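(* Let $Q$ be a closed unbounded self-adjoint operator on a complex Hilbert space $H$. Then $\mathcal{K}_{(H,\Gamma_Q)}$ is $\kappa$-stable for every (infinite, small) cardinal $\kappa\geq|\sigma(Q)|$.
   Context: All Hilbert spaces are complex. For a self-adjoint (densely defined, possibly unbounded) operator $Q$ on $H$, $\sigma(Q)$ is its spectrum and $\sigma_e(Q)$ is the set of $\lambda\in\mathbb{C}$ such that $(Q-\lambda I)S\neq I+K$ for every bounded $S$ and compact $K$ on $H$. $Q_1\sim_\sigma Q_2$ means: $\sigma(Q_1)=\sigma(Q_2)$, $\sigma_e(Q_1)=\sigma_e(Q_2)$, and the $\lambda$-eigenspaces of $Q_1$ and $Q_2$ have equal dimension for all $\lambda\in\sigma(Q_1)\setminus\sigma_e(Q_1)$. $(H,\Gamma_Q)$ denotes the metric structure consisting of the Hilbert space $H$ (with $0$, $+$, multiplication by $i$ and by rationals, the norm) and the predicate $\Gamma_Q(v,w)=$ distance from $(v,w)\in H\times H$ to the graph of the closed self-adjoint operator $Q$. $\mathcal{K}_{(H,\Gamma_Q)}$ is the class of all such structures $(H',\Gamma_{Q'})$ with $Q'\sim_\sigma Q$; $(H_1,\Gamma_{Q_1})\prec(H_2,\Gamma_{Q_2})$ iff $H_1\subseteq H_2$ and $Q_1\subseteq Q_2$. A $\mathcal{K}$-embedding $f:M\to N$ is an embedding of metric structures with $f(M)\prec N$. Galois types: for $M_1,M_2\in\mathcal{K}$, $A\subseteq M_1\cap M_2$, one writes $gatp_{M_1}((a_i)_{i<\alpha}/A)=gatp_{M_2}((b_i)_{i<\alpha}/A)$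 if there are $N\in\mathcal{K}$ and $\mathcal{K}$-embeddings $f:M_1\to N$, $g:M_2\to N$ with $f(a_i)=g(b_i)$ for all $i<\alpha$ and $f\upharpoonright A=g\upharpoonright A=\mathrm{Id}_A$. Monster model: for a fixed sufficiently large cardinal $\kappa^*$ (larger than the density of every structure to be studied), $(\tilde H,\Gamma_{\tilde Q})\in\mathcal{K}_{(H,\Gamma_Q)}$ is $\kappa^*$-universal (every $M\in\mathcal{K}$ with $|M|<\kappa^*$ has a $\mathcal{K}$-embedding into it) and $\kappa^*$-homogeneous (if two sequences of length $\alpha<\kappa^*$ in it have the property that all corresponding finite subtuples have the same Galois type over $\emptyset$, then some automorphism maps one sequence to the other). Small means of size $<\kappa^*$. For small $G\subseteq\tilde H$, $S(G)$ is the set of Galois types over $G$ of single vectors of $\tilde H$, with the metric $d(p,q)=\inf\{\|v-w\|: v\models p,\ w\models q\}$. $\mathcal{K}_{(H,\Gamma_Q)}$ is $\kappa$-stable if for every $G\subseteq\tilde H$ with $|G|\leq\kappa$, the metric space $S(G)$ has a dense subset of cardinality at most $\kappa$. *)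

theory Defs
  imports "HOL-Analysis.Analysis" "HOL-Algebra.Algebraic_Closure_Type"
begin

unbundle cardinal_syntax

text \<open>
  The paper's notions compare Hilbert spaces of varying size and inclusions between them, so a
  Hilbert space is a set-carried object inside a type \<open>'a\<close>: a \<open>module\<close> of HOL-Algebra over the
  complex field together with an inner product. The ring multiplication and unit which that record
  also contains are never used.
\<close>

record 'a hilb = "(complex, 'a) module" +
  cinner :: "'a \<Rightarrow> 'a \<Rightarrow> complex"

definition hnorm :: "('a, 'm) hilb_scheme \<Rightarrow> 'a \<Rightarrow> real" where
  "hnorm H x = sqrt (Re (cinner H x x))"

text \<open>
  The value outside the carrier is fixed because \<open>Metric_space\<close> requires symmetry and
  nonnegativity there as well.
\<close>
definition hdist :: "('a, 'm) hilb_scheme \<Rightarrow> 'a \<Rightarrow> 'a \<Rightarrow> real" where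
  "hdist H x y =
     (if x \<in> carrier H \<and> y \<in> carrier H then hnorm H (x \<ominus>\<^bsub>H\<^esub> y) else 0)"

abbreviation htopology :: "('a, 'm) hilb_scheme \<Rightarrow> 'a topology" where
  "htopology H \<equiv> Metric_space.mtopology (carrier H) (hdist H)"

locale complex_hilbert_space =
  Module.module "ring_of_type_algebra :: complex ring" H for H :: "('a, 'm) hilb_scheme" (structure) +
  assumes cinner_add: "\<lbrakk>x \<in> carrier H; y \<in> carrier H; z \<in> carrier H\<rbrakk> \<Longrightarrow>
      cinner H (x \<oplus> y) z = cinner H x z + cinner H y z"
    and cinner_smult: "\<lbrakk>x \<in> carrier H; y \<in> carrier H\<rbrakk> \<Longrightarrow>
      cinner H (c \<odot> x) y = c * cinner H x y"
    and cinner_commute: "\<lbrakk>x \<in> carrier H; y \<in> carrier H\<rbrakk> \<Longrightarrow>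
      cinner H y x = cnj (cinner H x y)"
    and cinner_nonneg: "x \<in> carrier H \<Longrightarrow> 0 \<le> Re (cinner H x x)"
    and cinner_eq_0: "\<lbrakk>x \<in> carrier H; cinner H x x = 0\<rbrakk> \<Longrightarrow> x = \<zero>"
    and complete: "Metric_space.mcomplete (carrier H) (hdist H)"

definition bounded_op :: "('a, 'm) hilb_scheme \<Rightarrow> ('a \<Rightarrow> 'a) \<Rightarrow> bool" where
  "bounded_op H S \<longleftrightarrow>
     S ` carrier H \<subseteq> carrier H \<and>
     (\<forall>x\<in>carrier H. \<forall>y\<in>carrier H. S (x \<oplus>\<^bsub>H\<^esub> y) = S x \<oplus>\<^bsub>H\<^esub> S y) \<and>
     (\<forall>c. \<forall>x\<in>carrier H. S (c \<odot>\<^bsub>H\<^esub> x) = c \<odot>\<^bsub>H\<^esub> S x) \<and>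
     (\<exists>B. \<forall>x\<in>carrier H. hnorm H (S x) \<le> B * hnorm H x)"

definition compact_op :: "('a, 'm) hilb_scheme \<Rightarrow> ('a \<Rightarrow> 'a) \<Rightarrow> bool" where
  "compact_op H S \<longleftrightarrow>
     bounded_op H S \<and>
     compactin (htopology H) (htopology H closure_of (S ` {x \<in> carrier H. hnorm H x \<le> 1}))"

text \<open>
  A Hilbert space with a partially defined operator, given by its graph. This represents both
  \<open>(H, Q)\<close> and the metric structure \<open>(H, \<Gamma>\<^sub>Q)\<close>; the predicate \<open>\<Gamma>\<^sub>Q\<close> is \<open>Gamma_pred\<close> below.
\<close>
record 'a hilb_op = "'a hilb" +
  graph :: "('a \<times> 'a) set"

definition Gamma_pred :: "'a hilb_op \<Rightarrow> 'a \<Rightarrow> 'a \<Rightarrow> real" where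
  "Gamma_pred M v w = (INF p\<in>graph M. prod_dist (hdist M) (hdist M) (v, w) p)"

definition linear_op :: "'a hilb_op \<Rightarrow> bool" where
  "linear_op M \<longleftrightarrow>
     graph M \<subseteq> carrier M \<times> carrier M \<and>
     single_valued (graph M) \<and>
     (\<zero>\<^bsub>M\<^esub>, \<zero>\<^bsub>M\<^esub>) \<in> graph M \<and>
     (\<forall>(x, y)\<in>graph M. \<forall>(x', y')\<in>graph M. (x \<oplus>\<^bsub>M\<^esub> x', y \<oplus>\<^bsub>M\<^esub> y') \<in> graph M) \<and>
     (\<forall>c. \<forall>(x, y)\<in>graph M. (c \<odot>\<^bsub>M\<^esub> x, c \<odot>\<^bsub>M\<^esub> y) \<in> graph M)"

definition densely_defined :: "'a hilb_op \<Rightarrow> bool" where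
  "densely_defined M \<longleftrightarrow> htopology M closure_of (Domain (graph M)) = carrier M"

definition closed_op :: "'a hilb_op \<Rightarrow> bool" where
  "closed_op M \<longleftrightarrow> closedin (prod_topology (htopology M) (htopology M)) (graph M)"

definition adjoint_graph :: "'a hilb_op \<Rightarrow> ('a \<times> 'a) set" where
  "adjoint_graph M =
     {(x, y) \<in> carrier M \<times> carrier M. \<forall>(u, w)\<in>graph M. cinner M w x = cinner M u y}"

definition self_adjoint :: "'a hilb_op \<Rightarrow> bool" where
  "self_adjoint M \<longleftrightarrow>
     linear_op M \<and> densely_defined M \<and> adjoint_graph M = graph M"

definition sa_structure :: "'a hilb_op \<Rightarrow> bool" where
  "sa_structure M \<longleftrightarrow> complex_hilbert_space M \<and> closed_op M \<and> self_adjoint M"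

definition unbounded_op :: "'a hilb_op \<Rightarrow> bool" where
  "unbounded_op M \<longleftrightarrow> \<not> (\<exists>B. \<forall>(x, y)\<in>graph M. hnorm M y \<le> B * hnorm M x)"

text \<open>The graph of \<open>Q - \<lambda>I\<close>.\<close>
definition shifted_graph :: "'a hilb_op \<Rightarrow> complex \<Rightarrow> ('a \<times> 'a) set" where
  "shifted_graph M l = {(x, y \<ominus>\<^bsub>M\<^esub> l \<odot>\<^bsub>M\<^esub> x) | x y. (x, y) \<in> graph M}"

definition spectrum :: "'a hilb_op \<Rightarrow> complex set" where
  "spectrum M =
     {l. \<not> (\<exists>S. bounded_op M S \<and>
              (\<forall>v\<in>carrier M. (S v, v) \<in> shifted_graph M l) \<and>
              (\<forall>(x, y)\<in>shifted_graph M l. S y = x))}"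

text \<open>
  The condition \<open>(S v, v \<oplus> K v) \<in> shifted_graph M l\<close> for all \<open>v\<close> is the operator equation
  \<open>(Q - \<lambda>I)S = I + K\<close>, including that \<open>S\<close> maps into the domain of \<open>Q\<close>.
\<close>
definition ess_spectrum :: "'a hilb_op \<Rightarrow> complex set" where
  "ess_spectrum M =
     {l. \<not> (\<exists>S K. bounded_op M S \<and> compact_op M K \<and>
              (\<forall>v\<in>carrier M. (S v, v \<oplus>\<^bsub>M\<^esub> K v) \<in> shifted_graph M l))}"

definition eigenspace :: "'a hilb_op \<Rightarrow> complex \<Rightarrow> 'a set" where
  "eigenspace M l = {x \<in> carrier M. (x, l \<odot>\<^bsub>M\<^esub> x) \<in> graph M}"

text \<open>An orthonormal basis of \<open>E\<close>, as a maximal orthonormal subset.\<close>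
definition orthonormal_basis :: "('a, 'm) hilb_scheme \<Rightarrow> 'a set \<Rightarrow> 'a set \<Rightarrow> bool" where
  "orthonormal_basis H E B \<longleftrightarrow>
     B \<subseteq> E \<and>
     (\<forall>x\<in>B. \<forall>y\<in>B. cinner H x y = (if x = y then 1 else 0)) \<and>
     (\<forall>x\<in>E. (\<forall>y\<in>B. cinner H x y = 0) \<longrightarrow> x = \<zero>\<^bsub>H\<^esub>)"

definition same_dim ::
    "('a, 'm) hilb_scheme \<Rightarrow> 'a set \<Rightarrow> ('a, 'm) hilb_scheme \<Rightarrow> 'a set \<Rightarrow> bool" where
  "same_dim H1 E1 H2 E2 \<longleftrightarrow>
     (\<exists>B1 B2. orthonormal_basis H1 E1 B1 \<and> orthonormal_basis H2 E2 B2 \<and> |B1| =o |B2| )"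

definition spectrally_equivalent :: "'a hilb_op \<Rightarrow> 'a hilb_op \<Rightarrow> bool" (infix \<open>\<sim>\<^sub>\<sigma>\<close> 50) where
  "M1 \<sim>\<^sub>\<sigma> M2 \<longleftrightarrow>
     spectrum M1 = spectrum M2 \<and>
     ess_spectrum M1 = ess_spectrum M2 \<and>
     (\<forall>l\<in>spectrum M1 - ess_spectrum M1. same_dim M1 (eigenspace M1 l) M2 (eigenspace M2 l))"

text \<open>
  The class \<open>\<K>\<close> of the structure \<open>M\<close>, restricted to structures whose underlying set lies in the
  type \<open>'a\<close>; see the remark on \<open>monster_model\<close>.
\<close>
definition K_class :: "'a hilb_op \<Rightarrow> 'a hilb_op set" where
  "K_class M = {M'. sa_structure M' \<and> M' \<sim>\<^sub>\<sigma> M}"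

definition K_sub :: "'a hilb_op \<Rightarrow> 'a hilb_op \<Rightarrow> bool" (infix \<open>\<prec>\<^sub>\<K>\<close> 50) where
  "M1 \<prec>\<^sub>\<K> M2 \<longleftrightarrow>
     carrier M1 \<subseteq> carrier M2 \<and>
     \<zero>\<^bsub>M1\<^esub> = \<zero>\<^bsub>M2\<^esub> \<and>
     (\<forall>x\<in>carrier M1. \<forall>y\<in>carrier M1. x \<oplus>\<^bsub>M1\<^esub> y = x \<oplus>\<^bsub>M2\<^esub> y) \<and>
     (\<forall>c. \<forall>x\<in>carrier M1. c \<odot>\<^bsub>M1\<^esub> x = c \<odot>\<^bsub>M2\<^esub> x) \<and>
     (\<forall>x\<in>carrier M1. \<forall>y\<in>carrier M1. cinner M1 x y = cinner M2 x y) \<and>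
     graph M1 \<subseteq> graph M2"

text \<open>
  Embeddings of metric structures in the language with \<open>0\<close>, \<open>+\<close>, multiplication by \<open>\<i>\<close> and by
  rationals, the norm and \<open>\<Gamma>\<close>.
\<close>
definition metric_embedding :: "'a hilb_op \<Rightarrow> 'a hilb_op \<Rightarrow> ('a \<Rightarrow> 'a) \<Rightarrow> bool" where
  "metric_embedding M N f \<longleftrightarrow>
     f ` carrier M \<subseteq> carrier N \<and>
     f \<zero>\<^bsub>M\<^esub> = \<zero>\<^bsub>N\<^esub> \<and>
     (\<forall>x\<in>carrier M. \<forall>y\<in>carrier M. f (x \<oplus>\<^bsub>M\<^esub> y) = f x \<oplus>\<^bsub>N\<^esub> f y) \<and>
     (\<forall>x\<in>carrier M. f (\<i> \<odot>\<^bsub>M\<^esub> x) = \<i> \<odot>\<^bsub>N\<^esub> f x) \<and>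
     (\<forall>q :: rat. \<forall>x\<in>carrier M. f (of_rat q \<odot>\<^bsub>M\<^esub> x) = of_rat q \<odot>\<^bsub>N\<^esub> f x) \<and>
     (\<forall>x\<in>carrier M. hnorm N (f x) = hnorm M x) \<and>
     (\<forall>x\<in>carrier M. \<forall>y\<in>carrier M. Gamma_pred N (f x) (f y) = Gamma_pred M x y)"

text \<open>\<open>f(M)\<close>, with the operations of \<open>N\<close> and the operator transported from \<open>M\<close>.\<close>
definition image_structure :: "('a \<Rightarrow> 'a) \<Rightarrow> 'a hilb_op \<Rightarrow> 'a hilb_op \<Rightarrow> 'a hilb_op" where
  "image_structure f M N = N\<lparr>carrier := f ` carrier M, graph := map_prod f f ` graph M\<rparr>"

definition K_embedding :: "'a hilb_op \<Rightarrow> 'a hilb_op \<Rightarrow> ('a \<Rightarrow> 'a) \<Rightarrow> bool" where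
  "K_embedding M N f \<longleftrightarrow> metric_embedding M N f \<and> image_structure f M N \<prec>\<^sub>\<K> N"

definition automorphism :: "'a hilb_op \<Rightarrow> ('a \<Rightarrow> 'a) \<Rightarrow> bool" where
  "automorphism M f \<longleftrightarrow> metric_embedding M M f \<and> bij_betw f (carrier M) (carrier M)"

text \<open>
  \<open>gatp_eq M0 I M1 a M2 b A\<close>: the families \<open>a\<close> in \<open>M1\<close> and \<open>b\<close> in \<open>M2\<close>, indexed by \<open>I\<close>, have the
  same Galois type over \<open>A\<close> with respect to the class of \<open>M0\<close>.
\<close>
definition gatp_eq ::
    "'a hilb_op \<Rightarrow> 'i set \<Rightarrow> 'a hilb_op \<Rightarrow> ('i \<Rightarrow> 'a) \<Rightarrow> 'a hilb_op \<Rightarrow> ('i \<Rightarrow> 'a) \<Rightarrow> 'a set \<Rightarrow> bool"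
where
  "gatp_eq M0 I M1 a M2 b A \<longleftrightarrow>
     M1 \<in> K_class M0 \<and> M2 \<in> K_class M0 \<and> A \<subseteq> carrier M1 \<inter> carrier M2 \<and>
     a ` I \<subseteq> carrier M1 \<and> b ` I \<subseteq> carrier M2 \<and>
     (\<exists>N\<in>K_class M0. \<exists>f g. K_embedding M1 N f \<and> K_embedding M2 N g \<and>
        (\<forall>i\<in>I. f (a i) = g (b i)) \<and> (\<forall>x\<in>A. f x = x \<and> g x = x))"

definition K_universal :: "'a hilb_op \<Rightarrow> 'a rel \<Rightarrow> 'a hilb_op \<Rightarrow> bool" where
  "K_universal M0 kstar Mt \<longleftrightarrow>
     (\<forall>M\<in>K_class M0. |carrier M| <o kstar \<longrightarrow> (\<exists>f. K_embedding M Mt f))"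

text \<open>
  The two sequences are families over an index set \<open>I\<close> with fewer than \<open>kstar\<close> elements; the
  order of the indices plays no role.
\<close>
definition K_homogeneous :: "'a hilb_op \<Rightarrow> 'a rel \<Rightarrow> 'a hilb_op \<Rightarrow> bool" where
  "K_homogeneous M0 kstar Mt \<longleftrightarrow>
     (\<forall>(I :: 'a set) a b.
        |I| <o kstar \<and> a ` I \<subseteq> carrier Mt \<and> b ` I \<subseteq> carrier Mt \<and>
        (\<forall>F. F \<subseteq> I \<and> finite F \<longrightarrow> gatp_eq M0 F Mt a Mt b {}) \<longrightarrow>
        (\<exists>f. automorphism Mt f \<and> (\<forall>i\<in>I. f (a i) = b i)))"

text \<open>
  The cardinal \<open>kstar\<close> is a well-order on a subset of \<open>'a\<close>, so \<open>kstar \<le>o |UNIV :: 'a set|\<close>: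
  every structure with fewer than \<open>kstar\<close> elements has an isomorphic copy inside \<open>'a\<close>, every
  index set with fewer than \<open>kstar\<close> elements has a copy inside \<open>'a\<close>, and the type \<open>'a\<close> has room
  for the amalgams over small sets which witness equality of Galois types. Hence nothing is lost
  by restricting the class to structures inside \<open>'a\<close>. The density of the given structure is
  required to be less than \<open>kstar\<close>.
\<close>
definition monster_model :: "'a hilb_op \<Rightarrow> 'a rel \<Rightarrow> 'a hilb_op \<Rightarrow> bool" where
  "monster_model M0 kstar Mt \<longleftrightarrow>
     Cinfinite kstar \<and>
     (\<exists>D \<subseteq> carrier M0. htopology M0 closure_of D = carrier M0 \<and> |D| <o kstar) \<and>
     Mt \<in> K_class M0 \<and> K_universal M0 kstar Mt \<and> K_homogeneous M0 kstar Mt"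

text \<open>
  Galois types over \<open>G\<close> of single vectors of the monster model, as equivalence classes; a vector
  realizes a type iff it is an element of the class.
\<close>
definition galois_types :: "'a hilb_op \<Rightarrow> 'a hilb_op \<Rightarrow> 'a set \<Rightarrow> 'a set set" where
  "galois_types M0 Mt G =
     carrier Mt // {(v, w). gatp_eq M0 (UNIV :: unit set) Mt (\<lambda>_. v) Mt (\<lambda>_. w) G}"

definition type_dist :: "'a hilb_op \<Rightarrow> 'a set \<Rightarrow> 'a set \<Rightarrow> real" where
  "type_dist Mt p q = Inf {hnorm Mt (v \<ominus>\<^bsub>Mt\<^esub> w) | v w. v \<in> p \<and> w \<in> q}"

definition kappa_stable :: "'a hilb_op \<Rightarrow> 'a hilb_op \<Rightarrow> 'k rel \<Rightarrow> bool" where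
  "kappa_stable M0 Mt \<kappa> \<longleftrightarrow>
     (\<forall>G \<subseteq> carrier Mt. |G| \<le>o \<kappa> \<longrightarrow>
        (\<exists>D \<subseteq> galois_types M0 Mt G. |D| \<le>o \<kappa> \<and>
           (\<forall>p\<in>galois_types M0 Mt G. \<forall>e>0. \<exists>q\<in>D. type_dist Mt p q < e)))"

end

theory Submission
  imports Defs
begin

text \<open>
  Let \<open>H\<close> be the monster model and \<open>G\<close> a set of at most \<open>\<kappa>\<close> parameters. The Cayley transform \<open>U\<close> of
  the operator \<open>Q\<close> is unitary and determines \<open>Q\<close>; a closed subspace reduces \<open>Q\<close> iff it is invariant
  under \<open>U\<close> and its inverse. Let \<open>K\<close> be the reducing subspace generated by \<open>G\<close> together with bases of
  the eigenspaces for spectral points outside the essential spectrum. There are at most \<open>\<kappa>\<close> such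
  points, and their eigenspaces are finite-dimensional (\<open>finite_orthonormal_eigenvectors\<close>), so \<open>K\<close> has
  a dense subset of size at most \<open>\<kappa>\<close>. Every vector is a sum \<open>h + v\<close> with \<open>h\<close> in \<open>K\<close> and \<open>v\<close> orthogonal
  to \<open>K\<close>, and the problem is to find few types for the second summand.

  If \<open>v\<close> and \<open>u\<close> lie in reducing subspaces \<open>A\<close> and \<open>B\<close> orthogonal to \<open>K\<close>, and a unitary operator from \<open>B\<close>
  to \<open>A\<close> commutes with \<open>Q\<close> and maps \<open>u\<close> to \<open>v\<close>, then \<open>h + v\<close> and \<open>h + u\<close> have the same type over \<open>G\<close>
  (\<open>same_typeI\<close>). Indeed the sum of \<open>H\<close> and a copy of \<open>A\<close> is again in the class: it has the same
  spectrum and essential spectrum, and no discrete eigenvector is added since \<open>A\<close> is orthogonal to \<open>K\<close>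
  (\<open>N_in_K_class\<close>). Moving \<open>A\<close>, respectively \<open>B\<close>, to the new summand gives two embeddings of \<open>H\<close> into
  this sum that agree on \<open>K\<close> and identify the two vectors (\<open>K_embedding_embed_sum\<close>, \<open>gatp_eqI\<close>). The
  unitary operator exists as soon as \<open>A\<close> and \<open>B\<close> are spanned by families with equal Gram matrices on
  which \<open>U\<close> acts in the same way (\<open>transfer_exists\<close>, \<open>Tr_cayley\<close>).

  If \<open>\<kappa>\<close> is at least the continuum, the orbits of \<open>v\<close> and \<open>u\<close> under \<open>U\<close> serve as these families, and the
  type is determined by \<open>h\<close> and the moments \<open>\<langle>U\<^sup>n v, v\<rangle>\<close> (\<open>dense_types_continuum\<close>). Otherwise the
  spectrum has fewer points than the continuum. A nonzero reducing subspace without eigenvectors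
  would contribute a nonempty perfect set of approximate eigenvalues to the spectrum, hence continuum
  many points (\<open>continuum_le_spectrum\<close>). This avoids the spectral theorem: a gap of the spectrum is
  controlled by the Cauchy-Schwarz inequality for a positive form (\<open>spectral_gap\<close>), and an isolated
  point of the spectrum is an eigenvalue by polarization (\<open>approx_eig_not_isolated\<close>). So eigenvectors
  are total in the complement of \<open>K\<close>. Rotating the component of \<open>v\<close> in each eigenspace separately moves
  \<open>v\<close> to the closed span of one fixed unit vector for each of the at most \<open>\<kappa>\<close> eigenvalues
  (\<open>dense_types_eigenvectors\<close>).

  The amalgams are built on the underlying type of the given structures and the embeddings have to
  fix \<open>G\<close> pointwise, which is possible if \<open>H\<close> has more than \<open>\<kappa>\<close> elements (\<open>exists_coding\<close>). If it has
  not, then there are at most \<open>\<kappa>\<close> types.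
\<close>

section \<open>Inner product geometry on a carrier\<close>

text \<open>
  Completeness is separated from the algebraic axioms so that the inner product geometry is
  available while completeness of a constructed space is still being proved.
\<close>
locale inner_product_space =
  Module.module "ring_of_type_algebra :: complex ring" H for H :: "('a, 'm) hilb_scheme" (structure) +
  assumes cinner_add: "\<lbrakk>x \<in> carrier H; y \<in> carrier H; z \<in> carrier H\<rbrakk> \<Longrightarrow>
      cinner H (x \<oplus> y) z = cinner H x z + cinner H y z"
    and cinner_smult: "\<lbrakk>x \<in> carrier H; y \<in> carrier H\<rbrakk> \<Longrightarrow>
      cinner H (c \<odot> x) y = c * cinner H x y"
    and cinner_commute: "\<lbrakk>x \<in> carrier H; y \<in> carrier H\<rbrakk> \<Longrightarrow>
      cinner H y x = cnj (cinner H x y)"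
    and cinner_nonneg: "x \<in> carrier H \<Longrightarrow> 0 \<le> Re (cinner H x x)"
    and cinner_eq_0: "\<lbrakk>x \<in> carrier H; cinner H x x = 0\<rbrakk> \<Longrightarrow> x = \<zero>"
begin

abbreviation V :: "'a set" where "V \<equiv> carrier H"
abbreviation ip :: "'a \<Rightarrow> 'a \<Rightarrow> complex" where "ip \<equiv> cinner H"
abbreviation nm :: "'a \<Rightarrow> real" where "nm \<equiv> hnorm H"

lemma smult_in [simp, intro]: "x \<in> V \<Longrightarrow> c \<odot> x \<in> V"
  using smult_closed[of c x] by (simp add: ring_of_type_algebra_def)

lemma ip_add_right: "\<lbrakk>x \<in> V; y \<in> V; z \<in> V\<rbrakk> \<Longrightarrow> ip x (y \<oplus> z) = ip x y + ip x z"
  by (metis cinner_add cinner_commute complex_cnj_add M.a_closed)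

lemma ip_smult_right: "\<lbrakk>x \<in> V; y \<in> V\<rbrakk> \<Longrightarrow> ip x (c \<odot> y) = cnj c * ip x y"
  by (metis cinner_smult cinner_commute complex_cnj_mult smult_in)

lemma ip_zero_left [simp]: "x \<in> V \<Longrightarrow> ip \<zero> x = 0"
  using cinner_add[of "\<zero>" "\<zero>" x] by simp

lemma ip_zero_right [simp]: "x \<in> V \<Longrightarrow> ip x \<zero> = 0"
  using ip_add_right[of x "\<zero>" "\<zero>"] by simp

lemma ip_neg_left: "\<lbrakk>x \<in> V; y \<in> V\<rbrakk> \<Longrightarrow> ip (\<ominus> x) y = - ip x y"
  using cinner_add[of "\<ominus> x" x y] by (simp add: M.l_neg eq_neg_iff_add_eq_0)

lemma ip_neg_right: "\<lbrakk>x \<in> V; y \<in> V\<rbrakk> \<Longrightarrow> ip x (\<ominus> y) = - ip x y"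
  using ip_add_right[of x "\<ominus> y" y] by (simp add: M.l_neg eq_neg_iff_add_eq_0)

lemma ip_minus_left: "\<lbrakk>x \<in> V; y \<in> V; z \<in> V\<rbrakk> \<Longrightarrow> ip (x \<ominus> y) z = ip x z - ip y z"
  by (simp add: a_minus_def cinner_add ip_neg_left)

lemma ip_minus_right: "\<lbrakk>x \<in> V; y \<in> V; z \<in> V\<rbrakk> \<Longrightarrow> ip x (y \<ominus> z) = ip x y - ip x z"
  by (simp add: a_minus_def ip_add_right ip_neg_right)

lemmas ip_simps = cinner_add cinner_smult ip_add_right ip_smult_right ip_neg_left ip_neg_right
  ip_minus_left ip_minus_right

lemma minus_in [simp, intro]: "\<lbrakk>x \<in> V; y \<in> V\<rbrakk> \<Longrightarrow> x \<ominus> y \<in> V"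
  by (rule M.minus_closed)

lemma minus_eq_zeroD: "\<lbrakk>x \<in> V; y \<in> V; x \<ominus> y = \<zero>\<rbrakk> \<Longrightarrow> x = y"
  using M.minus_equality[of x "\<ominus> y"] by (simp add: a_minus_def)

text \<open>
  Testing against all vectors reduces every vector identity to an identity between complex
  numbers; this replaces rewriting with the module axioms throughout.
\<close>
lemma ip_eqI:
  assumes "x \<in> V" "y \<in> V" "\<And>z. z \<in> V \<Longrightarrow> ip x z = ip y z"
  shows "x = y"
proof -
  have "ip (x \<ominus> y) (x \<ominus> y) = 0"
    using assms by (simp add: ip_minus_left)
  then have "x \<ominus> y = \<zero>"
    using cinner_eq_0 assms by blast
  then show ?thesis
    using assms minus_eq_zeroD by blast
qed

lemma ip_self: "x \<in> V \<Longrightarrow> ip x x = of_real ((nm x)\<^sup>2)"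
  using cinner_commute[of x x] cinner_nonneg[of x]
  by (auto simp: hnorm_def complex_eq_iff)

lemma nm_nonneg [simp]: "0 \<le> nm x" if "x \<in> V"
  using cinner_nonneg[OF that] by (simp add: hnorm_def)

lemma nm_zero [simp]: "nm \<zero> = 0"
  by (simp add: hnorm_def)

lemma nm_eq_0: "x \<in> V \<Longrightarrow> nm x = 0 \<longleftrightarrow> x = \<zero>"
  using ip_self[of x] cinner_eq_0[of x] by auto

lemma nm_sq: "x \<in> V \<Longrightarrow> (nm x)\<^sup>2 = Re (ip x x)"
  by (simp add: ip_self)

lemma nm_smult [simp]: "x \<in> V \<Longrightarrow> nm (c \<odot> x) = cmod c * nm x"
proof -
  assume x: "x \<in> V"
  have "complex_of_real ((nm (c \<odot> x))\<^sup>2) = c * cnj c * of_real ((nm x)\<^sup>2)"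
    using x ip_self[of "c \<odot> x"] ip_self[of x] by (simp add: ip_simps mult.left_commute mult.assoc)
  also have "c * cnj c = of_real ((cmod c)\<^sup>2)"
    using complex_norm_square by simp
  finally have "(nm (c \<odot> x))\<^sup>2 = (cmod c * nm x)\<^sup>2"
    by (simp add: power_mult_distrib flip: of_real_mult of_real_power)
  then show ?thesis
    using x by (simp add: power2_eq_iff_nonneg)
qed

lemma nm_minus_commute: "\<lbrakk>x \<in> V; y \<in> V\<rbrakk> \<Longrightarrow> nm (x \<ominus> y) = nm (y \<ominus> x)"
  by (simp add: hnorm_def ip_simps algebra_simps)

lemma ip_cs: "cmod (ip x y) \<le> nm x * nm y" if x: "x \<in> V" and y: "y \<in> V"
proof (cases "nm y = 0")
  case True
  then show ?thesis using x y nm_eq_0 by simp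
next
  case False
  then have ny: "(nm y)\<^sup>2 > 0" by simp
  define t where "t = ip x y / of_real ((nm y)\<^sup>2)"
  have cyx: "ip y x = cnj (ip x y)" using cinner_commute[OF x y] .
  have "0 \<le> Re (ip (x \<ominus> t \<odot> y) (x \<ominus> t \<odot> y))"
    by (intro cinner_nonneg minus_in smult_in x y)
  also have "ip (x \<ominus> t \<odot> y) (x \<ominus> t \<odot> y)
      = ip x x - cnj t * ip x y - t * cnj (ip x y) + t * cnj t * ip y y"
    using x y by (simp add: ip_simps cyx algebra_simps)
  also have "\<dots> = of_real ((nm x)\<^sup>2) - ip x y * cnj (ip x y) / of_real ((nm y)\<^sup>2)"
    using ny x y by (simp add: t_def ip_self field_simps power2_eq_square)
  also have "\<dots> = of_real ((nm x)\<^sup>2 - (cmod (ip x y))\<^sup>2 / (nm y)\<^sup>2)"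
    by (simp add: complex_norm_square[symmetric] flip: of_real_power)
  finally have "(cmod (ip x y))\<^sup>2 \<le> (nm x)\<^sup>2 * (nm y)\<^sup>2"
    using ny by (simp add: field_simps)
  then show ?thesis
    using x y by (metis nm_nonneg mult_nonneg_nonneg power2_le_imp_le power_mult_distrib)
qed

lemma nm_triangle: "nm (x \<oplus> y) \<le> nm x + nm y" if x: "x \<in> V" and y: "y \<in> V"
proof -
  have "(nm (x \<oplus> y))\<^sup>2 = (nm x)\<^sup>2 + (nm y)\<^sup>2 + 2 * Re (ip x y)"
    using x y cinner_commute[OF x y] by (simp add: nm_sq ip_simps)
  moreover have "Re (ip x y) \<le> nm x * nm y"
    using ip_cs[OF x y] complex_Re_le_cmod[of "ip x y"] by linarith
  ultimately have "(nm (x \<oplus> y))\<^sup>2 \<le> (nm x + nm y)\<^sup>2"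
    by (simp add: power2_sum)
  then show ?thesis
    by (rule power2_le_imp_le[OF _ add_nonneg_nonneg[OF nm_nonneg[OF x] nm_nonneg[OF y]]])
qed

lemma nm_triangle_minus: "nm (x \<ominus> y) \<le> nm x + nm y" if "x \<in> V" "y \<in> V"
proof -
  have "nm (x \<oplus> (\<ominus> y)) \<le> nm x + nm (\<ominus> y)"
    using that by (intro nm_triangle) auto
  then show ?thesis using that by (simp add: a_minus_def hnorm_def ip_simps)
qed

lemma nm_diff_triangle: "nm (x \<ominus> z) \<le> nm (x \<ominus> y) + nm (y \<ominus> z)"
  if "x \<in> V" "y \<in> V" "z \<in> V"
proof -
  have "x \<ominus> z = (x \<ominus> y) \<oplus> (y \<ominus> z)"
    by (rule ip_eqI) (use that in \<open>auto simp: ip_simps\<close>)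
  then have "nm (x \<ominus> z) = nm ((x \<ominus> y) \<oplus> (y \<ominus> z))" by (rule arg_cong[where f = nm])
  also have "\<dots> \<le> nm (x \<ominus> y) + nm (y \<ominus> z)"
    using that by (intro nm_triangle) auto
  finally show ?thesis .
qed

lemma nm_le_diff: "nm x \<le> nm y + nm (x \<ominus> y)" if "x \<in> V" "y \<in> V"
proof -
  have "x = y \<oplus> (x \<ominus> y)"
    by (rule ip_eqI) (use that in \<open>auto simp: ip_simps\<close>)
  then have "nm x = nm (y \<oplus> (x \<ominus> y))" by (rule arg_cong[where f = nm])
  also have "\<dots> \<le> nm y + nm (x \<ominus> y)"
    using that by (intro nm_triangle) auto
  finally show ?thesis .
qed

lemma minus_self [simp]: "x \<in> V \<Longrightarrow> x \<ominus> x = \<zero>"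
  by (rule ip_eqI) (auto simp: ip_simps)

lemma nm_pos: "\<lbrakk>x \<in> V; x \<noteq> \<zero>\<rbrakk> \<Longrightarrow> nm x > 0"
  using nm_eq_0[of x] nm_nonneg[of x] by (simp add: less_le)

lemma hdist_eq: "\<lbrakk>x \<in> V; y \<in> V\<rbrakk> \<Longrightarrow> hdist H x y = nm (x \<ominus> y)"
  by (simp add: hdist_def)

sublocale MS: Metric_space V "hdist H"
proof
  show "0 \<le> hdist H x y" for x y
    by (simp add: hdist_def)
  show "hdist H x y = hdist H y x" for x y
    by (simp add: hdist_def nm_minus_commute)
  show "\<lbrakk>x \<in> V; y \<in> V\<rbrakk> \<Longrightarrow> hdist H x y = 0 \<longleftrightarrow> x = y" for x y
    using minus_eq_zeroD[of x y] by (auto simp: hdist_def nm_eq_0)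
  show "\<lbrakk>x \<in> V; y \<in> V; z \<in> V\<rbrakk> \<Longrightarrow> hdist H x z \<le> hdist H x y + hdist H y z" for x y z
    by (simp add: hdist_def nm_diff_triangle)
qed

definition tends :: "(nat \<Rightarrow> 'a) \<Rightarrow> 'a \<Rightarrow> bool" where
  "tends s x \<longleftrightarrow> range s \<subseteq> V \<and> x \<in> V \<and> (\<lambda>n. nm (s n \<ominus> x)) \<longlonglongrightarrow> 0"

lemma tendsD: "tends s x \<Longrightarrow> s n \<in> V" "tends s x \<Longrightarrow> x \<in> V"
  "tends s x \<Longrightarrow> (\<lambda>n. nm (s n \<ominus> x)) \<longlonglongrightarrow> 0"
  by (auto simp: tends_def)

lemma tends_ip:
  assumes "tends s x" "y \<in> V"
  shows "(\<lambda>n. ip (s n) y) \<longlonglongrightarrow> ip x y"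
proof -
  have lim: "(\<lambda>n. nm (s n \<ominus> x) * nm y) \<longlonglongrightarrow> 0"
    using tendsto_mult_right[OF tendsD(3)[OF assms(1)], of "nm y"] by simp
  have *: "cmod (ip (s n) y - ip x y) \<le> nm (s n \<ominus> x) * nm y" for n
    using ip_cs[of "s n \<ominus> x" y] tendsD[OF assms(1)] assms(2) by (simp add: ip_simps)
  have "(\<lambda>n. ip (s n) y - ip x y) \<longlonglongrightarrow> 0"
    by (rule Lim_null_comparison[OF _ lim]) (use * in auto)
  then show ?thesis
    by (simp add: LIM_zero_iff)
qed

lemma tends_ip_right:
  assumes "tends s x" "y \<in> V"
  shows "(\<lambda>n. ip y (s n)) \<longlonglongrightarrow> ip y x"
proof -
  have "(\<lambda>n. cnj (ip (s n) y)) \<longlonglongrightarrow> cnj (ip x y)"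
    using tends_ip[OF assms] by (intro tendsto_intros)
  then show ?thesis
    using tendsD[OF assms(1)] assms(2) by (simp add: cinner_commute[symmetric])
qed

lemma limitin_tends:
  assumes "range s \<subseteq> V"
  shows "limitin MS.mtopology s x sequentially \<longleftrightarrow> tends s x"
proof (cases "x \<in> V")
  case True
  then have "(\<lambda>n. hdist H (s n) x) = (\<lambda>n. nm (s n \<ominus> x))"
    using assms by (intro ext hdist_eq) auto
  then show ?thesis
    using True assms by (simp add: MS.limitin_metric_dist_null tends_def image_subset_iff)
qed (simp add: MS.limitin_metric_dist_null tends_def)

lemma closure_of_eq_iff:
  assumes "D \<subseteq> V"
  shows "MS.mtopology closure_of D = V \<longleftrightarrow> (\<forall>x\<in>V. \<forall>e>0. \<exists>d\<in>D. nm (x \<ominus> d) < e)"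
proof -
  have "MS.mtopology closure_of D = {x \<in> V. \<forall>e>0. \<exists>d\<in>D. nm (x \<ominus> d) < e}"
    using assms by (auto simp: MS.metric_closure_of hdist_eq subset_iff) (metis hdist_eq)+
  then show ?thesis by blast
qed

end

sublocale complex_hilbert_space \<subseteq> inner_product_space H
  by unfold_locales
    (blast intro: cinner_add cinner_smult cinner_commute cinner_nonneg cinner_eq_0)+

lemma MCauchy_dominated:
  fixes x :: "nat \<Rightarrow> 'a" and y :: "nat \<Rightarrow> 'b"
  assumes "Metric_space A d" "Metric_space B d'" "Metric_space.MCauchy A d x" "\<And>n. y n \<in> B"
    and le: "\<And>m n. d' (y m) (y n) \<le> d (x m) (x n)"
  shows "Metric_space.MCauchy B d' y"
  unfolding Metric_space.MCauchy_def[OF assms(2)]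
proof (intro conjI allI impI)
  fix e :: real assume "e > 0"
  then obtain k where "\<And>n n'. k \<le> n \<Longrightarrow> k \<le> n' \<Longrightarrow> d (x n) (x n') < e"
    using assms(3) unfolding Metric_space.MCauchy_def[OF assms(1)] by blast
  then show "\<exists>k. \<forall>n n'. k \<le> n \<longrightarrow> k \<le> n' \<longrightarrow> d' (y n) (y n') < e"
    using le by (meson le_less_trans)
qed (use assms(4) in auto)

context complex_hilbert_space
begin

lemma cauchy_tends:
  assumes "MS.MCauchy s"
  obtains x where "tends s x"
proof -
  have s: "range s \<subseteq> V" using assms by (simp add: MS.MCauchy_def)
  obtain x where "limitin MS.mtopology s x sequentially"
    using complete assms by (auto simp: MS.mcomplete_def)
  then show ?thesis using that limitin_tends[OF s] by simp
qed

end

section \<open>Families with equal Gram matrices\<close>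

context complex_hilbert_space
begin

text \<open>
  The coefficients of a finite linear combination are kept as a list, so that they can be applied
  to a second family with the same index set.
\<close>
primrec lc :: "('i \<Rightarrow> 'a) \<Rightarrow> (complex \<times> 'i) list \<Rightarrow> 'a" where
  "lc a [] = \<zero>"
| "lc a (p # xs) = (fst p \<odot> a (snd p)) \<oplus> lc a xs"

lemma lc_in [simp]: "(\<And>i. a i \<in> V) \<Longrightarrow> lc a xs \<in> V"
  by (induction xs) auto

lemma ip_lc_left:
  assumes "\<And>i. a i \<in> V" "y \<in> V"
  shows "ip (lc a xs) y = (\<Sum>p\<leftarrow>xs. fst p * ip (a (snd p)) y)"
  using assms by (induction xs) (auto simp: ip_simps)

lemma ip_lc_right:
  assumes "\<And>i. a i \<in> V" "y \<in> V"
  shows "ip y (lc a xs) = (\<Sum>p\<leftarrow>xs. cnj (fst p) * ip y (a (snd p)))"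
  using assms by (induction xs) (auto simp: ip_simps)

lemma lc_append: "(\<And>i. a i \<in> V) \<Longrightarrow> lc a (xs @ ys) = lc a xs \<oplus> lc a ys"
  by (rule ip_eqI) (auto simp: ip_simps ip_lc_left)

lemma lc_scale: "(\<And>i. a i \<in> V) \<Longrightarrow> lc a (map (apfst ((*) t)) xs) = t \<odot> lc a xs"
  by (induction xs) (auto intro!: ip_eqI simp: ip_simps algebra_simps)

text \<open>
  The values \<open>y + s x\<close> for \<open>(x, y)\<close> in the graph of a linear operator form a subspace; hence what
  is approximated by linear combinations of such values is approximated by the values.
\<close>
lemma lc_pairs:
  assumes V: "\<And>x y. (x, y) \<in> g \<Longrightarrow> x \<in> V \<and> y \<in> V" and z: "(\<zero>, \<zero>) \<in> g"
    and lin: "\<And>t u w x y. \<lbrakk>(u, w) \<in> g; (x, y) \<in> g\<rbrakk> \<Longrightarrow> (t \<odot> u \<oplus> x, t \<odot> w \<oplus> y) \<in> g"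
  obtains x y where "(x, y) \<in> g"
    "lc (\<lambda>p. if p \<in> g then snd p \<oplus> s \<odot> fst p else \<zero>) xs = y \<oplus> s \<odot> x"
proof -
  let ?a = "\<lambda>p. if p \<in> g then snd p \<oplus> s \<odot> fst p else \<zero>"
  have zz: "\<zero> = \<zero> \<oplus> s \<odot> \<zero>" by (rule ip_eqI) (auto simp: ip_simps)
  have "\<exists>x y. (x, y) \<in> g \<and> lc ?a xs = y \<oplus> s \<odot> x"
  proof (induction xs)
    case Nil
    then show ?case using z zz by fastforce
  next
    case (Cons p xs)
    then obtain x y where xy: "(x, y) \<in> g" "lc ?a xs = y \<oplus> s \<odot> x" by blast
    obtain t q where p: "p = (t, q)" by (cases p)
    obtain u w where uw: "(u, w) \<in> g" "?a q = w \<oplus> s \<odot> u"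
    proof (cases "q \<in> g")
      case True
      then show ?thesis using that[of "fst q" "snd q"] by simp
    next
      case False
      then show ?thesis using that[OF z] zz by simp
    qed
    have "lc ?a (p # xs) = t \<odot> ?a q \<oplus> lc ?a xs"
      unfolding p by simp
    also have "\<dots> = t \<odot> (w \<oplus> s \<odot> u) \<oplus> (y \<oplus> s \<odot> x)"
      by (simp only: xy uw)
    also have "\<dots> = (t \<odot> w \<oplus> y) \<oplus> s \<odot> (t \<odot> u \<oplus> x)"
      using V[OF xy(1)] V[OF uw(1)] by (intro ip_eqI) (auto simp: ip_simps algebra_simps)
    finally show ?case
      using lin[OF uw(1) xy(1), of t] by blast
  qed
  then show ?thesis using that by blast
qed

definition same_gram :: "('i \<Rightarrow> 'a) \<Rightarrow> ('i \<Rightarrow> 'a) \<Rightarrow> bool" where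
  "same_gram a b \<longleftrightarrow> (\<forall>i. a i \<in> V) \<and> (\<forall>i. b i \<in> V) \<and> (\<forall>i j. ip (a i) (a j) = ip (b i) (b j))"

lemma same_gramD:
  assumes "same_gram a b"
  shows "a i \<in> V" "b i \<in> V" "ip (a i) (a j) = ip (b i) (b j)"
  using assms by (auto simp: same_gram_def)

lemma same_gram_refl: "(\<And>i. a i \<in> V) \<Longrightarrow> same_gram a a"
  by (simp add: same_gram_def)

lemma same_gram_sym: "same_gram a b \<Longrightarrow> same_gram b a"
  by (simp add: same_gram_def)

lemma same_gram_trans: "same_gram a b \<Longrightarrow> same_gram b c \<Longrightarrow> same_gram a c"
  by (simp add: same_gram_def)

lemma ip_lc_gram:
  assumes "same_gram a b"
  shows "ip (lc a xs) (lc a ys) = ip (lc b xs) (lc b ys)"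
  using same_gramD[OF assms] by (simp add: ip_lc_left ip_lc_right)

text \<open>
  The closed span of a family, as a double orthogonal complement. In this form it is visibly closed
  under sums, limits and every operator that preserves the orthogonal complement of the family.
\<close>
definition Cl :: "('i \<Rightarrow> 'a) \<Rightarrow> 'a set" where
  "Cl a = {z \<in> V. \<forall>y\<in>V. (\<forall>i. ip y (a i) = 0) \<longrightarrow> ip z y = 0}"

lemma ClD: "z \<in> Cl a \<Longrightarrow> z \<in> V"
  "z \<in> Cl a \<Longrightarrow> y \<in> V \<Longrightarrow> (\<And>i. ip y (a i) = 0) \<Longrightarrow> ip z y = 0"
  by (auto simp: Cl_def)

lemma ip_eq_0_commute: "\<lbrakk>x \<in> V; y \<in> V\<rbrakk> \<Longrightarrow> ip x y = 0 \<longleftrightarrow> ip y x = 0"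
  using cinner_commute[of x y] by auto

lemma Cl_self: "(\<And>i. a i \<in> V) \<Longrightarrow> a i \<in> Cl a"
  by (auto simp: Cl_def ip_eq_0_commute)

lemma Cl_zero [simp]: "\<zero> \<in> Cl a"
  and Cl_add: "\<lbrakk>x \<in> Cl a; y \<in> Cl a\<rbrakk> \<Longrightarrow> x \<oplus> y \<in> Cl a"
  and Cl_smult: "x \<in> Cl a \<Longrightarrow> c \<odot> x \<in> Cl a"
  and Cl_minus: "\<lbrakk>x \<in> Cl a; y \<in> Cl a\<rbrakk> \<Longrightarrow> x \<ominus> y \<in> Cl a"
  by (auto simp: Cl_def ip_simps)

lemma Cl_lc: "(\<And>i. a i \<in> Cl b) \<Longrightarrow> lc a xs \<in> Cl b"
  by (induction xs) (auto intro: Cl_add Cl_smult)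

lemma Cl_tends:
  assumes "tends s z" "\<And>n. s n \<in> Cl a"
  shows "z \<in> Cl a"
proof -
  have "ip z y = 0" if y: "y \<in> V" "\<And>i. ip y (a i) = 0" for y
  proof -
    have "(\<lambda>n. ip (s n) y) \<longlonglongrightarrow> ip z y"
      using assms(1) y(1) by (rule tends_ip)
    moreover have "ip (s n) y = 0" for n
      by (rule ClD(2)[OF assms(2)]) (use y in auto)
    ultimately show ?thesis
      by (simp add: LIMSEQ_const_iff)
  qed
  then show ?thesis
    using tendsD(2)[OF assms(1)] by (simp add: Cl_def)
qed

lemma Cl_unique:
  assumes "z \<in> Cl b" "z' \<in> Cl b" "\<And>i. b i \<in> V" "\<And>i. ip z (b i) = ip z' (b i)"
  shows "z = z'"
proof -
  note V = assms(3) ClD(1)[OF assms(1)] ClD(1)[OF assms(2)]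
  have *: "ip (z \<ominus> z') (b i) = 0" for i
    using V assms(4) by (simp add: ip_simps)
  have "ip (z \<ominus> z') (z \<ominus> z') = 0"
    by (rule ClD(2)[OF Cl_minus[OF assms(1,2)]]) (use V * in auto)
  then show ?thesis
    using V cinner_eq_0 minus_eq_zeroD by blast
qed

lemma nm_minus_sq: "\<lbrakk>x \<in> V; y \<in> V\<rbrakk> \<Longrightarrow> (nm (x \<ominus> y))\<^sup>2 = (nm x)\<^sup>2 - 2 * Re (ip x y) + (nm y)\<^sup>2"
  using cinner_commute[of x y] by (simp add: nm_sq ip_simps)

lemma nm_add_sq: "\<lbrakk>x \<in> V; y \<in> V\<rbrakk> \<Longrightarrow> (nm (x \<oplus> y))\<^sup>2 = (nm x)\<^sup>2 + 2 * Re (ip x y) + (nm y)\<^sup>2"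
  using cinner_commute[of x y] by (simp add: nm_sq ip_simps)

lemma nm_pythagoras: "\<lbrakk>x \<in> V; y \<in> V; ip x y = 0\<rbrakk> \<Longrightarrow> (nm (x \<oplus> y))\<^sup>2 = (nm x)\<^sup>2 + (nm y)\<^sup>2"
  by (simp add: nm_add_sq)

lemma parallelogram_midpoint:
  assumes "x \<in> V" "s \<in> V" "t \<in> V"
  shows "(nm (s \<ominus> t))\<^sup>2 = 2 * (nm (x \<ominus> s))\<^sup>2 + 2 * (nm (x \<ominus> t))\<^sup>2
            - 4 * (nm (x \<ominus> (1/2) \<odot> (s \<oplus> t)))\<^sup>2"
  using assms cinner_commute[of x s] cinner_commute[of x t] cinner_commute[of s t]
  by (simp add: nm_sq ip_simps algebra_simps)

text \<open>
  Minimizing the distance from \<open>x\<close> to the span of \<open>a\<close> and copying the coefficients of a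
  minimizing sequence to \<open>b\<close> gives a Cauchy sequence, since both families have the same Gram
  matrix. For \<open>a = b\<close> this is the orthogonal projection.
\<close>
lemma transfer_exists:
  fixes a b :: "'i \<Rightarrow> 'a"
  assumes g: "same_gram a b" and x: "x \<in> V"
  shows "\<exists>z\<in>Cl b. (\<forall>i. ip z (b i) = ip x (a i)) \<and> (\<forall>e>0. \<exists>xs. nm (z \<ominus> lc b xs) < e)"
proof -
  note gD = same_gramD[OF g]
  have la [simp]: "lc a xs \<in> V" and lb [simp]: "lc b xs \<in> V" for xs
    using gD by auto
  define q where "q xs = (nm (x \<ominus> lc a xs))\<^sup>2" for xs
  define d where "d = Inf (range q)"
  have bdd: "bdd_below (range q)"
    by (rule bdd_belowI[of _ 0]) (auto simp: q_def)
  have d_le: "d \<le> q xs" for xs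
    unfolding d_def using bdd by (intro cInf_lower) auto
  have "\<exists>xs. q xs < d + 1 / (real n + 1)" for n
    using cInf_lessD[of "range q" "d + 1 / (real n + 1)"] by (auto simp: d_def)
  then obtain cf :: "nat \<Rightarrow> (complex \<times> 'i) list" where cf: "\<And>n. q (cf n) < d + 1 / (real n + 1)"
    by metis
  define s where "s n = lc a (cf n)" for n
  define t where "t n = lc b (cf n)" for n
  have [simp]: "s n \<in> V" "t n \<in> V" for n
    by (auto simp: s_def t_def)
  have qs: "(nm (x \<ominus> s n))\<^sup>2 < d + 1 / (real n + 1)" for n
    using cf[of n] by (simp add: q_def s_def)
  have nm_t: "(nm (t m \<ominus> t n))\<^sup>2 = (nm (s m \<ominus> s n))\<^sup>2" for m n
    using ip_lc_gram[OF g] by (simp add: nm_sq ip_simps s_def t_def)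
  have bound: "(nm (t m \<ominus> t n))\<^sup>2 \<le> 2 * (1 / (real m + 1)) + 2 * (1 / (real n + 1))" for m n
  proof -
    have "(1/2) \<odot> (s m \<oplus> s n) = lc a (map (apfst ((*) (1/2))) (cf m @ cf n))"
      using gD by (simp only: lc_scale lc_append s_def)
    then have "d \<le> (nm (x \<ominus> (1/2) \<odot> (s m \<oplus> s n)))\<^sup>2"
      using d_le[of "map (apfst ((*) (1/2))) (cf m @ cf n)"] by (simp only: q_def)
    then show ?thesis
      using parallelogram_midpoint[OF x, of "s m" "s n"] qs[of m] qs[of n] nm_t[of m n] by simp
  qed
  have "MS.MCauchy t"
    unfolding MS.MCauchy_def
  proof (intro conjI allI impI)
    fix e :: real assume e: "e > 0"
    then obtain N where N: "1 / (real N + 1) < e\<^sup>2 / 4"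
      using nat_approx_posE[of "e\<^sup>2/4"] by (auto simp: add.commute)
    show "\<exists>N. \<forall>n n'. N \<le> n \<longrightarrow> N \<le> n' \<longrightarrow> hdist H (t n) (t n') < e"
    proof (intro exI allI impI)
      fix n n' assume n: "N \<le> n" "N \<le> n'"
      have "1 / (real n + 1) \<le> 1 / (real N + 1)" "1 / (real n' + 1) \<le> 1 / (real N + 1)"
        using n by (auto simp: frac_le)
      then have "(nm (t n \<ominus> t n'))\<^sup>2 < e\<^sup>2"
        using bound[of n n'] N by linarith
      then have "nm (t n \<ominus> t n') < e"
        using e by (simp add: power2_less_imp_less)
      then show "hdist H (t n) (t n') < e"
        by (simp add: hdist_eq)
    qed
  qed auto
  then obtain z where z: "tends t z"
    by (rule cauchy_tends)
  have lim_s: "(\<lambda>n. ip (s n) (a i)) \<longlonglongrightarrow> ip x (a i)" for i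
  proof -
    define k where "k = 1 + (nm (a i))\<^sup>2"
    have k: "k > 0" by (simp add: k_def add_pos_nonneg)
    have *: "(cmod (ip (x \<ominus> s n) (a i)))\<^sup>2 \<le> k * (1 / (real n + 1))" for n
    proof -
      define w where "w = ip (x \<ominus> s n) (a i)"
      define r where "r = w / of_real k"
      have "x \<ominus> s n \<ominus> r \<odot> a i = x \<ominus> lc a ((r, i) # cf n)"
        using x gD by (intro ip_eqI) (auto simp: ip_simps s_def)
      then have "d \<le> (nm (x \<ominus> s n \<ominus> r \<odot> a i))\<^sup>2"
        using d_le[of "(r, i) # cf n"] by (simp only: q_def)
      also have "\<dots> = (nm (x \<ominus> s n))\<^sup>2 - 2 * Re (cnj r * w) + (cmod r)\<^sup>2 * (nm (a i))\<^sup>2"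
        using x gD by (subst nm_minus_sq) (auto simp: ip_smult_right w_def power_mult_distrib)
      also have "Re (cnj r * w) = (cmod w)\<^sup>2 / k"
      proof -
        have "cnj r * w = of_real ((cmod w)\<^sup>2 / k)"
          using complex_norm_square[of w] by (simp add: r_def mult.commute)
        then show ?thesis by (simp only: Re_complex_of_real)
      qed
      also have "(cmod r)\<^sup>2 * (nm (a i))\<^sup>2 = (cmod w)\<^sup>2 / k * ((nm (a i))\<^sup>2 / k)"
        using k by (simp add: r_def norm_divide power_divide power2_eq_square)
      also have "(nm (x \<ominus> s n))\<^sup>2 - 2 * ((cmod w)\<^sup>2 / k) + (cmod w)\<^sup>2 / k * ((nm (a i))\<^sup>2 / k)
           \<le> (nm (x \<ominus> s n))\<^sup>2 - (cmod w)\<^sup>2 / k"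
      proof -
        have "(cmod w)\<^sup>2 / k * ((nm (a i))\<^sup>2 / k) \<le> (cmod w)\<^sup>2 / k * 1"
          using k by (intro mult_left_mono) (auto simp: k_def)
        then show ?thesis by simp
      qed
      finally have "(cmod w)\<^sup>2 / k \<le> 1 / (real n + 1)"
        using qs[of n] by simp
      then show ?thesis
        using k by (simp add: w_def field_simps)
    qed
    have lim: "(\<lambda>n. k * (1 / (real n + 1))) \<longlonglongrightarrow> 0"
      using tendsto_mult[OF tendsto_const[of k] LIMSEQ_inverse_real_of_nat]
      by (simp add: inverse_eq_divide add.commute)
    have "(\<lambda>n. (cmod (ip (x \<ominus> s n) (a i)))\<^sup>2) \<longlonglongrightarrow> 0"
      by (rule tendsto_sandwich[OF _ _ tendsto_const lim]) (use * in auto)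
    then have "(\<lambda>n. sqrt ((cmod (ip (x \<ominus> s n) (a i)))\<^sup>2)) \<longlonglongrightarrow> sqrt 0"
      by (rule tendsto_real_sqrt)
    then have "(\<lambda>n. cmod (ip (x \<ominus> s n) (a i))) \<longlonglongrightarrow> 0"
      by (simp only: real_sqrt_abs abs_norm_cancel real_sqrt_zero)
    then have 0: "(\<lambda>n. ip (x \<ominus> s n) (a i)) \<longlonglongrightarrow> 0"
      by (rule tendsto_norm_zero_cancel)
    have "(\<lambda>n. ip x (a i) - ip (x \<ominus> s n) (a i)) \<longlonglongrightarrow> ip x (a i) - 0"
      by (rule tendsto_diff[OF tendsto_const 0])
    moreover have "ip x (a i) - ip (x \<ominus> s n) (a i) = ip (s n) (a i)" for n
      using x gD(1) by (simp add: ip_minus_left)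
    ultimately show ?thesis
      by simp
  qed
  have "ip (s n) (a i) = ip (t n) (b i)" for n i
    using gD by (simp add: s_def t_def ip_lc_left)
  moreover have "(\<lambda>n. ip (t n) (b i)) \<longlonglongrightarrow> ip z (b i)" for i
    using z gD by (intro tends_ip)
  ultimately have "\<forall>i. ip z (b i) = ip x (a i)"
    using LIMSEQ_unique[OF _ lim_s] by simp
  moreover have "z \<in> Cl b"
    using z by (rule Cl_tends) (auto simp: t_def intro: Cl_lc Cl_self gD)
  moreover have "\<exists>xs. nm (z \<ominus> lc b xs) < e" if "e > 0" for e
  proof -
    have "\<forall>\<^sub>F n in sequentially. nm (t n \<ominus> z) < e"
      using tendsD(3)[OF z] that order_tendstoD(2) by blast
    then obtain n where "nm (t n \<ominus> z) < e"
      by (meson eventually_happens' sequentially_bot)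
    then show ?thesis
      using tendsD(2)[OF z] by (intro exI[of _ "cf n"]) (simp add: t_def nm_minus_commute)
  qed
  ultimately show ?thesis by blast
qed

text \<open>
  The projection onto the closed span of \<open>a\<close>, followed by the unitary operator from there to the
  closed span of \<open>b\<close> that maps \<open>a\<close> to \<open>b\<close>.
\<close>
definition Tr :: "('i \<Rightarrow> 'a) \<Rightarrow> ('i \<Rightarrow> 'a) \<Rightarrow> 'a \<Rightarrow> 'a" where
  "Tr a b x = (SOME z. z \<in> Cl b \<and> (\<forall>i. ip z (b i) = ip x (a i)))"

lemma
  assumes "same_gram a b" "x \<in> V"
  shows Tr_Cl: "Tr a b x \<in> Cl b" and Tr_ip: "ip (Tr a b x) (b i) = ip x (a i)"
  using someI_ex[of "\<lambda>z. z \<in> Cl b \<and> (\<forall>i. ip z (b i) = ip x (a i))"]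
    transfer_exists[OF assms] unfolding Tr_def by blast+

lemma Tr_in: "same_gram a b \<Longrightarrow> x \<in> V \<Longrightarrow> Tr a b x \<in> V"
  using Tr_Cl ClD by blast

lemma Tr_eqI:
  assumes "same_gram a b" "x \<in> V" "z \<in> Cl b" "\<And>i. ip z (b i) = ip x (a i)"
  shows "Tr a b x = z"
  by (rule Cl_unique[of _ b]) (use assms Tr_Cl Tr_ip same_gramD in auto)

lemma Tr_approx:
  assumes "same_gram a b" "x \<in> V" "e > 0"
  obtains xs where "nm (Tr a b x \<ominus> lc b xs) < e"
  using transfer_exists[OF assms(1,2)] Tr_eqI[OF assms(1,2)] assms(3) by metis

lemma
  assumes g: "same_gram a b" and x: "x \<in> V"
  shows Tr_add: "y \<in> V \<Longrightarrow> Tr a b (x \<oplus> y) = Tr a b x \<oplus> Tr a b y"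
    and Tr_minus: "y \<in> V \<Longrightarrow> Tr a b (x \<ominus> y) = Tr a b x \<ominus> Tr a b y"
    and Tr_smult: "Tr a b (c \<odot> x) = c \<odot> Tr a b x"
  using same_gramD[OF g] g x
  by (auto intro!: Tr_eqI Cl_add Cl_minus Cl_smult Tr_Cl simp: ip_simps Tr_ip Tr_in)

lemma Tr_Tr: "\<lbrakk>same_gram a b; same_gram b c; x \<in> V\<rbrakk> \<Longrightarrow> Tr b c (Tr a b x) = Tr a c x"
  by (rule Tr_eqI[symmetric]) (auto intro: same_gram_trans[of a b c] Tr_Cl Tr_in simp: Tr_ip Tr_in)

text \<open>
  By the Cauchy-Schwarz inequality, applied to the pairing of \<open>x\<close> with a combination of \<open>a\<close> whose
  copy in \<open>b\<close> is close to the image of \<open>x\<close>.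
\<close>
lemma Tr_nm_le:
  assumes g: "same_gram a b" and x: "x \<in> V"
  shows "nm (Tr a b x) \<le> nm x"
proof -
  define z where "z = Tr a b x"
  note gD = same_gramD[OF g]
  have zV: "z \<in> V" using g x by (simp add: z_def Tr_in)
  have "(nm z)\<^sup>2 \<le> nm x * nm z + e * (nm x + nm z)" if e: "e > 0" for e
  proof -
    obtain xs where xs: "nm (z \<ominus> lc b xs) < e"
      using Tr_approx[OF g x e] z_def by blast
    have V: "lc a xs \<in> V" "lc b xs \<in> V" using gD by auto
    have "(nm (lc a xs))\<^sup>2 = (nm (lc b xs))\<^sup>2"
      using V ip_lc_gram[OF g] by (simp add: nm_sq)
    then have nab: "nm (lc a xs) = nm (lc b xs)"
      using V by (simp add: power2_eq_iff_nonneg)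
    have "ip z (lc b xs) = ip x (lc a xs)"
      using g x gD zV by (simp add: ip_lc_right z_def Tr_ip)
    then have "Re (ip z (lc b xs)) \<le> nm x * nm (lc b xs)"
      using ip_cs[OF x V(1)] complex_Re_le_cmod[of "ip x (lc a xs)"] nab by simp
    moreover have "nm (lc b xs) \<le> nm z + e"
      using nm_le_diff[OF V(2) zV] xs V zV by (simp add: nm_minus_commute)
    then have "nm x * nm (lc b xs) \<le> nm x * (nm z + e)"
      using x by (intro mult_left_mono) auto
    moreover have "Re (ip z (z \<ominus> lc b xs)) \<le> nm z * e"
    proof -
      have "Re (ip z (z \<ominus> lc b xs)) \<le> nm z * nm (z \<ominus> lc b xs)"
        using ip_cs[of z "z \<ominus> lc b xs"] complex_Re_le_cmod[of "ip z (z \<ominus> lc b xs)"] zV V by simp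
      also have "\<dots> \<le> nm z * e"
        using xs zV by (intro mult_left_mono) auto
      finally show ?thesis .
    qed
    moreover have "(nm z)\<^sup>2 = Re (ip z (lc b xs)) + Re (ip z (z \<ominus> lc b xs))"
      using zV V by (simp add: nm_sq ip_simps)
    ultimately show ?thesis
      by (simp add: algebra_simps)
  qed
  note * = this
  have "(nm z)\<^sup>2 \<le> nm x * nm z"
  proof (rule field_le_epsilon)
    fix e :: real assume e: "e > 0"
    define k where "k = nm x + nm z + 1"
    have k: "k > 0" using x zV by (simp add: k_def add_nonneg_pos)
    have "e / k * (nm x + nm z) \<le> e"
      using e k by (simp add: k_def field_simps)
    then show "(nm z)\<^sup>2 \<le> nm x * nm z + e"
      using *[of "e / k"] e k by simp
  qed
  then show ?thesis
    using x zV nm_nonneg[OF zV] nm_nonneg[OF x] unfolding z_def[symmetric] power2_eq_square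
    by (cases "nm z = 0") auto
qed

lemma Tr_self_id: "\<lbrakk>\<And>i. a i \<in> V; x \<in> Cl a\<rbrakk> \<Longrightarrow> Tr a a x = x"
  by (rule Tr_eqI) (auto simp: same_gram_refl ClD)

lemma ip_minus_proj:
  assumes "\<And>i. a i \<in> V" "x \<in> V" "y \<in> Cl a"
  shows "ip (x \<ominus> Tr a a x) y = 0"
proof -
  have g: "same_gram a a" using assms(1) by (rule same_gram_refl)
  have T: "Tr a a x \<in> V" using g assms(2) by (rule Tr_in)
  have *: "ip (x \<ominus> Tr a a x) (a i) = 0" for i
    using assms(1,2) T Tr_ip[OF g assms(2)] by (simp add: ip_simps)
  have "ip y (x \<ominus> Tr a a x) = 0"
    using * assms(2) T by (intro ClD(2)[OF assms(3)]) auto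
  then show ?thesis
    using assms(2) T ClD(1)[OF assms(3)] by (subst ip_eq_0_commute) auto
qed

lemma proj_self_adjoint:
  assumes "\<And>i. a i \<in> V" "x \<in> V" "y \<in> V"
  shows "ip (Tr a a x) y = ip x (Tr a a y)"
proof -
  have g: "same_gram a a" using assms same_gram_refl by blast
  have T: "Tr a a x \<in> V" "Tr a a y \<in> V" using g assms by (auto simp: Tr_in)
  have "ip (x \<ominus> Tr a a x) (Tr a a y) = 0" "ip (y \<ominus> Tr a a y) (Tr a a x) = 0"
    using assms g by (auto intro!: ip_minus_proj Tr_Cl)
  then have "ip x (Tr a a y) = ip (Tr a a x) (Tr a a y)" "ip y (Tr a a x) = ip (Tr a a y) (Tr a a x)"
    using T assms by (auto simp: ip_simps)
  then show ?thesis
    using T assms cinner_commute[of x "Tr a a y"] cinner_commute[of "Tr a a y" "Tr a a x"]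
      cinner_commute[of y "Tr a a x"] by simp
qed

lemma nm_proj_split:
  assumes "\<And>i. a i \<in> V" "x \<in> V"
  shows "(nm x)\<^sup>2 = (nm (x \<ominus> Tr a a x))\<^sup>2 + (nm (Tr a a x))\<^sup>2"
proof -
  have g: "same_gram a a" using assms(1) by (rule same_gram_refl)
  have T: "Tr a a x \<in> V" using g assms(2) by (rule Tr_in)
  have "(x \<ominus> Tr a a x) \<oplus> Tr a a x = x"
    using assms T by (intro ip_eqI) (auto simp: ip_simps)
  then show ?thesis
    using nm_pythagoras[of "x \<ominus> Tr a a x" "Tr a a x"] ip_minus_proj[OF assms Tr_Cl[OF g assms(2)]]
      T assms(2) by simp
qed

lemma proj_orth_eq_0:
  assumes "\<And>i. a i \<in> V" "x \<in> V" "\<And>i. ip x (a i) = 0"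
  shows "Tr a a x = \<zero>"
  using assms by (intro Tr_eqI) (auto simp: same_gram_refl)

end

section \<open>The Cayley transform of a self-adjoint operator\<close>

locale sa_op = complex_hilbert_space M for M :: "'a hilb_op" (structure) +
  assumes linear: "linear_op M" and dense: "densely_defined M"
    and adjoint: "adjoint_graph M = graph M"
begin

lemma gr_in:
  assumes "(x, y) \<in> graph M"
  shows "x \<in> V" "y \<in> V"
  using assms linear by (auto simp: linear_op_def)

lemma gr_zero [simp]: "(\<zero>, \<zero>) \<in> graph M"
  using linear by (simp add: linear_op_def)

lemma gr_add:
  assumes "(x, y) \<in> graph M" "(x', y') \<in> graph M"
  shows "(x \<oplus> x', y \<oplus> y') \<in> graph M"
proof -
  have "\<forall>p\<in>graph M. \<forall>q\<in>graph M. (fst p \<oplus> fst q, snd p \<oplus> snd q) \<in> graph M"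
    using linear by (simp add: linear_op_def case_prod_beta)
  from this[rule_format, OF assms] show ?thesis by simp
qed

lemma gr_smult:
  assumes "(x, y) \<in> graph M"
  shows "(c \<odot> x, c \<odot> y) \<in> graph M"
proof -
  have "\<forall>c. \<forall>p\<in>graph M. (c \<odot> fst p, c \<odot> snd p) \<in> graph M"
    using linear by (simp add: linear_op_def case_prod_beta)
  from this[rule_format, OF assms] show ?thesis by simp
qed

lemma gr_minus:
  assumes "(x, y) \<in> graph M" "(x', y') \<in> graph M"
  shows "(x \<ominus> x', y \<ominus> y') \<in> graph M"
proof -
  have "(x \<oplus> (-1) \<odot> x', y \<oplus> (-1) \<odot> y') \<in> graph M"
    using assms by (intro gr_add gr_smult)
  moreover have "x \<oplus> (-1) \<odot> x' = x \<ominus> x'" "y \<oplus> (-1) \<odot> y' = y \<ominus> y'"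
    using gr_in[OF assms(1)] gr_in[OF assms(2)] by (auto intro!: ip_eqI simp: ip_simps)
  ultimately show ?thesis by simp
qed

lemma gr_unique: "\<lbrakk>(x, y) \<in> graph M; (x, y') \<in> graph M\<rbrakk> \<Longrightarrow> y = y'"
  using linear by (auto simp: linear_op_def single_valued_def)

lemma gr_sym:
  assumes "(x, y) \<in> graph M" "(u, w) \<in> graph M"
  shows "ip w x = ip u y"
proof -
  have "(x, y) \<in> adjoint_graph M"
    using assms adjoint by simp
  then show ?thesis
    using assms(2) by (auto simp: adjoint_graph_def)
qed

lemma gr_adjI:
  assumes "x \<in> V" "y \<in> V" "\<And>u w. (u, w) \<in> graph M \<Longrightarrow> ip w x = ip u y"
  shows "(x, y) \<in> graph M"
proof -
  have "(x, y) \<in> adjoint_graph M"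
    using assms by (auto simp: adjoint_graph_def)
  then show ?thesis using adjoint by simp
qed

lemma gr_tends:
  assumes "tends s x" "tends t y" "\<And>n. (s n, t n) \<in> graph M"
  shows "(x, y) \<in> graph M"
proof (rule gr_adjI)
  fix u w assume uw: "(u, w) \<in> graph M"
  have "(\<lambda>n. ip w (s n)) \<longlonglongrightarrow> ip w x" "(\<lambda>n. ip u (t n)) \<longlonglongrightarrow> ip u y"
    using assms(1,2) gr_in[OF uw] by (auto intro: tends_ip_right)
  moreover have "ip w (s n) = ip u (t n)" for n
    by (rule gr_sym[OF assms(3) uw])
  ultimately show "ip w x = ip u y"
    using LIMSEQ_unique by simp
qed (use assms(1,2) tendsD in auto)

text \<open>
  The cross terms vanish, because \<open>\<langle>Qx, x\<rangle>\<close> is real and \<open>s\<close> is imaginary.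
\<close>
lemma gr_imag_norm:
  assumes xy: "(x, y) \<in> graph M" and s: "Re s = 0" "cmod s = 1"
  shows "(nm (y \<oplus> s \<odot> x))\<^sup>2 = (nm x)\<^sup>2 + (nm y)\<^sup>2"
proof -
  note V = gr_in[OF xy]
  have "Im (ip y x) = 0"
    using gr_sym[OF xy xy] cinner_commute[OF V(2) V(1)] by (simp add: complex_eq_iff)
  then have "Re (ip y (s \<odot> x)) = 0"
    using V s by (simp add: ip_simps)
  then show ?thesis
    using V s by (simp add: nm_add_sq)
qed

lemma tends_ex:
  assumes "v \<in> V" "\<And>e. e > 0 \<Longrightarrow> \<exists>w. w \<in> V \<and> P w \<and> nm (v \<ominus> w) < e"
  obtains s where "tends s v" "\<And>n. P (s n)"
proof -
  have "\<exists>w. w \<in> V \<and> P w \<and> nm (v \<ominus> w) < 1 / (real n + 1)" for n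
    by (rule assms(2)) simp
  then obtain s where s: "\<And>n. s n \<in> V" "\<And>n. P (s n)" "\<And>n. nm (v \<ominus> s n) < 1 / (real n + 1)"
    by metis
  have lim: "(\<lambda>n. 1 / (real n + 1)) \<longlonglongrightarrow> 0"
    using LIMSEQ_inverse_real_of_nat by (simp add: inverse_eq_divide add.commute)
  have "(\<lambda>n. nm (s n \<ominus> v)) \<longlonglongrightarrow> 0"
    by (rule tendsto_sandwich[OF _ _ tendsto_const lim])
      (use s assms(1) in \<open>auto simp: nm_minus_commute[of _ v] intro!: always_eventually less_imp_le\<close>)
  then have "tends s v"
    using s assms(1) by (auto simp: tends_def)
  then show ?thesis using that s by blast
qed

lemma tends_dominated:
  assumes "tends s v" "\<And>m n. nm (t m \<ominus> t n) \<le> nm (s m \<ominus> s n)" "\<And>n. t n \<in> V"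
  obtains z where "tends t z"
proof -
  have s: "range s \<subseteq> V" using assms(1) by (simp add: tends_def)
  then have "MS.MCauchy s"
    using assms(1) limitin_tends[OF s] MS.convergent_imp_MCauchy[OF s] by simp
  then have "MS.MCauchy t"
    by (rule MCauchy_dominated[OF MS.Metric_space_axioms MS.Metric_space_axioms])
      (use assms s in \<open>auto simp: hdist_eq image_subset_iff\<close>)
  then show ?thesis by (rule cauchy_tends) (rule that)
qed

text \<open>
  The range is closed because \<open>Q + sI\<close> is bounded below and the graph is closed, and it is dense
  because a vector orthogonal to it is an eigenvector for a non-real eigenvalue.
\<close>
lemma gr_imag_surj:
  assumes v: "v \<in> V" and s: "Re s = 0" "cmod s = 1"
  obtains x y where "(x, y) \<in> graph M" "v = y \<oplus> s \<odot> x"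
proof -
  define a where "a p = (if p \<in> graph M then snd p \<oplus> s \<odot> fst p else \<zero>)" for p
  have a_in: "a p \<in> V" for p
    using gr_in[of "fst p" "snd p"] by (auto simp: a_def)
  have a_eq: "a = (\<lambda>p. if p \<in> graph M then snd p \<oplus> s \<odot> fst p else \<zero>)"
    by (simp add: a_def fun_eq_iff)
  have lc_range: "\<exists>x y. (x, y) \<in> graph M \<and> lc a xs = y \<oplus> s \<odot> x" for xs
    unfolding a_eq by (rule lc_pairs[of "graph M"]) (auto intro: gr_in gr_add gr_smult)
  have cs: "- cnj s = s" using s by (simp add: complex_eq_iff)
  have z0: "z = \<zero>" if z: "z \<in> V" "\<And>p. ip z (a p) = 0" for z
  proof -
    have "(z, s \<odot> z) \<in> graph M"
    proof (rule gr_adjI)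
      fix u w assume uw: "(u, w) \<in> graph M"
      note uwV = gr_in[OF uw]
      have "ip z (a (u, w)) = 0" by (rule z)
      then have "ip (w \<oplus> s \<odot> u) z = 0"
        using uw uwV z(1) by (simp add: a_def ip_eq_0_commute)
      then have "ip w z = (- s) * ip u z"
        using uwV z(1) by (simp add: ip_simps eq_neg_iff_add_eq_0)
      also have "- s = cnj s" using s by (simp add: complex_eq_iff)
      finally show "ip w z = ip u (s \<odot> z)"
        using uwV z(1) by (simp add: ip_simps)
    qed (use z in auto)
    then have "ip (s \<odot> z) z = ip z (s \<odot> z)"
      using gr_sym by blast
    then have "(s - cnj s) * ip z z = 0"
      using z(1) by (simp add: ip_simps algebra_simps)
    moreover have "s - cnj s \<noteq> 0"
      using s by (auto simp: complex_eq_iff cmod_def)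
    ultimately show ?thesis using cinner_eq_0 z(1) by simp
  qed
  have g: "same_gram a a" using a_in by (rule same_gram_refl)
  have Pv: "Tr a a v \<in> V" using g v by (rule Tr_in)
  have "v \<ominus> Tr a a v = \<zero>"
    by (rule z0) (use v a_in Pv Tr_ip[OF g v] in \<open>auto simp: ip_simps\<close>)
  then have Pv_eq: "Tr a a v = v"
    using minus_eq_zeroD[OF v Pv] by simp
  have "\<exists>w. w \<in> V \<and> (\<exists>x y. (x, y) \<in> graph M \<and> w = y \<oplus> s \<odot> x) \<and> nm (v \<ominus> w) < e" if "e > 0" for e
    using Tr_approx[OF g v that] Pv_eq lc_range a_in lc_in[of a] by metis
  then obtain t where t: "tends t v" "\<And>n. \<exists>x y. (x, y) \<in> graph M \<and> t n = y \<oplus> s \<odot> x"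
    using tends_ex[of v "\<lambda>w. \<exists>x y. (x, y) \<in> graph M \<and> w = y \<oplus> s \<odot> x"] v by metis
  then obtain f g where fg: "\<And>n. (f n, g n) \<in> graph M" "\<And>n. t n = g n \<oplus> s \<odot> f n"
    by metis
  have fgV: "f n \<in> V" "g n \<in> V" for n
    using gr_in[OF fg(1)] by auto
  have "(nm (t m \<ominus> t n))\<^sup>2 = (nm (f m \<ominus> f n))\<^sup>2 + (nm (g m \<ominus> g n))\<^sup>2" for m n
  proof -
    have "t m \<ominus> t n = (g m \<ominus> g n) \<oplus> s \<odot> (f m \<ominus> f n)"
      using fgV by (intro ip_eqI) (auto simp: fg(2) ip_simps algebra_simps)
    then show ?thesis
      using gr_imag_norm[OF gr_minus[OF fg(1)[of m] fg(1)[of n]] s] by simp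
  qed
  note tmn = this
  have nf: "nm (f m \<ominus> f n) \<le> nm (t m \<ominus> t n)" and ng: "nm (g m \<ominus> g n) \<le> nm (t m \<ominus> t n)" for m n
    by (rule power2_le_imp_le; use tmn[of m n] tendsD[OF t(1)] in simp)+
  obtain x where x: "tends f x" by (rule tends_dominated[OF t(1) nf fgV(1)])
  obtain y where y: "tends g y" by (rule tends_dominated[OF t(1) ng fgV(2)])
  have "(x, y) \<in> graph M"
    by (rule gr_tends[OF x y fg(1)])
  moreover have "v = y \<oplus> s \<odot> x"
  proof (rule ip_eqI)
    fix z assume z: "z \<in> V"
    have "(\<lambda>n. ip (g n) z + s * ip (f n) z) \<longlonglongrightarrow> ip y z + s * ip x z"
      using tends_ip[OF x z] tends_ip[OF y z] by (intro tendsto_intros)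
    moreover have "ip (g n) z + s * ip (f n) z = ip (t n) z" for n
      using fgV z by (simp add: fg(2) ip_simps)
    ultimately have "ip y z + s * ip x z = ip v z"
      using LIMSEQ_unique[OF _ tends_ip[OF t(1) z]] by simp
    then show "ip v z = ip (y \<oplus> s \<odot> x) z"
      using tendsD(2)[OF x] tendsD(2)[OF y] z by (simp add: ip_simps)
  qed (use v tendsD(2)[OF x] tendsD(2)[OF y] in auto)
  ultimately show ?thesis using that by blast
qed

lemma gr_imag_unique:
  assumes "(x, y) \<in> graph M" "(x', y') \<in> graph M" "y \<oplus> s \<odot> x = y' \<oplus> s \<odot> x'"
    and s: "Re s = 0" "cmod s = 1"
  shows "x = x'" "y = y'"
proof -
  note V = gr_in[OF assms(1)] gr_in[OF assms(2)]
  have d: "(x \<ominus> x', y \<ominus> y') \<in> graph M"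
    using assms by (intro gr_minus)
  have "(y \<ominus> y') \<oplus> s \<odot> (x \<ominus> x') = (y \<oplus> s \<odot> x) \<ominus> (y' \<oplus> s \<odot> x')"
    using V by (intro ip_eqI) (auto simp: ip_simps algebra_simps)
  also have "\<dots> = \<zero>"
    using assms(3) V by simp
  finally have "(nm (x \<ominus> x'))\<^sup>2 + (nm (y \<ominus> y'))\<^sup>2 = 0"
    using gr_imag_norm[OF d s] by simp
  then have "nm (x \<ominus> x') = 0" "nm (y \<ominus> y') = 0"
    by (auto simp: sum_power2_eq_zero_iff)
  then show "x = x'" "y = y'"
    using V by (auto simp: nm_eq_0 intro: minus_eq_zeroD)
qed

text \<open>
  The Cayley transform \<open>(Q - i)(Q + i)\<inverse>\<close>. It is unitary, so it replaces the unbounded operator by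
  a bounded one that is defined everywhere.
\<close>
definition cayley :: "'a \<Rightarrow> 'a" where
  "cayley v = (SOME u. \<exists>x y. (x, y) \<in> graph M \<and> v = y \<oplus> \<i> \<odot> x \<and> u = y \<oplus> (-\<i>) \<odot> x)"

definition cayley_inv :: "'a \<Rightarrow> 'a" where
  "cayley_inv v = (SOME u. \<exists>x y. (x, y) \<in> graph M \<and> v = y \<oplus> (-\<i>) \<odot> x \<and> u = y \<oplus> \<i> \<odot> x)"

lemma cayley_eq:
  assumes "(x, y) \<in> graph M"
  shows "cayley (y \<oplus> \<i> \<odot> x) = y \<oplus> (-\<i>) \<odot> x"
proof -
  have "\<exists>x' y'. (x', y') \<in> graph M \<and> y \<oplus> \<i> \<odot> x = y' \<oplus> \<i> \<odot> x'
      \<and> cayley (y \<oplus> \<i> \<odot> x) = y' \<oplus> (-\<i>) \<odot> x'"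
    unfolding cayley_def by (rule someI_ex) (use assms in blast)
  then obtain x' y' where *: "(x', y') \<in> graph M" "y \<oplus> \<i> \<odot> x = y' \<oplus> \<i> \<odot> x'"
      "cayley (y \<oplus> \<i> \<odot> x) = y' \<oplus> (-\<i>) \<odot> x'"
    by blast
  have "x = x'" "y = y'"
    using gr_imag_unique[OF assms *(1,2)] by auto
  then show ?thesis using *(3) by simp
qed

lemma cayley_inv_eq:
  assumes "(x, y) \<in> graph M"
  shows "cayley_inv (y \<oplus> (-\<i>) \<odot> x) = y \<oplus> \<i> \<odot> x"
proof -
  have "\<exists>x' y'. (x', y') \<in> graph M \<and> y \<oplus> (-\<i>) \<odot> x = y' \<oplus> (-\<i>) \<odot> x'
      \<and> cayley_inv (y \<oplus> (-\<i>) \<odot> x) = y' \<oplus> \<i> \<odot> x'"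
    unfolding cayley_inv_def by (rule someI_ex) (use assms in blast)
  then obtain x' y' where *: "(x', y') \<in> graph M" "y \<oplus> (-\<i>) \<odot> x = y' \<oplus> (-\<i>) \<odot> x'"
      "cayley_inv (y \<oplus> (-\<i>) \<odot> x) = y' \<oplus> \<i> \<odot> x'"
    by blast
  have "x = x'" "y = y'"
    using gr_imag_unique[OF assms *(1,2)] by auto
  then show ?thesis using *(3) by simp
qed

lemma plus_i_surj:
  assumes "v \<in> V" obtains x y where "(x, y) \<in> graph M" "v = y \<oplus> \<i> \<odot> x"
  using gr_imag_surj[OF assms, of \<i>] by auto

lemma minus_i_surj:
  assumes "v \<in> V" obtains x y where "(x, y) \<in> graph M" "v = y \<oplus> (-\<i>) \<odot> x"
  using gr_imag_surj[OF assms, of "-\<i>"] by auto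

lemma cayley_in [simp, intro]: "v \<in> V \<Longrightarrow> cayley v \<in> V"
  by (erule plus_i_surj) (auto simp: cayley_eq gr_in)

lemma cayley_inv_in [simp, intro]: "v \<in> V \<Longrightarrow> cayley_inv v \<in> V"
  by (erule minus_i_surj) (auto simp: cayley_inv_eq gr_in)

lemma cayley_cayley_inv [simp]: "v \<in> V \<Longrightarrow> cayley (cayley_inv v) = v"
  by (erule minus_i_surj) (simp add: cayley_inv_eq cayley_eq)

lemma cayley_inv_cayley [simp]: "v \<in> V \<Longrightarrow> cayley_inv (cayley v) = v"
  by (erule plus_i_surj) (simp add: cayley_inv_eq cayley_eq)

lemma ip_cayley_cayley:
  assumes "v \<in> V" "w \<in> V"
  shows "ip (cayley v) (cayley w) = ip v w"
proof -
  obtain x y where xy: "(x, y) \<in> graph M" "v = y \<oplus> \<i> \<odot> x"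
    using plus_i_surj assms(1) by blast
  obtain x' y' where xy': "(x', y') \<in> graph M" "w = y' \<oplus> \<i> \<odot> x'"
    using plus_i_surj assms(2) by blast
  show ?thesis
    using gr_in[OF xy(1)] gr_in[OF xy'(1)] gr_sym[OF xy'(1) xy(1)]
    by (simp add: xy(2) xy'(2) cayley_eq[OF xy(1)] cayley_eq[OF xy'(1)] ip_simps algebra_simps)
qed

lemma ip_cayley: "\<lbrakk>x \<in> V; y \<in> V\<rbrakk> \<Longrightarrow> ip (cayley x) y = ip x (cayley_inv y)"
  using ip_cayley_cayley[of x "cayley_inv y"] by simp

lemma ip_cayley_inv: "\<lbrakk>x \<in> V; y \<in> V\<rbrakk> \<Longrightarrow> ip (cayley_inv x) y = ip x (cayley y)"
  using ip_cayley_cayley[of "cayley_inv x" y] by simp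

lemma cayley_minus: "\<lbrakk>x \<in> V; y \<in> V\<rbrakk> \<Longrightarrow> cayley (x \<ominus> y) = cayley x \<ominus> cayley y"
  by (intro ip_eqI) (auto simp: ip_cayley ip_simps)

lemma
  assumes "x \<in> V"
  shows cayley_smult: "cayley (c \<odot> x) = c \<odot> cayley x"
    and cayley_inv_smult: "cayley_inv (c \<odot> x) = c \<odot> cayley_inv x"
  using assms by (auto intro!: ip_eqI simp: ip_cayley ip_cayley_inv ip_simps)

lemma cayley_zero [simp]: "cayley \<zero> = \<zero>" "cayley_inv \<zero> = \<zero>"
  by (auto intro!: ip_eqI simp: ip_cayley ip_cayley_inv ip_simps)

lemma nm_cayley [simp]: "x \<in> V \<Longrightarrow> nm (cayley x) = nm x"
  by (simp add: hnorm_def ip_cayley_cayley)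

text \<open>
  The operator is recovered from its Cayley transform \<open>U\<close> as \<open>i (1 + U) (1 - U)\<inverse>\<close>, so whatever
  commutes with \<open>U\<close> respects the graph.
\<close>
lemma gr_cayleyI:
  assumes "v \<in> V"
  shows "(v \<ominus> cayley v, \<i> \<odot> (v \<oplus> cayley v)) \<in> graph M"
proof -
  obtain x y where xy: "(x, y) \<in> graph M" "v = y \<oplus> \<i> \<odot> x"
    using plus_i_surj assms by blast
  have "v \<ominus> cayley v = (2 * \<i>) \<odot> x" "\<i> \<odot> (v \<oplus> cayley v) = (2 * \<i>) \<odot> y"
    using gr_in[OF xy(1)]
    by (auto intro!: ip_eqI simp: xy(2) cayley_eq[OF xy(1)] ip_simps algebra_simps)
  then show ?thesis
    using gr_smult[OF xy(1), of "2 * \<i>"] by simp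
qed

lemma gr_cayleyE:
  assumes "(x, y) \<in> graph M"
  obtains v where "v \<in> V" "x = v \<ominus> cayley v" "y = \<i> \<odot> (v \<oplus> cayley v)"
    "v = (1 / (2 * \<i>)) \<odot> (y \<oplus> \<i> \<odot> x)"
proof -
  define v where "v = (1 / (2 * \<i>)) \<odot> (y \<oplus> \<i> \<odot> x)"
  have V: "x \<in> V" "y \<in> V" "v \<in> V"
    using gr_in[OF assms] by (auto simp: v_def)
  have cv: "cayley v = (1 / (2 * \<i>)) \<odot> (y \<oplus> (-\<i>) \<odot> x)"
    using V cayley_eq[OF assms] by (simp add: v_def cayley_smult)
  have "x = v \<ominus> cayley v" "y = \<i> \<odot> (v \<oplus> cayley v)"
    using V unfolding cv
    by (auto intro!: ip_eqI simp: v_def ip_simps field_simps)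
  then show ?thesis
    using V v_def that by blast
qed

definition cpow :: "int \<Rightarrow> 'a \<Rightarrow> 'a" where
  "cpow n = (if n \<ge> 0 then cayley ^^ nat n else cayley_inv ^^ nat (- n))"

lemma cpow_0 [simp]: "cpow 0 x = x"
  by (simp add: cpow_def)

lemma funpow_cayley_in: "x \<in> V \<Longrightarrow> (cayley ^^ n) x \<in> V" "x \<in> V \<Longrightarrow> (cayley_inv ^^ n) x \<in> V"
  by (induction n) auto

lemma cpow_in [simp]: "x \<in> V \<Longrightarrow> cpow n x \<in> V"
  by (auto simp: cpow_def funpow_cayley_in)

lemma cayley_cpow: 
  assumes "x \<in> V"
  shows "cayley (cpow n x) = cpow (n + 1) x"
proof (cases "n \<ge> 0")
  case True
  then have "nat (n + 1) = Suc (nat n)" by simp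
  then show ?thesis using True by (simp add: cpow_def)
next
  case False
  define k where "k = nat (- (n + 1))"
  have k: "nat (- n) = Suc k" "nat (- (n + 1)) = k"
    using False by (auto simp: k_def)
  have "cayley (cpow n x) = (cayley_inv ^^ k) x"
    using False k assms by (simp add: cpow_def funpow_cayley_in)
  also have "\<dots> = cpow (n + 1) x"
    using False k by (cases "n = -1") (auto simp: cpow_def)
  finally show ?thesis .
qed

lemma cayley_inv_cpow:
  assumes "x \<in> V"
  shows "cayley_inv (cpow n x) = cpow (n - 1) x"
  using cayley_cpow[OF assms, of "n - 1"] assms by (metis cayley_inv_cayley cpow_in diff_add_cancel)

lemma ip_cpow:
  assumes "x \<in> V" "y \<in> V"
  shows "ip (cpow m x) (cpow n y) = ip (cpow (m - n) x) y"
proof (induction n arbitrary: m rule: int_induct[where k = 0])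
  case base
  then show ?case by simp
next
  case (step1 n)
  have "ip (cpow m x) (cpow (n + 1) y) = ip (cayley_inv (cpow m x)) (cpow n y)"
    using assms by (simp add: ip_cayley_inv cayley_cpow)
  then show ?case using step1(2)[of "m - 1"] assms by (simp add: cayley_inv_cpow algebra_simps)
next
  case (step2 n)
  have "ip (cpow m x) (cpow (n - 1) y) = ip (cayley (cpow m x)) (cpow n y)"
    using assms by (simp add: ip_cayley cayley_inv_cpow)
  then show ?case using step2(2)[of "m + 1"] assms by (simp add: cayley_cpow algebra_simps)
qed

end

section \<open>The sum of an operator and a reducing part\<close>

context sa_op
begin

text \<open>
  The graph is its own adjoint graph, which is cut out by continuous conditions.
\<close>
lemma closed_graph: "closed_op M"
proof -
  interpret MM: Metric_space12 V "hdist M" V "hdist M"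
    by unfold_locales
  show ?thesis
    unfolding closed_op_def MM.mtopology_prod_metric[symmetric]
      MM.Prod_metric.metric_closedin_iff_sequentially_closed
    unfolding MM.mtopology_prod_metric limitin_pairwise
  proof (intro conjI allI impI)
    show "graph M \<subseteq> V \<times> V"
      using gr_in by auto
    fix \<sigma> l
    assume *: "range \<sigma> \<subseteq> graph M \<and> limitin MS.mtopology (fst \<circ> \<sigma>) (fst l) sequentially
        \<and> limitin MS.mtopology (snd \<circ> \<sigma>) (snd l) sequentially"
    have gr: "((fst \<circ> \<sigma>) n, (snd \<circ> \<sigma>) n) \<in> graph M" for n
      using * by auto
    have "tends (fst \<circ> \<sigma>) (fst l)" "tends (snd \<circ> \<sigma>) (snd l)"
      using * gr_in[OF gr] limitin_tends by (auto simp: image_subset_iff)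
    then have "(fst l, snd l) \<in> graph M"
      using gr by (rule gr_tends)
    then show "l \<in> graph M" by simp
  qed
qed

lemma sa: "sa_structure M"
  using closed_graph linear dense adjoint complex_hilbert_space_axioms
  by (simp add: sa_structure_def self_adjoint_def)

lemma dense_domain:
  assumes "x \<in> V" "e > 0"
  obtains u w where "(u, w) \<in> graph M" "nm (x \<ominus> u) < e"
proof -
  have "Domain (graph M) \<subseteq> V" using gr_in by auto
  then have "\<exists>d\<in>Domain (graph M). nm (x \<ominus> d) < e"
    using dense assms unfolding densely_defined_def by (simp add: closure_of_eq_iff)
  then show ?thesis using that by blast
qed

end

text \<open>
  The sum of \<open>M\<close> and the subspace \<open>L\<close>, with underlying set encoded by \<open>j\<close> inside the type of
  \<open>M\<close>. The ring multiplication and unit of the record are filled with arbitrary values.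
\<close>
definition sum_structure :: "('a \<times> 'a \<Rightarrow> 'a) \<Rightarrow> 'a hilb_op \<Rightarrow> 'a set \<Rightarrow> 'a hilb_op" where
  "sum_structure j M L = (let k = inv_into (carrier M \<times> L) j in
    \<lparr>carrier = j ` (carrier M \<times> L), mult = (\<lambda>p q. p), one = j (\<zero>\<^bsub>M\<^esub>, \<zero>\<^bsub>M\<^esub>),
     zero = j (\<zero>\<^bsub>M\<^esub>, \<zero>\<^bsub>M\<^esub>),
     add = (\<lambda>p q. j (fst (k p) \<oplus>\<^bsub>M\<^esub> fst (k q), snd (k p) \<oplus>\<^bsub>M\<^esub> snd (k q))),
     smult = (\<lambda>c p. j (c \<odot>\<^bsub>M\<^esub> fst (k p), c \<odot>\<^bsub>M\<^esub> snd (k p))),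
     cinner = (\<lambda>p q. cinner M (fst (k p)) (fst (k q)) + cinner M (snd (k p)) (snd (k q))),
     graph = {(j (x, l), j (y, m)) | x y l m. (x, y) \<in> graph M \<and> (l, m) \<in> graph M \<and> l \<in> L \<and> m \<in> L}\<rparr>)"

text \<open>
  A reducing subspace \<open>L\<close> of \<open>Q\<close>, given by its orthogonal projection \<open>P\<close>.
\<close>
locale reducing_projection = sa_op M for M :: "'a hilb_op" (structure) +
  fixes P :: "'a \<Rightarrow> 'a"
  assumes P_in [simp, intro]: "x \<in> V \<Longrightarrow> P x \<in> V"
    and P_idem [simp]: "x \<in> V \<Longrightarrow> P (P x) = P x"
    and P_self: "\<lbrakk>x \<in> V; y \<in> V\<rbrakk> \<Longrightarrow> ip (P x) y = ip x (P y)"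
    and P_graph: "(x, y) \<in> graph M \<Longrightarrow> (P x, P y) \<in> graph M"
begin

definition L :: "'a set" where "L = {x \<in> V. P x = x}"

lemma L_in: "l \<in> L \<Longrightarrow> l \<in> V" by (simp add: L_def)
lemma P_L: "l \<in> L \<Longrightarrow> P l = l" by (simp add: L_def)
lemma P_in_L [simp, intro]: "x \<in> V \<Longrightarrow> P x \<in> L" by (simp add: L_def)

lemma P_add: "\<lbrakk>x \<in> V; y \<in> V\<rbrakk> \<Longrightarrow> P (x \<oplus> y) = P x \<oplus> P y"
  by (rule ip_eqI) (auto simp: P_self ip_simps)

lemma P_minus: "\<lbrakk>x \<in> V; y \<in> V\<rbrakk> \<Longrightarrow> P (x \<ominus> y) = P x \<ominus> P y"
  by (rule ip_eqI) (auto simp: P_self ip_simps)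

lemma P_smult: "x \<in> V \<Longrightarrow> P (c \<odot> x) = c \<odot> P x"
  by (rule ip_eqI) (auto simp: P_self ip_simps)

lemma P_neg: "x \<in> V \<Longrightarrow> P (\<ominus> x) = \<ominus> P x"
  by (rule ip_eqI) (auto simp: P_self ip_simps)

lemma P_zero [simp]: "P \<zero> = \<zero>"
  by (rule ip_eqI) (auto simp: P_self)

lemma L_zero [simp]: "\<zero> \<in> L"
  and L_add: "\<lbrakk>l \<in> L; m \<in> L\<rbrakk> \<Longrightarrow> l \<oplus> m \<in> L"
  and L_minus: "\<lbrakk>l \<in> L; m \<in> L\<rbrakk> \<Longrightarrow> l \<ominus> m \<in> L"
  and L_smult: "l \<in> L \<Longrightarrow> c \<odot> l \<in> L"
  and L_neg: "l \<in> L \<Longrightarrow> \<ominus> l \<in> L"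
  by (auto simp: L_def P_add P_minus P_smult P_neg)

lemmas L_closed = L_zero L_add L_minus L_smult L_neg

lemma P_nm_le: "nm (P x) \<le> nm x" if x: "x \<in> V"
proof -
  have "(nm (P x))\<^sup>2 = Re (ip (P x) x)"
    using x P_self[of x "P x"] cinner_commute[of x "P x"] by (simp add: nm_sq)
  also have "\<dots> \<le> nm (P x) * nm x"
    using ip_cs[of "P x" x] complex_Re_le_cmod[of "ip (P x) x"] x by simp
  finally show ?thesis
    using nm_nonneg[OF P_in[OF x]] nm_nonneg[OF x] unfolding power2_eq_square
    by (cases "nm (P x) = 0") (auto simp: mult_le_cancel_left)
qed

lemma L_tends:
  assumes "tends s x" "\<And>n. s n \<in> L"
  shows "x \<in> L"
proof -
  have "P x = x"
  proof (rule ip_eqI)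
    fix z assume z: "z \<in> V"
    have "ip (s n) (P z) = ip (s n) z" for n
      using P_self[of "s n" z] assms(2) z L_in P_L by metis
    then show "ip (P x) z = ip x z"
      using tends_ip[OF assms(1) z] tends_ip[OF assms(1), of "P z"] z tendsD(2)[OF assms(1)]
        LIMSEQ_unique by (simp add: P_self)
  qed (use tendsD[OF assms(1)] in auto)
  then show ?thesis
    using tendsD(2)[OF assms(1)] by (simp add: L_def)
qed

end

text \<open>
  The map \<open>j\<close> names the elements of the sum of \<open>M\<close> and \<open>L\<close> by elements of the underlying type, so
  that the sum can be compared with \<open>M\<close> inside one class of structures.
\<close>
locale reducing_sum = reducing_projection M P for M :: "'a hilb_op" (structure) and P +
  fixes j :: "'a \<times> 'a \<Rightarrow> 'a"
  assumes j_inj: "inj_on j (V \<times> L)"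
begin

definition N :: "'a hilb_op" where "N = sum_structure j M L"

lemma j_inv [simp]: "\<lbrakk>x \<in> V; l \<in> L\<rbrakk> \<Longrightarrow> inv_into (V \<times> L) j (j (x, l)) = (x, l)"
  by (rule inv_into_f_f[OF j_inj]) simp

lemma j_eq: "\<lbrakk>x \<in> V; l \<in> L; y \<in> V; m \<in> L\<rbrakk> \<Longrightarrow> j (x, l) = j (y, m) \<longleftrightarrow> x = y \<and> l = m"
  using inj_on_eq_iff[OF j_inj, of "(x, l)" "(y, m)"] by simp

lemma carrier_N: "carrier N = j ` (V \<times> L)"
  by (simp add: N_def sum_structure_def Let_def)

lemma in_N [simp, intro]: "\<lbrakk>x \<in> V; l \<in> L\<rbrakk> \<Longrightarrow> j (x, l) \<in> carrier N"
  by (simp add: carrier_N)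

lemma N_E:
  assumes "p \<in> carrier N" obtains x l where "x \<in> V" "l \<in> L" "p = j (x, l)"
  using assms by (auto simp: carrier_N)

lemma zero_N: "\<zero>\<^bsub>N\<^esub> = j (\<zero>, \<zero>)"
  by (simp add: N_def sum_structure_def Let_def)

lemma add_N: "\<lbrakk>x \<in> V; l \<in> L; y \<in> V; m \<in> L\<rbrakk> \<Longrightarrow> j (x, l) \<oplus>\<^bsub>N\<^esub> j (y, m) = j (x \<oplus> y, l \<oplus> m)"
  by (simp add: N_def sum_structure_def Let_def)

lemma smult_N: "\<lbrakk>x \<in> V; l \<in> L\<rbrakk> \<Longrightarrow> c \<odot>\<^bsub>N\<^esub> j (x, l) = j (c \<odot> x, c \<odot> l)"
  by (simp add: N_def sum_structure_def Let_def)

lemma cinner_N: "\<lbrakk>x \<in> V; l \<in> L; y \<in> V; m \<in> L\<rbrakk> \<Longrightarrow> cinner N (j (x, l)) (j (y, m)) = ip x y + ip l m"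
  by (simp add: N_def sum_structure_def Let_def)

lemma graph_N: "graph N = {(j (x, l), j (y, m)) | x y l m.
    (x, y) \<in> graph M \<and> (l, m) \<in> graph M \<and> l \<in> L \<and> m \<in> L}"
  by (simp add: N_def sum_structure_def Let_def)

lemma graph_N_iff: "\<lbrakk>x \<in> V; l \<in> L; y \<in> V; m \<in> L\<rbrakk> \<Longrightarrow>
    (j (x, l), j (y, m)) \<in> graph N \<longleftrightarrow> (x, y) \<in> graph M \<and> (l, m) \<in> graph M"
  unfolding graph_N using gr_in by (auto simp: j_eq)

lemma graph_N_E:
  assumes "p \<in> graph N"
  obtains x l y m where "p = (j (x, l), j (y, m))" "(x, y) \<in> graph M" "(l, m) \<in> graph M"
    "l \<in> L" "m \<in> L" "x \<in> V" "y \<in> V"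
  using assms gr_in unfolding graph_N by blast

lemmas N_simps = add_N smult_N cinner_N zero_N L_closed L_in

lemma abelian_group_N: "abelian_group N"
proof (rule abelian_groupI)
  show "\<exists>q\<in>carrier N. q \<oplus>\<^bsub>N\<^esub> p = \<zero>\<^bsub>N\<^esub>" if pN: "p \<in> carrier N" for p
  proof -
    obtain x l where p: "x \<in> V" "l \<in> L" "p = j (x, l)" using pN by (rule N_E)
    show ?thesis
      by (rule bexI[of _ "j (\<ominus> x, \<ominus> l)"]) (use p in \<open>auto simp: N_simps M.l_neg\<close>)
  qed
qed (auto elim!: N_E simp: N_simps M.a_ac)

lemma module_N: "Module.module (ring_of_type_algebra :: complex ring) N"
  by (rule moduleI[OF R.cring_axioms abelian_group_N])
    (auto elim!: N_E simp: N_simps j_eq ring_of_type_algebra_def,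
      auto intro!: ip_eqI simp: N_simps ip_simps algebra_simps)

sublocale N: inner_product_space N
proof (intro inner_product_space.intro module_N inner_product_space_axioms.intro)
  fix p q assume pq: "p \<in> carrier N" "q \<in> carrier N"
  obtain x l where p: "x \<in> V" "l \<in> L" "p = j (x, l)" using pq(1) by (rule N_E)
  obtain y m where q: "y \<in> V" "m \<in> L" "q = j (y, m)" using pq(2) by (rule N_E)
  show "cinner N (c \<odot>\<^bsub>N\<^esub> p) q = c * cinner N p q" for c
    using p q by (simp add: N_simps ip_simps algebra_simps)
  show "cinner N q p = cnj (cinner N p q)"
    using p q cinner_commute[of x y] cinner_commute[of l m] by (simp add: cinner_N L_in)
  fix r assume "r \<in> carrier N"
  then obtain z n where r: "z \<in> V" "n \<in> L" "r = j (z, n)" by (rule N_E)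
  show "cinner N (p \<oplus>\<^bsub>N\<^esub> q) r = cinner N p r + cinner N q r"
    using p q r by (simp add: N_simps ip_simps)
next
  fix p assume "p \<in> carrier N"
  then obtain x l where p: "x \<in> V" "l \<in> L" "p = j (x, l)" by (rule N_E)
  show "0 \<le> Re (cinner N p p)"
    using p by (simp add: cinner_N cinner_nonneg L_in)
  assume "cinner N p p = 0"
  then have "complex_of_real ((nm x)\<^sup>2 + (nm l)\<^sup>2) = 0"
    using p L_in[OF p(2)] by (simp add: cinner_N ip_self)
  then have "(nm x)\<^sup>2 + (nm l)\<^sup>2 = 0"
    unfolding of_real_eq_0_iff .
  then show "p = \<zero>\<^bsub>N\<^esub>"
    using p L_in[OF p(2)] by (simp add: sum_power2_eq_zero_iff nm_eq_0 zero_N)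
qed

lemma minus_N:
  assumes "x \<in> V" "l \<in> L" "y \<in> V" "m \<in> L"
  shows "j (x, l) \<ominus>\<^bsub>N\<^esub> j (y, m) = j (x \<ominus> y, l \<ominus> m)"
proof -
  have "j (\<ominus> y, \<ominus> m) \<oplus>\<^bsub>N\<^esub> j (y, m) = \<zero>\<^bsub>N\<^esub>"
    using assms by (simp add: N_simps M.l_neg)
  then have "\<ominus>\<^bsub>N\<^esub> j (y, m) = j (\<ominus> y, \<ominus> m)"
    using assms by (intro N.M.minus_equality) (auto simp: N_simps)
  then show ?thesis
    using assms by (simp add: a_minus_def N_simps)
qed

lemma hnorm_N_sq: "\<lbrakk>x \<in> V; l \<in> L\<rbrakk> \<Longrightarrow> (hnorm N (j (x, l)))\<^sup>2 = (nm x)\<^sup>2 + (nm l)\<^sup>2"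
  using L_in[of l] by (simp add: hnorm_def cinner_N cinner_nonneg)

lemma hnorm_N: "\<lbrakk>x \<in> V; l \<in> L\<rbrakk> \<Longrightarrow> hnorm N (j (x, l)) = sqrt ((nm x)\<^sup>2 + (nm l)\<^sup>2)"
  using L_in[of l] by (simp add: hnorm_def cinner_N cinner_nonneg)

lemma hnorm_N_le: "\<lbrakk>x \<in> V; l \<in> L\<rbrakk> \<Longrightarrow> hnorm N (j (x, l)) \<le> nm x + nm l"
  using L_in[of l] by (simp add: hnorm_N sqrt_sum_squares_le_sum)

lemma nm_le_hnorm_N:
  assumes "x \<in> V" "l \<in> L" shows "nm x \<le> hnorm N (j (x, l))" "nm l \<le> hnorm N (j (x, l))"
  using assms by (auto simp: hnorm_N)

lemma hdist_N: "\<lbrakk>x \<in> V; l \<in> L; y \<in> V; m \<in> L\<rbrakk> \<Longrightarrow>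
    hdist N (j (x, l)) (j (y, m)) = hnorm N (j (x \<ominus> y, l \<ominus> m))"
  by (simp add: hdist_def minus_N)

lemma hilbert_N: "complex_hilbert_space N"
proof -
  have "N.MS.mcomplete"
    unfolding N.MS.mcomplete_def
  proof (intro allI impI)
    fix s assume s: "N.MS.MCauchy s"
    then have sN: "s n \<in> carrier N" for n
      by (auto simp: N.MS.MCauchy_def)
    have "\<exists>x l. x \<in> V \<and> l \<in> L \<and> s n = j (x, l)" for n
      using sN[of n] by (auto simp: carrier_N)
    then obtain x l where xl: "\<And>n. x n \<in> V" "\<And>n. l n \<in> L" "\<And>n. s n = j (x n, l n)"
      by metis
    have hd: "hdist N (s n) (s n') = hnorm N (j (x n \<ominus> x n', l n \<ominus> l n'))" for n n'
      using xl by (simp add: hdist_N)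
    note dom = MCauchy_dominated[OF N.MS.Metric_space_axioms MS.Metric_space_axioms s]
    have "MS.MCauchy x"
      by (rule dom[OF xl(1)])
        (use xl(1,2) nm_le_hnorm_N(1) in \<open>simp add: hd hdist_eq L_closed\<close>)
    then obtain x0 where x0: "tends x x0" by (rule cauchy_tends)
    have "MS.MCauchy l"
      by (rule dom[OF L_in[OF xl(2)]])
        (use xl(1,2) nm_le_hnorm_N(2) in \<open>simp add: hd hdist_eq L_closed L_in\<close>)
    then obtain l0 where l0: "tends l l0" by (rule cauchy_tends)
    note lim = x0 l0
    have V: "x0 \<in> V" "l0 \<in> L"
      using tendsD(2)[OF lim(1)] L_tends[OF lim(2)] xl by auto
    have "(\<lambda>n. sqrt ((nm (x n \<ominus> x0))\<^sup>2 + (nm (l n \<ominus> l0))\<^sup>2)) \<longlonglongrightarrow> sqrt (0\<^sup>2 + 0\<^sup>2)"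
      by (intro tendsto_intros tendsD(3) lim)
    then have "(\<lambda>n. hdist N (s n) (j (x0, l0))) \<longlonglongrightarrow> 0"
      using xl V by (simp add: hdist_N hnorm_N L_closed)
    then show "\<exists>p. limitin N.MS.mtopology s p sequentially"
      using xl V by (intro exI[of _ "j (x0, l0)"]) (simp add: N.MS.limitin_metric_dist_null)
  qed
  note complete_N = this
  show ?thesis
    by (intro complex_hilbert_space.intro module_N complex_hilbert_space_axioms.intro)
      (rule complete_N N.cinner_add N.cinner_smult N.cinner_commute N.cinner_nonneg
        N.cinner_eq_0; assumption)+
qed

sublocale N: complex_hilbert_space N
  by (rule hilbert_N)

lemma linear_N: "linear_op N"
proof -
  have "single_valued (graph N)"
    unfolding single_valued_def
  proof (intro allI impI)
    fix p q q' assume "(p, q) \<in> graph N" "(p, q') \<in> graph N"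
    then show "q = q'"
      using gr_unique gr_in by (auto elim!: graph_N_E simp: j_eq)
  qed
  moreover have "graph N \<subseteq> carrier N \<times> carrier N"
    by (auto elim!: graph_N_E)
  moreover have "(\<zero>\<^bsub>N\<^esub>, \<zero>\<^bsub>N\<^esub>) \<in> graph N"
    by (simp add: zero_N graph_N_iff)
  moreover have "(c \<odot>\<^bsub>N\<^esub> p, c \<odot>\<^bsub>N\<^esub> q) \<in> graph N" if "(p, q) \<in> graph N" for p q c
    using that by (auto elim!: graph_N_E simp: N_simps graph_N_iff gr_smult)
  moreover have "(p \<oplus>\<^bsub>N\<^esub> p', q \<oplus>\<^bsub>N\<^esub> q') \<in> graph N"
    if "(p, q) \<in> graph N" "(p', q') \<in> graph N" for p q p' q'
    using that by (auto elim!: graph_N_E simp: N_simps graph_N_iff gr_add)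
  ultimately show ?thesis
    unfolding linear_op_def by blast
qed

lemma dense_N: "densely_defined N"
proof -
  have sub: "Domain (graph N) \<subseteq> carrier N"
    using gr_in by (auto elim!: graph_N_E)
  have "\<exists>d\<in>Domain (graph N). hnorm N (p \<ominus>\<^bsub>N\<^esub> d) < e" if pN: "p \<in> carrier N" and e: "e > 0" for p e
  proof -
    obtain x l where p: "x \<in> V" "l \<in> L" "p = j (x, l)" using pN by (rule N_E)
    obtain u w where uw: "(u, w) \<in> graph M" "nm (x \<ominus> u) < e / 2"
      using dense_domain[of x "e / 2"] p e by auto
    obtain u' w' where uw': "(u', w') \<in> graph M" "nm (l \<ominus> u') < e / 2"
      using dense_domain[of l "e / 2"] p e L_in by auto
    note V = gr_in[OF uw(1)] gr_in[OF uw'(1)]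
    have "nm (l \<ominus> P u') \<le> nm (l \<ominus> u')"
      using P_nm_le[of "l \<ominus> u'"] p V L_in by (simp add: P_minus P_L)
    moreover have "hnorm N (j (x, l) \<ominus>\<^bsub>N\<^esub> j (u, P u')) \<le> nm (x \<ominus> u) + nm (l \<ominus> P u')"
      using p V by (simp add: minus_N hnorm_N_le L_closed)
    ultimately have "hnorm N (p \<ominus>\<^bsub>N\<^esub> j (u, P u')) < e"
      using uw(2) uw'(2) unfolding p(3) by linarith
    moreover have "(j (u, P u'), j (w, P w')) \<in> graph N"
      using V uw uw' P_graph by (simp add: graph_N_iff)
    ultimately show ?thesis by blast
  qed
  then show ?thesis
    unfolding densely_defined_def by (subst N.closure_of_eq_iff[OF sub]) blast
qed

text \<open>
  On the second summand the adjoint condition is tested only against pairs of the graph in \<open>L\<close>. It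
  extends to all pairs, because \<open>P\<close> projects the graph to such pairs.
\<close>
lemma adjoint_N: "adjoint_graph N = graph N"
proof (intro equalityI subsetI)
  fix pq assume pq: "pq \<in> adjoint_graph N"
  then obtain x l y m where p: "pq = (j (x, l), j (y, m))" "x \<in> V" "l \<in> L" "y \<in> V" "m \<in> L"
    unfolding adjoint_graph_def by (auto elim!: N_E)
  have adj: "ip w x + ip w' l = ip u y + ip u' m"
    if "(u, w) \<in> graph M" "(u', w') \<in> graph M" "u' \<in> L" "w' \<in> L" for u w u' w'
  proof -
    have "(j (u, u'), j (w, w')) \<in> graph N"
      using that gr_in by (simp add: graph_N_iff)
    then have "cinner N (j (w, w')) (j (x, l)) = cinner N (j (u, u')) (j (y, m))"
      using pq p(1) unfolding adjoint_graph_def by fast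
    then show ?thesis
      using that gr_in p by (simp add: cinner_N)
  qed
  have "(x, y) \<in> graph M"
  proof (rule gr_adjI)
    show "ip w x = ip u y" if "(u, w) \<in> graph M" for u w
      using adj[OF that gr_zero] p L_in by simp
  qed (use p in auto)
  moreover have "(l, m) \<in> graph M"
  proof (rule gr_adjI)
    fix u w assume uw: "(u, w) \<in> graph M"
    note V = gr_in[OF uw]
    have "ip (P w) l = ip (P u) m"
      using adj[OF gr_zero P_graph[OF uw]] V p by simp
    then show "ip w l = ip u m"
      using V p L_in by (simp add: P_self P_L)
  qed (use p L_in in auto)
  ultimately show "pq \<in> graph N"
    using p by (simp add: graph_N_iff)
next
  fix pq assume "pq \<in> graph N"
  then obtain x l y m where p: "pq = (j (x, l), j (y, m))" "(x, y) \<in> graph M" "(l, m) \<in> graph M"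
    "l \<in> L" "m \<in> L" "x \<in> V" "y \<in> V"
    by (rule graph_N_E)
  show "pq \<in> adjoint_graph N"
    unfolding adjoint_graph_def using p
    by (auto elim!: graph_N_E simp: cinner_N gr_sym[OF p(2)] gr_sym[OF p(3)])
qed

sublocale N: sa_op N
  by unfold_locales (rule linear_N dense_N adjoint_N)+

end

section \<open>Spectrum and essential spectrum of the sum\<close>

lemma not_spectrum_iff: "c \<notin> spectrum M \<longleftrightarrow>
    (\<exists>S. bounded_op M S \<and> (\<forall>v\<in>carrier M. (S v, v) \<in> shifted_graph M c) \<and>
      (\<forall>x y. (x, y) \<in> shifted_graph M c \<longrightarrow> S y = x))"
  unfolding spectrum_def mem_Collect_eq not_not Ball_def by simp

lemma not_ess_spectrum_iff: "c \<notin> ess_spectrum M \<longleftrightarrow>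
    (\<exists>S K. bounded_op M S \<and> compact_op M K \<and>
      (\<forall>v\<in>carrier M. (S v, v \<oplus>\<^bsub>M\<^esub> K v) \<in> shifted_graph M c))"
  unfolding ess_spectrum_def mem_Collect_eq not_not ..

lemma (in sa_op) shifted_iff:
  assumes "y \<in> V"
  shows "(x, y) \<in> shifted_graph M c \<longleftrightarrow> (x, y \<oplus> c \<odot> x) \<in> graph M"
proof
  assume "(x, y) \<in> shifted_graph M c"
  then obtain y' where y': "(x, y') \<in> graph M" "y = y' \<ominus> c \<odot> x"
    by (auto simp: shifted_graph_def)
  have "y \<oplus> c \<odot> x = y'"
    using gr_in[OF y'(1)] by (intro ip_eqI) (auto simp: y'(2) ip_simps)
  then show "(x, y \<oplus> c \<odot> x) \<in> graph M" using y' by simp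
next
  assume *: "(x, y \<oplus> c \<odot> x) \<in> graph M"
  have "y = (y \<oplus> c \<odot> x) \<ominus> c \<odot> x"
    using gr_in[OF *] assms by (intro ip_eqI) (auto simp: ip_simps)
  then show "(x, y) \<in> shifted_graph M c"
    using * by (auto simp: shifted_graph_def)
qed

lemma (in sa_op) shifted_in:
  assumes "(x, y) \<in> shifted_graph M c"
  shows "x \<in> V" "y \<in> V"
  using assms gr_in by (auto simp: shifted_graph_def)

context complex_hilbert_space
begin

lemma bounded_opD:
  assumes "bounded_op H S"
  shows "x \<in> V \<Longrightarrow> S x \<in> V"
    and "\<lbrakk>x \<in> V; y \<in> V\<rbrakk> \<Longrightarrow> S (x \<oplus> y) = S x \<oplus> S y"
    and "x \<in> V \<Longrightarrow> S (c \<odot> x) = c \<odot> S x"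
  using assms by (auto simp: bounded_op_def)

lemma bounded_op_bound:
  assumes "bounded_op H S"
  obtains B where "B \<ge> 0" "\<And>x. x \<in> V \<Longrightarrow> nm (S x) \<le> B * nm x"
proof -
  obtain B where B: "\<And>x. x \<in> V \<Longrightarrow> nm (S x) \<le> B * nm x"
    using assms unfolding bounded_op_def by blast
  have "nm (S x) \<le> max B 0 * nm x" if "x \<in> V" for x
  proof -
    have "B * nm x \<le> max B 0 * nm x"
      using that by (intro mult_right_mono) auto
    then show ?thesis using B[OF that] by linarith
  qed
  then show ?thesis using that[of "max B 0"] by auto
qed

lemma bounded_opI:
  assumes "\<And>x. x \<in> V \<Longrightarrow> S x \<in> V"
    and "\<And>x y. \<lbrakk>x \<in> V; y \<in> V\<rbrakk> \<Longrightarrow> S (x \<oplus> y) = S x \<oplus> S y"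
    and "\<And>c x. x \<in> V \<Longrightarrow> S (c \<odot> x) = c \<odot> S x"
    and "\<And>x. x \<in> V \<Longrightarrow> nm (S x) \<le> B * nm x"
  shows "bounded_op H S"
  unfolding bounded_op_def by (intro conjI ballI allI exI[of _ B]) (auto simp: assms)

text \<open>
  In a complete space the closure of the image of the unit ball is compact iff the image is
  totally bounded, which is a condition on Cauchy subsequences.
\<close>
lemma compact_op_iff:
  "compact_op H S \<longleftrightarrow> bounded_op H S \<and>
    (\<forall>f::nat \<Rightarrow> 'a. (\<forall>n. f n \<in> V \<and> nm (f n) \<le> 1) \<longrightarrow> (\<exists>r. strict_mono r \<and> MS.MCauchy (\<lambda>n. S (f (r n)))))"
proof (cases "bounded_op H S")
  case True
  let ?B = "S ` {x \<in> V. nm x \<le> 1}"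
  have B: "?B \<subseteq> V" using bounded_opD(1)[OF True] by auto
  have "compact_op H S \<longleftrightarrow> MS.mtotally_bounded ?B"
    using True B complete by (simp add: compact_op_def MS.mtotally_bounded_eq_compact_closure_of)
  also have "\<dots> \<longleftrightarrow> (\<forall>\<sigma>::nat \<Rightarrow> 'a. range \<sigma> \<subseteq> ?B \<longrightarrow> (\<exists>r. strict_mono r \<and> MS.MCauchy (\<sigma> \<circ> r)))"
    using B by (simp add: MS.mtotally_bounded_sequentially)
  also have "\<dots> \<longleftrightarrow> (\<forall>f::nat \<Rightarrow> 'a. (\<forall>n. f n \<in> V \<and> nm (f n) \<le> 1) \<longrightarrow> (\<exists>r. strict_mono r \<and> MS.MCauchy (\<lambda>n. S (f (r n)))))"
    (is "?l = ?r")
  proof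
    assume l: ?l
    show ?r
    proof (intro allI impI)
      fix f :: "nat \<Rightarrow> 'a" assume "\<forall>n. f n \<in> V \<and> nm (f n) \<le> 1"
      then have "range (S \<circ> f) \<subseteq> ?B" by auto
      then show "\<exists>r. strict_mono r \<and> MS.MCauchy (\<lambda>n. S (f (r n)))"
        using l[rule_format, of "S \<circ> f"] by (simp add: comp_def)
    qed
  next
    assume r: ?r
    show ?l
    proof (intro allI impI)
      fix \<sigma> :: "nat \<Rightarrow> 'a" assume \<sigma>: "range \<sigma> \<subseteq> ?B"
      have "\<exists>x. x \<in> V \<and> nm x \<le> 1 \<and> \<sigma> n = S x" for n
      proof -
        have "\<sigma> n \<in> ?B" using \<sigma> by auto
        then show ?thesis by auto
      qed
      then obtain f where f: "\<And>n. f n \<in> V \<and> nm (f n) \<le> 1" "\<And>n. \<sigma> n = S (f n)"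
        by metis
      show "\<exists>r. strict_mono r \<and> MS.MCauchy (\<sigma> \<circ> r)"
        using r[rule_format, of f] f by (simp add: comp_def)
    qed
  qed
  finally show ?thesis using True by simp
qed (simp add: compact_op_def)

end

context reducing_sum
begin

lemma shifted_N_iff:
  assumes "x \<in> V" "l \<in> L" "y \<in> V" "m \<in> L"
  shows "(j (x, l), j (y, m)) \<in> shifted_graph N c \<longleftrightarrow>
    (x, y) \<in> shifted_graph M c \<and> (l, m) \<in> shifted_graph M c"
  using assms by (simp add: N.shifted_iff shifted_iff N_simps graph_N_iff)

lemma P_shifted: "(x, y) \<in> shifted_graph M c \<Longrightarrow> (P x, P y) \<in> shifted_graph M c"
  using P_graph gr_in by (fastforce simp: shifted_graph_def P_minus P_smult)

text \<open>
  Lifting and compressing carry resolvents, and inverses modulo compact operators, from \<open>M\<close> to the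
  sum and back. An operator is cut down to \<open>L\<close> by \<open>P\<close>, which is harmless as \<open>P\<close> commutes with \<open>Q\<close>.
\<close>
definition coord1 :: "'a \<Rightarrow> 'a" where "coord1 p = fst (inv_into (V \<times> L) j p)"
definition coord2 :: "'a \<Rightarrow> 'a" where "coord2 p = snd (inv_into (V \<times> L) j p)"
definition lift_op :: "('a \<Rightarrow> 'a) \<Rightarrow> 'a \<Rightarrow> 'a" where
  "lift_op S p = j (S (coord1 p), P (S (coord2 p)))"
definition compress_op :: "('a \<Rightarrow> 'a) \<Rightarrow> 'a \<Rightarrow> 'a" where
  "compress_op S x = coord1 (S (j (x, \<zero>)))"

lemma coord_j [simp]: "\<lbrakk>x \<in> V; l \<in> L\<rbrakk> \<Longrightarrow> coord1 (j (x, l)) = x" "\<lbrakk>x \<in> V; l \<in> L\<rbrakk> \<Longrightarrow> coord2 (j (x, l)) = l"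
  by (auto simp: coord1_def coord2_def)

lemma coord_in [simp]: "p \<in> N.V \<Longrightarrow> coord1 p \<in> V" "p \<in> N.V \<Longrightarrow> coord2 p \<in> L"
  and j_coord: "p \<in> N.V \<Longrightarrow> j (coord1 p, coord2 p) = p"
  by (auto elim!: N_E)

lemma lift_op_j [simp]: "\<lbrakk>x \<in> V; l \<in> L\<rbrakk> \<Longrightarrow> lift_op S (j (x, l)) = j (S x, P (S l))"
  by (simp add: lift_op_def)

lemma coord1_linear:
  assumes "p \<in> N.V"
  shows "q \<in> N.V \<Longrightarrow> coord1 (p \<oplus>\<^bsub>N\<^esub> q) = coord1 p \<oplus> coord1 q"
    "coord1 (c \<odot>\<^bsub>N\<^esub> p) = c \<odot> coord1 p"
    "q \<in> N.V \<Longrightarrow> coord1 (p \<ominus>\<^bsub>N\<^esub> q) = coord1 p \<ominus> coord1 q"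
  using assms by (auto elim!: N_E simp: N_simps minus_N)

lemma nm_coord1_le: "p \<in> N.V \<Longrightarrow> nm (coord1 p) \<le> N.nm p"
  and nm_coord2_le: "p \<in> N.V \<Longrightarrow> nm (coord2 p) \<le> N.nm p"
  by (auto elim!: N_E simp: nm_le_hnorm_N)

lemma bounded_lift:
  assumes "bounded_op M S"
  shows "bounded_op N (lift_op S)"
proof -
  note S = bounded_opD[OF assms]
  obtain B where B: "B \<ge> 0" "\<And>x. x \<in> V \<Longrightarrow> nm (S x) \<le> B * nm x"
    using bounded_op_bound[OF assms] by blast
  show ?thesis
  proof (rule N.bounded_opI)
    fix p assume p: "p \<in> N.V"
    then obtain x l where xl: "x \<in> V" "l \<in> L" "p = j (x, l)" by (rule N_E)
    have "N.nm (lift_op S p) \<le> nm (S x) + nm (P (S l))"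
      using xl S L_in by (simp add: hnorm_N_le)
    also have "\<dots> \<le> nm (S x) + nm (S l)"
      using xl S L_in by (simp add: P_nm_le)
    also have "\<dots> \<le> B * nm x + B * nm l"
      using xl L_in B by (intro add_mono) auto
    also have "\<dots> \<le> B * N.nm p + B * N.nm p"
      using xl B by (intro add_mono mult_left_mono) (auto simp: nm_le_hnorm_N)
    finally show "N.nm (lift_op S p) \<le> (2 * B) * N.nm p" by simp
  qed (auto elim!: N_E simp: N_simps S P_add P_smult)
qed

lemma bounded_compress:
  assumes "bounded_op N S"
  shows "bounded_op M (compress_op S)"
proof -
  note S = N.bounded_opD[OF assms]
  obtain B where B: "B \<ge> 0" "\<And>x. x \<in> N.V \<Longrightarrow> N.nm (S x) \<le> B * N.nm x"
    using N.bounded_op_bound[OF assms] by blast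
  show ?thesis
  proof (rule bounded_opI)
    fix x assume x: "x \<in> V"
    have "nm (compress_op S x) \<le> N.nm (S (j (x, \<zero>)))"
      using x S by (simp add: compress_op_def nm_coord1_le)
    also have "\<dots> \<le> B * N.nm (j (x, \<zero>))"
      using x B by simp
    finally show "nm (compress_op S x) \<le> B * nm x"
      using x by (simp add: hnorm_N)
  next
    fix x y assume xy: "x \<in> V" "y \<in> V"
    have "j (x \<oplus> y, \<zero>) = j (x, \<zero>) \<oplus>\<^bsub>N\<^esub> j (y, \<zero>)"
      using xy by (simp add: add_N)
    then show "compress_op S (x \<oplus> y) = compress_op S x \<oplus> compress_op S y"
      using xy S by (simp add: compress_op_def coord1_linear)
  next
    fix c x assume x: "x \<in> V"
    have "c \<odot> \<zero> = \<zero>" by (rule ip_eqI) (auto simp: ip_simps)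
    then have "j (c \<odot> x, \<zero>) = c \<odot>\<^bsub>N\<^esub> j (x, \<zero>)"
      using x by (simp add: smult_N)
    then show "compress_op S (c \<odot> x) = c \<odot> compress_op S x"
      using x S by (simp add: compress_op_def coord1_linear)
  qed (use S in \<open>auto simp: compress_op_def\<close>)
qed

lemma MCauchy_j:
  assumes "MS.MCauchy x" "MS.MCauchy l" "\<And>n. l n \<in> L"
  shows "N.MS.MCauchy (\<lambda>n. j (x n, l n))"
  unfolding N.MS.MCauchy_def
proof (intro conjI allI impI)
  have xV: "x n \<in> V" for n using assms(1) by (auto simp: MS.MCauchy_def)
  show "range (\<lambda>n. j (x n, l n)) \<subseteq> N.V" using xV assms(3) by auto
  fix e :: real assume e: "e > 0"
  obtain k1 where k1: "\<And>n n'. k1 \<le> n \<Longrightarrow> k1 \<le> n' \<Longrightarrow> hdist M (x n) (x n') < e/2"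
    using assms(1) e unfolding MS.MCauchy_def by (meson half_gt_zero)
  obtain k2 where k2: "\<And>n n'. k2 \<le> n \<Longrightarrow> k2 \<le> n' \<Longrightarrow> hdist M (l n) (l n') < e/2"
    using assms(2) e unfolding MS.MCauchy_def by (meson half_gt_zero)
  show "\<exists>k. \<forall>n n'. k \<le> n \<longrightarrow> k \<le> n' \<longrightarrow> hdist N (j (x n, l n)) (j (x n', l n')) < e"
  proof (intro exI[of _ "max k1 k2"] allI impI)
    fix n n' assume "max k1 k2 \<le> n" "max k1 k2 \<le> n'"
    then have "nm (x n \<ominus> x n') < e/2" "nm (l n \<ominus> l n') < e/2"
      using k1[of n n'] k2[of n n'] xV assms(3) L_in by (auto simp: hdist_eq)
    moreover have "hdist N (j (x n, l n)) (j (x n', l n')) \<le> nm (x n \<ominus> x n') + nm (l n \<ominus> l n')"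
      using xV assms(3) by (simp add: hdist_N hnorm_N_le L_closed)
    ultimately show "hdist N (j (x n, l n)) (j (x n', l n')) < e" by linarith
  qed
qed

lemma compact_lift:
  assumes "compact_op M K"
  shows "compact_op N (lift_op K)"
proof -
  have b: "bounded_op M K" using assms by (simp add: compact_op_def)
  note K = bounded_opD[OF b]
  have c: "\<exists>r. strict_mono r \<and> MS.MCauchy (\<lambda>n. K (f (r n)))" if "\<And>n. f n \<in> V \<and> nm (f n) \<le> 1" for f :: "nat \<Rightarrow> 'a"
    using assms that unfolding compact_op_iff by blast
  show ?thesis
    unfolding N.compact_op_iff
  proof (intro conjI allI impI bounded_lift b)
    fix f :: "nat \<Rightarrow> 'a" assume f: "\<forall>n. f n \<in> N.V \<and> N.nm (f n) \<le> 1"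
    define x where "x n = coord1 (f n)" for n
    define l where "l n = coord2 (f n)" for n
    have xl: "x n \<in> V" "l n \<in> L" "f n = j (x n, l n)" "nm (x n) \<le> 1" "nm (l n) \<le> 1" for n
      using f[rule_format, of n] nm_coord1_le[of "f n"] nm_coord2_le[of "f n"]
      by (auto simp: x_def l_def j_coord)
    obtain r where r: "strict_mono r" "MS.MCauchy (\<lambda>n. K (x (r n)))"
      using c[of x] xl by auto
    obtain r' where r': "strict_mono r'" "MS.MCauchy (\<lambda>n. K (l (r (r' n))))"
      using c[of "\<lambda>n. l (r n)"] xl L_in by auto
    have "MS.MCauchy (\<lambda>n. P (K (l (r (r' n)))))"
      by (rule MCauchy_dominated[OF MS.Metric_space_axioms MS.Metric_space_axioms r'(2)])
        (use xl(2) K(1) L_in P_nm_le in \<open>auto simp: P_minus[symmetric] hdist_eq\<close>)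
    moreover have "MS.MCauchy (\<lambda>n. K (x (r (r' n))))"
      using MS.MCauchy_subsequence[OF r'(1) r(2)] by (simp add: comp_def)
    ultimately have "N.MS.MCauchy (\<lambda>n. j (K (x (r (r' n))), P (K (l (r (r' n))))))"
      using xl(2) K(1) L_in by (intro MCauchy_j) auto
    then have "N.MS.MCauchy (\<lambda>n. lift_op K (f ((r \<circ> r') n)))"
      using xl(1-3) by simp
    moreover have "strict_mono (r \<circ> r')"
      using r(1) r'(1) by (rule strict_mono_o)
    ultimately show "\<exists>r. strict_mono r \<and> N.MS.MCauchy (\<lambda>n. lift_op K (f (r n)))" by blast
  qed
qed

lemma compact_compress:
  assumes "compact_op N K"
  shows "compact_op M (compress_op K)"
proof -
  have b: "bounded_op N K" using assms by (simp add: compact_op_def)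
  note K = N.bounded_opD[OF b]
  show ?thesis
    unfolding compact_op_iff
  proof (intro conjI allI impI bounded_compress b)
    fix f :: "nat \<Rightarrow> 'a" assume f: "\<forall>n. f n \<in> V \<and> nm (f n) \<le> 1"
    then have "j (f n, \<zero>) \<in> N.V \<and> N.nm (j (f n, \<zero>)) \<le> 1" for n
      by (simp add: hnorm_N)
    then obtain r where r: "strict_mono r" "N.MS.MCauchy (\<lambda>n. K (j (f (r n), \<zero>)))"
      using conjunct2[OF iffD1[OF N.compact_op_iff assms], rule_format, of "\<lambda>n. j (f n, \<zero>)"]
      by auto
    have KV: "K (j (f n, \<zero>)) \<in> N.V" for n
      using K f by simp
    have "MS.MCauchy (\<lambda>n. compress_op K (f (r n)))"
      by (rule MCauchy_dominated[OF N.MS.Metric_space_axioms MS.Metric_space_axioms r(2)])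
        (use KV in \<open>auto simp: compress_op_def hdist_eq N.hdist_eq coord1_linear(3)[symmetric]
          intro: nm_coord1_le\<close>)
    then show "\<exists>r. strict_mono r \<and> MS.MCauchy (\<lambda>n. compress_op K (f (r n)))"
      using r(1) by blast
  qed
qed

lemma compress_shifted:
  assumes "bounded_op N S" "(S (j (x, \<zero>)), q) \<in> shifted_graph N c"
  shows "(coord1 (S (j (x, \<zero>))), coord1 q) \<in> shifted_graph M c"
  using N.shifted_in[OF assms(2)] assms(2) by (auto elim!: N_E simp: shifted_N_iff)

lemma spectrum_N: "spectrum N = spectrum M"
proof -
  have "c \<notin> spectrum N \<longleftrightarrow> c \<notin> spectrum M" for c
  proof
    assume "c \<notin> spectrum N"
    then obtain S where S: "bounded_op N S" "\<And>v. v \<in> N.V \<Longrightarrow> (S v, v) \<in> shifted_graph N c"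
        "\<And>x y. (x, y) \<in> shifted_graph N c \<Longrightarrow> S y = x"
      unfolding not_spectrum_iff by blast
    have z: "(\<zero>, \<zero>) \<in> shifted_graph M c"
    proof -
      have "\<zero> \<oplus> c \<odot> \<zero> = \<zero>" by (rule ip_eqI) (auto simp: ip_simps)
      then show ?thesis by (simp add: shifted_iff)
    qed
    have "(compress_op S v, v) \<in> shifted_graph M c" if "v \<in> V" for v
      using compress_shifted[OF S(1) S(2)[of "j (v, \<zero>)"]] that by (simp add: compress_op_def)
    moreover have "compress_op S y = x" if "(x, y) \<in> shifted_graph M c" for x y
    proof -
      have "(j (x, \<zero>), j (y, \<zero>)) \<in> shifted_graph N c"
        using that z shifted_in[OF that] by (simp add: shifted_N_iff)
      then have "S (j (y, \<zero>)) = j (x, \<zero>)"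
        by (rule S(3))
      then show ?thesis
        using shifted_in[OF that] by (simp add: compress_op_def)
    qed
    ultimately show "c \<notin> spectrum M"
      unfolding not_spectrum_iff
      by (intro exI[of _ "compress_op S"] conjI ballI allI impI bounded_compress[OF S(1)])
  next
    assume "c \<notin> spectrum M"
    then obtain S where S: "bounded_op M S" "\<And>v. v \<in> V \<Longrightarrow> (S v, v) \<in> shifted_graph M c"
        "\<And>x y. (x, y) \<in> shifted_graph M c \<Longrightarrow> S y = x"
      unfolding not_spectrum_iff by blast
    have "(lift_op S p, p) \<in> shifted_graph N c" if "p \<in> N.V" for p
    proof -
      obtain x l where xl: "x \<in> V" "l \<in> L" "p = j (x, l)" using \<open>p \<in> N.V\<close> by (rule N_E)
      have "(P (S l), P l) \<in> shifted_graph M c"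
        using xl L_in by (intro P_shifted S(2)) auto
      then show ?thesis
        using xl S(2) bounded_opD(1)[OF S(1)] by (simp add: shifted_N_iff P_L L_in)
    qed
    moreover have "lift_op S q = p" if pq: "(p, q) \<in> shifted_graph N c" for p q
    proof -
      obtain x l where p: "x \<in> V" "l \<in> L" "p = j (x, l)" using N.shifted_in(1)[OF pq] by (rule N_E)
      obtain y m where q: "y \<in> V" "m \<in> L" "q = j (y, m)" using N.shifted_in(2)[OF pq] by (rule N_E)
      have "S y = x" "S m = l"
        using pq p q by (auto simp: shifted_N_iff intro: S(3))
      then show ?thesis
        using p q by (simp add: P_L)
    qed
    ultimately show "c \<notin> spectrum N"
      unfolding not_spectrum_iff
      by (intro exI[of _ "lift_op S"] conjI ballI allI impI bounded_lift[OF S(1)])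
  qed
  then show ?thesis by blast
qed

lemma ess_spectrum_N: "ess_spectrum N = ess_spectrum M"
proof -
  have "c \<notin> ess_spectrum N \<longleftrightarrow> c \<notin> ess_spectrum M" for c
  proof
    assume "c \<notin> ess_spectrum N"
    then obtain S K where S: "bounded_op N S" "compact_op N K"
        "\<And>v. v \<in> N.V \<Longrightarrow> (S v, v \<oplus>\<^bsub>N\<^esub> K v) \<in> shifted_graph N c"
      unfolding not_ess_spectrum_iff by blast
    have bK: "bounded_op N K" using S(2) by (simp add: compact_op_def)
    have "(compress_op S v, v \<oplus> compress_op K v) \<in> shifted_graph M c" if "v \<in> V" for v
      using compress_shifted[OF S(1) S(3)[of "j (v, \<zero>)"]] that N.bounded_opD(1)[OF bK]
      by (simp add: compress_op_def coord1_linear)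
    then show "c \<notin> ess_spectrum M"
      unfolding not_ess_spectrum_iff
      by (intro exI[of _ "compress_op S"] exI[of _ "compress_op K"] conjI ballI
        bounded_compress[OF S(1)] compact_compress[OF S(2)])
  next
    assume "c \<notin> ess_spectrum M"
    then obtain S K where S: "bounded_op M S" "compact_op M K"
        "\<And>v. v \<in> V \<Longrightarrow> (S v, v \<oplus> K v) \<in> shifted_graph M c"
      unfolding not_ess_spectrum_iff by blast
    have bK: "bounded_op M K" using S(2) by (simp add: compact_op_def)
    note in_V = bounded_opD(1)[OF S(1)] bounded_opD(1)[OF bK]
    have "(lift_op S p, p \<oplus>\<^bsub>N\<^esub> lift_op K p) \<in> shifted_graph N c" if pN: "p \<in> N.V" for p
    proof -
      obtain x l where xl: "x \<in> V" "l \<in> L" "p = j (x, l)" using pN by (rule N_E)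
      have "(P (S l), P (l \<oplus> K l)) \<in> shifted_graph M c"
        using xl L_in by (intro P_shifted S(3)) auto
      then show ?thesis
        using xl S(3) in_V by (simp add: shifted_N_iff P_L L_in P_add add_N L_add)
    qed
    then show "c \<notin> ess_spectrum N"
      unfolding not_ess_spectrum_iff
      by (intro exI[of _ "lift_op S"] exI[of _ "lift_op K"] conjI ballI
        bounded_lift[OF S(1)] compact_lift[OF S(2)])
  qed
  then show ?thesis by blast
qed

lemma eigenspace_N:
  assumes "eigenspace M c \<inter> L = {\<zero>}"
  shows "eigenspace N c = (\<lambda>x. j (x, \<zero>)) ` eigenspace M c"
proof (intro equalityI subsetI)
  fix p assume p: "p \<in> eigenspace N c"
  then have "p \<in> N.V" by (simp add: eigenspace_def)
  then obtain x l where xl: "x \<in> V" "l \<in> L" "p = j (x, l)" by (rule N_E)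
  have "(x, c \<odot> x) \<in> graph M" "(l, c \<odot> l) \<in> graph M"
    using p xl by (auto simp: eigenspace_def N_simps graph_N_iff)
  moreover from this have "l = \<zero>"
    using assms xl L_in by (auto simp: eigenspace_def)
  ultimately show "p \<in> (\<lambda>x. j (x, \<zero>)) ` eigenspace M c"
    using xl by (auto simp: eigenspace_def)
next
  fix p assume "p \<in> (\<lambda>x. j (x, \<zero>)) ` eigenspace M c"
  moreover have "c \<odot> \<zero> = \<zero>" by (rule ip_eqI) (auto simp: ip_simps)
  ultimately show "p \<in> eigenspace N c"
    by (auto simp: eigenspace_def N_simps graph_N_iff)
qed

lemma same_dim_N:
  assumes "eigenspace M c \<inter> L = {\<zero>}" "same_dim M (eigenspace M c) M0 E"
  shows "same_dim N (eigenspace N c) M0 E"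
proof -
  obtain B1 B2 where B: "orthonormal_basis M (eigenspace M c) B1" "orthonormal_basis M0 E B2" "|B1| =o |B2|"
    using assms(2) by (auto simp: same_dim_def)
  have sub: "B1 \<subseteq> V"
    using B(1) by (auto simp: orthonormal_basis_def eigenspace_def)
  have inj: "inj_on (\<lambda>x. j (x, \<zero>)) V"
    by (auto simp: inj_on_def j_eq)
  have "orthonormal_basis N (eigenspace N c) ((\<lambda>x. j (x, \<zero>)) ` B1)"
    unfolding orthonormal_basis_def eigenspace_N[OF assms(1)]
  proof (intro conjI ballI impI)
    show "(\<lambda>x. j (x, \<zero>)) ` B1 \<subseteq> (\<lambda>x. j (x, \<zero>)) ` eigenspace M c"
      using B(1) by (auto simp: orthonormal_basis_def)
    fix p q assume "p \<in> (\<lambda>x. j (x, \<zero>)) ` B1" "q \<in> (\<lambda>x. j (x, \<zero>)) ` B1"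
    then show "cinner N p q = (if p = q then 1 else 0)"
      using B(1) sub by (auto simp: orthonormal_basis_def cinner_N j_eq subset_iff)
  next
    fix p assume "p \<in> (\<lambda>x. j (x, \<zero>)) ` eigenspace M c"
      and orth: "\<forall>q\<in>(\<lambda>x. j (x, \<zero>)) ` B1. cinner N p q = 0"
    then obtain x where x: "x \<in> eigenspace M c" "p = j (x, \<zero>)" by blast
    have "ip x y = 0" if "y \<in> B1" for y
      using orth that x sub by (auto simp: cinner_N eigenspace_def subset_iff)
    then have "x = \<zero>"
      using B(1) x(1) by (auto simp: orthonormal_basis_def)
    then show "p = \<zero>\<^bsub>N\<^esub>"
      using x by (simp add: zero_N)
  qed
  moreover have "|(\<lambda>x. j (x, \<zero>)) ` B1| =o |B2|"
    using card_of_ordIsoI[OF bij_betw_imageI[OF inj_on_subset[OF inj sub] refl]] B(3)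
    by (rule ordIso_transitive[OF ordIso_symmetric])
  ultimately show ?thesis
    using B(2) by (auto simp: same_dim_def)
qed

text \<open>
  Only the dimensions of eigenspaces could tell the sum from \<open>M\<close>, and they count only outside the
  essential spectrum, where the new summand contributes nothing.
\<close>
lemma N_in_K_class:
  assumes "M \<sim>\<^sub>\<sigma> M0" "\<And>c. c \<in> spectrum M - ess_spectrum M \<Longrightarrow> eigenspace M c \<inter> L = {\<zero>}"
  shows "N \<in> K_class M0"
  using assms N.sa same_dim_N
  by (simp add: K_class_def spectrally_equivalent_def spectrum_N ess_spectrum_N)

end

section \<open>Embeddings and equality of Galois types\<close>

text \<open>
  A linear contraction with a contractive linear left inverse, both respecting the graphs, cannot
  change distances to the graph: points of either graph can be moved to the other one without
  increasing distances.
\<close>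
lemma K_embeddingI:
  fixes M N :: "'a hilb_op"
  assumes "sa_op M" "sa_op N"
    and f: "\<And>x. x \<in> carrier M \<Longrightarrow> f x \<in> carrier N"
      "\<And>x y. \<lbrakk>x \<in> carrier M; y \<in> carrier M\<rbrakk> \<Longrightarrow> f (x \<oplus>\<^bsub>M\<^esub> y) = f x \<oplus>\<^bsub>N\<^esub> f y"
      "\<And>c x. x \<in> carrier M \<Longrightarrow> f (c \<odot>\<^bsub>M\<^esub> x) = c \<odot>\<^bsub>N\<^esub> f x"
      "\<And>x. x \<in> carrier M \<Longrightarrow> hnorm N (f x) \<le> hnorm M x"
      "\<And>x y. (x, y) \<in> graph M \<Longrightarrow> (f x, f y) \<in> graph N"
    and f': "\<And>p. p \<in> carrier N \<Longrightarrow> f' p \<in> carrier M"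
      "\<And>p q. \<lbrakk>p \<in> carrier N; q \<in> carrier N\<rbrakk> \<Longrightarrow> f' (p \<ominus>\<^bsub>N\<^esub> q) = f' p \<ominus>\<^bsub>M\<^esub> f' q"
      "\<And>p. p \<in> carrier N \<Longrightarrow> hnorm M (f' p) \<le> hnorm N p"
      "\<And>p q. (p, q) \<in> graph N \<Longrightarrow> (f' p, f' q) \<in> graph M"
    and inv: "\<And>x. x \<in> carrier M \<Longrightarrow> f' (f x) = x"
  shows "K_embedding M N f"
proof -
  interpret M: sa_op M by fact
  interpret N: sa_op N by fact
  have f0: "f \<zero>\<^bsub>M\<^esub> = \<zero>\<^bsub>N\<^esub>"
  proof -
    have "0 \<odot>\<^bsub>M\<^esub> \<zero>\<^bsub>M\<^esub> = \<zero>\<^bsub>M\<^esub>" by (rule M.ip_eqI) (auto simp: M.ip_simps)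
    moreover have "0 \<odot>\<^bsub>N\<^esub> f \<zero>\<^bsub>M\<^esub> = \<zero>\<^bsub>N\<^esub>" by (rule N.ip_eqI) (auto simp: N.ip_simps f)
    ultimately show ?thesis using f(3)[of "\<zero>\<^bsub>M\<^esub>" 0] by simp
  qed
  have nm_f: "hnorm N (f x) = hnorm M x" if "x \<in> carrier M" for x
    using f(4)[OF that] f'(3)[OF f(1)[OF that]] inv[OF that] by simp
  have f_minus: "f (x \<ominus>\<^bsub>M\<^esub> y) = f x \<ominus>\<^bsub>N\<^esub> f y" if "x \<in> carrier M" "y \<in> carrier M" for x y
  proof -
    have "x \<ominus>\<^bsub>M\<^esub> y = x \<oplus>\<^bsub>M\<^esub> (-1) \<odot>\<^bsub>M\<^esub> y"
      using that by (intro M.ip_eqI) (auto simp: M.ip_simps)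
    then have "f (x \<ominus>\<^bsub>M\<^esub> y) = f x \<oplus>\<^bsub>N\<^esub> (-1) \<odot>\<^bsub>N\<^esub> f y"
      using that by (simp add: f)
    also have "\<dots> = f x \<ominus>\<^bsub>N\<^esub> f y"
      using that by (intro N.ip_eqI) (auto simp: N.ip_simps f)
    finally show ?thesis .
  qed
  have d_f: "hdist N (f x) (f y) = hdist M x y" if "x \<in> carrier M" "y \<in> carrier M" for x y
    using that by (simp add: N.hdist_eq M.hdist_eq f f_minus[symmetric] nm_f)
  have d_f': "hdist M (f' p) (f' q) \<le> hdist N p q" if "p \<in> carrier N" "q \<in> carrier N" for p q
    using that f'(3)[of "p \<ominus>\<^bsub>N\<^esub> q"] by (simp add: N.hdist_eq M.hdist_eq f')
  have pd_mono: "prod_dist d1 d1 p q \<le> prod_dist d2 d2 p' q'"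
    if "d1 (fst p) (fst q) \<le> d2 (fst p') (fst q')" "d1 (snd p) (snd q) \<le> d2 (snd p') (snd q')"
      "0 \<le> d1 (fst p) (fst q)" "0 \<le> d1 (snd p) (snd q)"
    for d1 d2 :: "'a \<Rightarrow> 'a \<Rightarrow> real" and p q p' q' :: "'a \<times> 'a"
    using that by (cases p; cases q; cases p'; cases q')
      (auto simp: prod_dist_def intro!: real_sqrt_le_mono add_mono power_mono)
  have bdd: "bdd_below ((\<lambda>p. prod_dist d d v p) ` A)" for d :: "'a \<Rightarrow> 'a \<Rightarrow> real" and v A
    by (rule bdd_belowI[of _ 0]) (auto simp: prod_dist_def split: prod.split)
  have "Gamma_pred N (f x) (f y) = Gamma_pred M x y" if xy: "x \<in> carrier M" "y \<in> carrier M" for x y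
  proof (rule antisym)
    show "Gamma_pred N (f x) (f y) \<le> Gamma_pred M x y"
      unfolding Gamma_pred_def
    proof (rule cINF_mono[OF _ bdd])
      show "graph M \<noteq> {}" using M.gr_zero by blast
      fix p assume p: "p \<in> graph M"
      then obtain u w where uw: "p = (u, w)" "(u, w) \<in> graph M" by (cases p) auto
      show "\<exists>q\<in>graph N. prod_dist (hdist N) (hdist N) (f x, f y) q \<le> prod_dist (hdist M) (hdist M) (x, y) p"
        using f(5)[OF uw(2)] uw xy M.gr_in[OF uw(2)]
        by (intro bexI[of _ "(f u, f w)"] pd_mono) (auto simp: d_f)
    qed
    show "Gamma_pred M x y \<le> Gamma_pred N (f x) (f y)"
      unfolding Gamma_pred_def
    proof (rule cINF_mono[OF _ bdd])
      show "graph N \<noteq> {}" using N.gr_zero by blast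
      fix p assume p: "p \<in> graph N"
      then obtain u w where uw: "p = (u, w)" "(u, w) \<in> graph N" by (cases p) auto
      show "\<exists>q\<in>graph M. prod_dist (hdist M) (hdist M) (x, y) q \<le> prod_dist (hdist N) (hdist N) (f x, f y) p"
        using f'(4)[OF uw(2)] uw xy N.gr_in[OF uw(2)] d_f'[of "f x" u] d_f'[of "f y" w]
        by (intro bexI[of _ "(f' u, f' w)"] pd_mono) (auto simp: inv f)
    qed
  qed
  then have "metric_embedding M N f"
    unfolding metric_embedding_def using f nm_f f0 by auto
  moreover have "image_structure f M N \<prec>\<^sub>\<K> N"
    using f by (auto simp: image_structure_def K_sub_def)
  ultimately show ?thesis
    by (simp add: K_embedding_def)
qed

context sa_op
begin

text \<open>
  The Cayley transform and its inverse map members of either family to multiples of members, with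
  the same indices and the same scalars for both. Then the unitary operator from one closed span to
  the other commutes with \<open>Q\<close>.
\<close>
definition compat :: "('i \<Rightarrow> 'a) \<Rightarrow> ('i \<Rightarrow> 'a) \<Rightarrow> bool" where
  "compat a b \<longleftrightarrow> same_gram a b \<and>
     (\<forall>i. \<exists>k s. cayley (a i) = s \<odot> a k \<and> cayley (b i) = s \<odot> b k) \<and>
     (\<forall>i. \<exists>k s. cayley_inv (a i) = s \<odot> a k \<and> cayley_inv (b i) = s \<odot> b k)"

lemma compat_gram: "compat a b \<Longrightarrow> same_gram a b"
  by (simp add: compat_def)

lemma compat_sym: "compat a b \<Longrightarrow> compat b a"
  unfolding compat_def by (meson same_gram_sym)

lemma compat_self:
  assumes "compat a b" shows "compat a a"
  using assms same_gram_refl[of a] same_gramD(1) unfolding compat_def by meson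

lemma Cl_cayley:
  assumes "compat a b" "z \<in> Cl b"
  shows "cayley z \<in> Cl b"
proof -
  note gD = same_gramD[OF compat_gram[OF assms(1)]]
  have z: "z \<in> V" using assms(2) by (rule ClD)
  have "ip (cayley z) y = 0" if y: "y \<in> V" "\<And>i. ip y (b i) = 0" for y
  proof -
    have "ip (cayley_inv y) (b i) = 0" for i
    proof -
      obtain k s where "cayley (b i) = s \<odot> b k"
        using assms(1) unfolding compat_def by blast
      then show ?thesis
        using y gD by (simp add: ip_cayley_inv ip_simps)
    qed
    then have "ip z (cayley_inv y) = 0"
      using ClD(2)[OF assms(2)] y(1) by blast
    then show ?thesis
      using y(1) z by (simp add: ip_cayley)
  qed
  then show ?thesis
    using z by (simp add: Cl_def)
qed

lemma Tr_cayley: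
  assumes c: "compat a b" and x: "x \<in> V"
  shows "Tr a b (cayley x) = cayley (Tr a b x)"
proof (rule Tr_eqI)
  show g: "same_gram a b" using c by (rule compat_gram)
  note gD = same_gramD[OF g]
  show "cayley (Tr a b x) \<in> Cl b"
    using Cl_cayley[OF c Tr_Cl[OF g x]] .
  show "ip (cayley (Tr a b x)) (b i) = ip (cayley x) (a i)" for i
  proof -
    obtain k s where ks: "cayley_inv (a i) = s \<odot> a k" "cayley_inv (b i) = s \<odot> b k"
      using c unfolding compat_def by blast
    show ?thesis
      using x gD Tr_in[OF g x] by (simp add: ip_cayley ks ip_simps Tr_ip[OF g x])
  qed
qed (use x in simp)

lemma Tr_graph:
  assumes c: "compat a b" and xy: "(x, y) \<in> graph M"
  shows "(Tr a b x, Tr a b y) \<in> graph M"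
proof -
  have g: "same_gram a b" using c by (rule compat_gram)
  obtain v where v: "v \<in> V" "x = v \<ominus> cayley v" "y = \<i> \<odot> (v \<oplus> cayley v)"
    using gr_cayleyE[OF xy] by blast
  have "Tr a b x = Tr a b v \<ominus> cayley (Tr a b v)" "Tr a b y = \<i> \<odot> (Tr a b v \<oplus> cayley (Tr a b v))"
    using v(1) g by (auto simp: v(2,3) Tr_minus Tr_smult Tr_add Tr_cayley[OF c])
  then show ?thesis
    using gr_cayleyI[OF Tr_in[OF g v(1)]] by simp
qed

lemma reducing_projection_Tr:
  assumes "compat a b"
  shows "reducing_projection M (Tr a a)"
proof -
  have c: "compat a a" using assms by (rule compat_self)
  have g: "same_gram a a" using c by (rule compat_gram)
  show ?thesis
    by unfold_locales
      (auto simp: Tr_in[OF g] Tr_self_id Tr_Cl[OF g] same_gramD[OF g] proj_self_adjoint Tr_graph[OF c])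
qed

lemma L_Tr:
  assumes "compat a b"
  shows "reducing_projection.L M (Tr a a) = Cl a"
proof -
  interpret R: reducing_projection M "Tr a a"
    using assms by (rule reducing_projection_Tr)
  have g: "same_gram a a" using compat_self[OF assms] by (rule compat_gram)
  show ?thesis
    unfolding R.L_def using Tr_Cl[OF g] Tr_self_id[of a] same_gramD(1)[OF g] ClD(1) by force
qed

text \<open>
  The component in the closed span of \<open>b\<close> is replaced by its copy in the new summand, the closed
  span of \<open>a\<close>; the rest stays in place.
\<close>
definition embed_sum :: "('a \<times> 'a \<Rightarrow> 'a) \<Rightarrow> ('i \<Rightarrow> 'a) \<Rightarrow> ('i \<Rightarrow> 'a) \<Rightarrow> 'a \<Rightarrow> 'a" where
  "embed_sum j a b x = j (x \<ominus> Tr b b x, Tr b a x)"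

lemma K_embedding_embed_sum:
  assumes c: "compat a b" and j: "inj_on j (V \<times> Cl a)"
  shows "K_embedding M (reducing_sum.N M (Tr a a) j) (embed_sum j a b)"
proof -
  interpret R: reducing_projection M "Tr a a"
    using c by (rule reducing_projection_Tr)
  have L: "R.L = Cl a" using c by (rule L_Tr)
  interpret S: reducing_sum M "Tr a a" j
    by unfold_locales (simp add: L j)
  have cb: "compat b a" "compat b b" using compat_sym[OF c] compat_self by auto
  have gab: "same_gram a b" and gba: "same_gram b a" and gb: "same_gram b b"
    using c cb by (auto intro: compat_gram)
  note gD = same_gramD[OF gab]
  have CL: "l \<in> Cl a \<Longrightarrow> l \<in> V" for l by (rule ClD)
  let ?f = "embed_sum j a b"
  define f' where "f' p = (S.coord1 p \<ominus> Tr b b (S.coord1 p)) \<oplus> Tr a b (S.coord2 p)" for p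
  have f'_j: "f' (j (x, l)) = (x \<ominus> Tr b b x) \<oplus> Tr a b l" if "x \<in> V" "l \<in> Cl a" for x l
    using that by (simp add: f'_def L)
  note TV = Tr_in[OF gab] Tr_in[OF gba] Tr_in[OF gb]
  note TCl = Tr_Cl[OF gba, unfolded L[symmetric]]
  have orth: "ip (x \<ominus> Tr b b x) y = 0" if "x \<in> V" "y \<in> Cl b" for x y
    using that gD by (intro ip_minus_proj) auto
  have fV: "?f x \<in> S.N.V" if "x \<in> V" for x
    using that by (simp add: embed_sum_def TV TCl)
  show ?thesis
  proof (rule K_embeddingI[where f' = f'])
    show "sa_op M" "sa_op S.N" by unfold_locales
    show "?f x \<in> S.N.V" if "x \<in> V" for x by (rule fV[OF that])
    show "?f (x \<oplus> y) = ?f x \<oplus>\<^bsub>S.N\<^esub> ?f y" if "x \<in> V" "y \<in> V" for x y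
    proof -
      have "x \<oplus> y \<ominus> Tr b b (x \<oplus> y) = (x \<ominus> Tr b b x) \<oplus> (y \<ominus> Tr b b y)"
        using that by (intro ip_eqI) (auto simp: ip_simps Tr_add[OF gb] TV)
      then show ?thesis
        using that by (simp add: embed_sum_def S.N_simps TV TCl Tr_add[OF gba])
    qed
    show "?f (t \<odot> x) = t \<odot>\<^bsub>S.N\<^esub> ?f x" if "x \<in> V" for t x
    proof -
      have "t \<odot> x \<ominus> Tr b b (t \<odot> x) = t \<odot> (x \<ominus> Tr b b x)"
        using that by (intro ip_eqI) (auto simp: ip_simps Tr_smult[OF gb] TV algebra_simps)
      then show ?thesis
        using that by (simp add: embed_sum_def S.N_simps TV TCl Tr_smult[OF gba])
    qed
    show "S.N.nm (?f x) \<le> nm x" if x: "x \<in> V" for x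
    proof -
      have "Tr b a x = Tr b a (Tr b b x)"
        using Tr_Tr[OF gb gba x] by simp
      then have le: "nm (Tr b a x) \<le> nm (Tr b b x)"
        using Tr_nm_le[OF gba, of "Tr b b x"] TV x by simp
      have "(nm x)\<^sup>2 = (nm (x \<ominus> Tr b b x))\<^sup>2 + (nm (Tr b b x))\<^sup>2"
        using gD x by (intro nm_proj_split) auto
      moreover have "(nm (Tr b a x))\<^sup>2 \<le> (nm (Tr b b x))\<^sup>2"
        using le x TV by (intro power_mono) auto
      moreover have "(S.N.nm (?f x))\<^sup>2 = (nm (x \<ominus> Tr b b x))\<^sup>2 + (nm (Tr b a x))\<^sup>2"
        using x TV TCl by (simp add: embed_sum_def S.hnorm_N_sq)
      ultimately have "(S.N.nm (?f x))\<^sup>2 \<le> (nm x)\<^sup>2" by simp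
      then show ?thesis
        by (rule power2_le_imp_le) (use x in simp)
    qed
    show "(?f x, ?f y) \<in> graph S.N" if xy: "(x, y) \<in> graph M" for x y
      using gr_in[OF xy] gr_minus[OF xy Tr_graph[OF cb(2) xy]] Tr_graph[OF cb(1) xy]
      by (simp add: embed_sum_def S.graph_N_iff TV TCl)
    show "f' p \<in> V" if "p \<in> S.N.V" for p
      using that CL by (auto elim!: S.N_E simp: f'_j TV L)
    show "f' (p \<ominus>\<^bsub>S.N\<^esub> q) = f' p \<ominus> f' q" if pq: "p \<in> S.N.V" "q \<in> S.N.V" for p q
    proof -
      obtain x l where p: "x \<in> V" "l \<in> Cl a" "p = j (x, l)" using pq(1) L by (auto elim!: S.N_E)
      obtain y m where q: "y \<in> V" "m \<in> Cl a" "q = j (y, m)" using pq(2) L by (auto elim!: S.N_E)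
      show ?thesis
        using p q CL
        by (simp add: S.minus_N L f'_j Cl_minus)
          (intro ip_eqI; simp add: TV Tr_minus[OF gb] Tr_minus[OF gab] ip_simps)
    qed
    show "nm (f' p) \<le> S.N.nm p" if pN: "p \<in> S.N.V" for p
    proof -
      obtain x l where p: "x \<in> V" "l \<in> Cl a" "p = j (x, l)" using pN L by (auto elim!: S.N_E)
      have l: "l \<in> V" using p CL by blast
      have "(nm (x \<ominus> Tr b b x))\<^sup>2 \<le> (nm x)\<^sup>2"
        using nm_proj_split[of b x] gD p by simp
      moreover have "(nm (f' p))\<^sup>2 = (nm (x \<ominus> Tr b b x))\<^sup>2 + (nm (Tr a b l))\<^sup>2"
        using p l TV orth[OF p(1) Tr_Cl[OF gab l]] by (simp add: f'_j nm_pythagoras)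
      moreover have "(nm (Tr a b l))\<^sup>2 \<le> (nm l)\<^sup>2"
        using Tr_nm_le[OF gab l] l TV by (intro power_mono) auto
      moreover have "(S.N.nm p)\<^sup>2 = (nm x)\<^sup>2 + (nm l)\<^sup>2"
        using p L by (simp add: S.hnorm_N_sq)
      ultimately have "(nm (f' p))\<^sup>2 \<le> (S.N.nm p)\<^sup>2" by simp
      then show ?thesis
        by (rule power2_le_imp_le) (use pN in simp)
    qed
    show "(f' p, f' q) \<in> graph M" if pq: "(p, q) \<in> graph S.N" for p q
    proof -
      obtain x l y m where p: "(p, q) = (j (x, l), j (y, m))" "(x, y) \<in> graph M" "(l, m) \<in> graph M"
          "l \<in> Cl a" "m \<in> Cl a" "x \<in> V" "y \<in> V"
        using pq L by (auto elim!: S.graph_N_E)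
      have "((x \<ominus> Tr b b x) \<oplus> Tr a b l, (y \<ominus> Tr b b y) \<oplus> Tr a b m) \<in> graph M"
        using p by (intro gr_add gr_minus Tr_graph c cb)
      then show ?thesis using p by (simp add: f'_j)
    qed
    show "f' (?f x) = x" if x: "x \<in> V" for x
    proof -
      have 1: "Tr b b (x \<ominus> Tr b b x) = \<zero>"
        using x TV gD Tr_ip[OF gb x] by (intro proj_orth_eq_0) (auto simp: ip_simps)
      have 2: "Tr a b (Tr b a x) = Tr b b x"
        using Tr_Tr[OF gba gab x] .
      show ?thesis
        using x TV Tr_Cl[OF gba x]
        by (simp add: embed_sum_def f'_j 1 2) (intro ip_eqI; simp add: TV ip_simps)
    qed
  qed
qed

end

text \<open>
  Equality of types over \<open>G\<close> requires embeddings that fix the elements of \<open>G\<close> themselves, so the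
  names of the elements of an amalgam are not arbitrary. Outside a small set \<open>G\<close> there is room for
  all the other elements.
\<close>
lemma exists_coding:
  fixes A G L :: "'a set"
  assumes A: "infinite A" and G: "G \<subseteq> A" "|G| <o |A|" and L: "L \<subseteq> A"
  obtains j :: "'a \<times> 'a \<Rightarrow> 'a" where "inj_on j (A \<times> L)" "\<And>x. x \<in> G \<Longrightarrow> j (x, z) = x"
proof -
  have "|A| \<le>o |A - G|"
  proof (rule ccontr)
    assume "\<not> |A| \<le>o |A - G|"
    then have lt: "|A - G| <o |A|"
      using card_of_Well_order not_ordLeq_iff_ordLess by blast
    have "|(A - G) \<union> G| <o |A|"
      using card_of_Un_ordLess_infinite[OF A lt G(2)] .
    moreover have "(A - G) \<union> G = A" using G(1) by blast
    ultimately show False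
      using ordLess_irreflexive[of "|A|"] by simp
  qed
  moreover have "|A \<times> L| \<le>o |A|"
    using card_of_Times_ordLeq_infinite_Field[of "|A|" A L, OF _ ordLeq_refl[OF card_of_Card_order]
        card_of_mono1[OF L] card_of_Card_order] A
    by (simp add: Field_card_of)
  ultimately have "|A \<times> L| \<le>o |A - G|"
    using ordLeq_transitive by blast
  then obtain h where h: "inj_on h (A \<times> L)" "h ` (A \<times> L) \<subseteq> A - G"
    by (auto simp: card_of_ordLeq[symmetric])
  define j where "j p = (if snd p = z \<and> fst p \<in> G then fst p else h p)" for p
  have "inj_on j (A \<times> L)"
  proof (rule inj_onI)
    fix p q assume *: "p \<in> A \<times> L" "q \<in> A \<times> L" "j p = j q"
    have "h p \<notin> G" "h q \<notin> G" using h(2) *(1,2) by auto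
    then show "p = q"
      using * h(1) by (auto simp: j_def prod_eq_iff inj_on_def split: if_splits)
  qed
  then show ?thesis
    using that[of j] by (simp add: j_def)
qed

context sa_op
begin

text \<open>
  The two vectors are identified in the sum of \<open>M\<close> with a copy of the closed span of \<open>a\<close>: the
  embeddings move the component in the closed span of \<open>a\<close>, respectively \<open>b\<close>, to the new summand
  and fix what is orthogonal to it.
\<close>
lemma gatp_eqI:
  assumes K: "M \<in> K_class M0" and c: "compat a b"
    and G: "G \<subseteq> V" "|G| <o |V|" and inf: "infinite V"
    and orthG: "\<And>g i. g \<in> G \<Longrightarrow> ip g (a i) = 0" "\<And>g i. g \<in> G \<Longrightarrow> ip g (b i) = 0"
    and eig: "\<And>t. t \<in> spectrum M - ess_spectrum M \<Longrightarrow> eigenspace M t \<inter> Cl a = {\<zero>}"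
    and h: "h \<in> V" "\<And>i. ip h (a i) = 0" "\<And>i. ip h (b i) = 0"
    and v: "v \<in> Cl a" and u: "u \<in> Cl b" and uv: "\<And>i. ip v (a i) = ip u (b i)"
  shows "gatp_eq M0 (UNIV :: unit set) M (\<lambda>_. h \<oplus> v) M (\<lambda>_. h \<oplus> u) G"
proof -
  have gab: "same_gram a b" and gba: "same_gram b a" and ga: "same_gram a a" and gb: "same_gram b b"
    using c compat_sym[OF c] compat_self by (auto intro: compat_gram)
  note gD = same_gramD[OF gab]
  have V: "v \<in> V" "u \<in> V" using ClD(1) u v by auto
  have L_sub: "Cl a \<subseteq> V" using ClD(1) by blast
  obtain j where j: "inj_on j (V \<times> Cl a)" "\<And>x. x \<in> G \<Longrightarrow> j (x, \<zero>) = x"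
    using exists_coding[OF inf G L_sub] by blast
  interpret R: reducing_projection M "Tr a a"
    using c by (rule reducing_projection_Tr)
  have L: "R.L = Cl a" using c by (rule L_Tr)
  interpret S: reducing_sum M "Tr a a" j
    by unfold_locales (simp add: L j)
  have N: "S.N \<in> K_class M0"
    using K eig by (intro S.N_in_K_class) (auto simp: K_class_def L)
  have 0: "Tr b' b' x = \<zero>" "Tr b' a x = \<zero>"
    if "x \<in> V" "\<And>i. ip x (b' i) = 0" "same_gram b' a" for x and b' :: "'b \<Rightarrow> 'a"
    using that same_gramD[OF that(3)] by (auto intro!: Tr_eqI same_gram_refl)
  have sub0: "x \<ominus> \<zero> = x" if "x \<in> V" for x
    using that by (intro ip_eqI) (auto simp: ip_simps)
  have fix_G: "embed_sum j a b' x = x"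
    if "x \<in> G" "\<And>i. ip x (b' i) = 0" "same_gram b' a" for x and b' :: "'b \<Rightarrow> 'a"
    using that G j(2) by (auto simp: embed_sum_def 0 sub0 subset_iff)
  have add_minus: "h \<oplus> w \<ominus> w = h" if "w \<in> V" for w
    using that h by (intro ip_eqI) (auto simp: ip_simps)
  have zero_add: "\<zero> \<oplus> w = w" if "w \<in> V" for w using that by simp
  have fv: "embed_sum j a a (h \<oplus> v) = j (h, v)"
    using h V v gD
    by (simp add: embed_sum_def Tr_add[OF ga] 0[OF h(1,2) ga] Tr_self_id add_minus)
  have Tu: "Tr b a u = v" using V v uv by (intro Tr_eqI gba) auto
  have gu: "embed_sum j a b (h \<oplus> u) = j (h, v)"
    using h V u gD
    by (simp add: embed_sum_def Tr_add[OF gb] Tr_add[OF gba] 0[OF h(1,3) gba] Tr_self_id add_minus Tu)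
  show ?thesis
    unfolding gatp_eq_def
  proof (intro conjI K bexI[OF _ N] exI)
    show "K_embedding M S.N (embed_sum j a a)"
      by (rule K_embedding_embed_sum[OF compat_self[OF c] j(1)])
    show "K_embedding M S.N (embed_sum j a b)"
      by (rule K_embedding_embed_sum[OF c j(1)])
    show "\<forall>i\<in>UNIV. embed_sum j a a (h \<oplus> v) = embed_sum j a b (h \<oplus> u)"
      by (simp add: fv gu)
    show "\<forall>x\<in>G. embed_sum j a a x = x \<and> embed_sum j a b x = x"
      using orthG fix_G ga gba by blast
  qed (use G h V in auto)
qed

end

section \<open>Reducing parts without eigenvectors\<close>

context complex_hilbert_space
begin

definition perp :: "('i \<Rightarrow> 'a) \<Rightarrow> 'a set" where
  "perp c = {y \<in> V. \<forall>i. ip y (c i) = 0}"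

lemma perp_in: "y \<in> perp c \<Longrightarrow> y \<in> V"
  and perp_ip: "y \<in> perp c \<Longrightarrow> ip y (c i) = 0"
  by (auto simp: perp_def)

lemma perp_closed:
  assumes "\<And>i. c i \<in> V"
  shows "\<zero> \<in> perp c" "\<lbrakk>x \<in> perp c; y \<in> perp c\<rbrakk> \<Longrightarrow> x \<oplus> y \<in> perp c"
    "\<lbrakk>x \<in> perp c; y \<in> perp c\<rbrakk> \<Longrightarrow> x \<ominus> y \<in> perp c" "x \<in> perp c \<Longrightarrow> t \<odot> x \<in> perp c"
  using assms by (auto simp: perp_def ip_simps)

lemma Cl_perp:
  assumes "\<And>i. c i \<in> V" "\<And>k. a k \<in> perp c"
  shows "Cl a \<subseteq> perp c"
proof
  fix z assume z: "z \<in> Cl a"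
  have "ip (c i) (a k) = 0" for i k
    using perp_ip[OF assms(2)] perp_in[OF assms(2)] assms(1) by (subst ip_eq_0_commute) auto
  then have "ip z (c i) = 0" for i
    by (rule ClD(2)[OF z assms(1)])
  then show "z \<in> perp c" using ClD(1)[OF z] by (simp add: perp_def)
qed

end

context sa_op
begin

lemma perp_cayley:
  assumes c: "compat c c" and y: "y \<in> perp c"
  shows "cayley y \<in> perp c" "cayley_inv y \<in> perp c"
proof -
  note cV = same_gramD(1)[OF compat_gram[OF c]]
  have "ip (cayley y) (c i) = 0" for i
  proof -
    obtain k s where "cayley_inv (c i) = s \<odot> c k" using c unfolding compat_def by blast
    then show ?thesis using y cV by (simp add: ip_cayley ip_simps perp_in perp_ip)
  qed
  moreover have "ip (cayley_inv y) (c i) = 0" for i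
  proof -
    obtain k s where "cayley (c i) = s \<odot> c k" using c unfolding compat_def by blast
    then show ?thesis using y cV by (simp add: ip_cayley_inv ip_simps perp_in perp_ip)
  qed
  ultimately show "cayley y \<in> perp c" "cayley_inv y \<in> perp c"
    using y by (auto simp: perp_def)
qed

end

text \<open>
  The reducing subspace is given as the orthogonal complement of a family on which the Cayley
  transform acts, so that it is closed and invariant by construction.
\<close>
locale eigenvector_free = sa_op M for M :: "'a hilb_op" (structure) +
  fixes c :: "'i \<Rightarrow> 'a"
  assumes compat_c: "compat c c"
    and no_eigenvector: "\<And>y t. \<lbrakk>y \<in> perp c; cayley y = t \<odot> y\<rbrakk> \<Longrightarrow> y = \<zero>"
    and nontrivial: "perp c \<noteq> {\<zero>}"
begin

lemma c_in: "c i \<in> V"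
  using same_gramD(1)[OF compat_gram[OF compat_c]] .

lemmas perp_c = perp_closed[of c, OF c_in]

definition restr :: "('a \<times> 'a) set" where
  "restr = {(x, y) \<in> graph M. x \<in> perp c \<and> y \<in> perp c}"

lemma restrD:
  assumes "(x, y) \<in> restr"
  shows "(x, y) \<in> graph M" "x \<in> perp c" "y \<in> perp c" "x \<in> V" "y \<in> V"
  using assms perp_in by (auto simp: restr_def)

lemma restr_lin:
  assumes "(u, w) \<in> restr" "(x, y) \<in> restr"
  shows "(t \<odot> u \<oplus> x, t \<odot> w \<oplus> y) \<in> restr"
  using restrD[OF assms(1)] restrD[OF assms(2)] by (auto simp: restr_def perp_c gr_add gr_smult)

lemma restr_zero: "(\<zero>, \<zero>) \<in> restr"
  by (simp add: restr_def perp_c)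

lemma restr_smult: "(x, y) \<in> restr \<Longrightarrow> (t \<odot> x, t \<odot> y) \<in> restr"
  by (auto simp: restr_def perp_c gr_smult)

lemma restr_cayleyI: "p \<in> perp c \<Longrightarrow> (p \<ominus> cayley p, \<i> \<odot> (p \<oplus> cayley p)) \<in> restr"
  using perp_cayley[OF compat_c] by (auto simp: restr_def perp_c gr_cayleyI perp_in)

text \<open>A vector orthogonal to the range of \<open>Q - m\<close> would be an eigenvector.\<close>
lemma restr_range_dense:
  fixes m :: real
  assumes z: "z \<in> perp c" and e: "e > 0"
  obtains x y where "(x, y) \<in> restr" "nm (z \<ominus> (y \<ominus> of_real m \<odot> x)) < e"
proof -
  define s where "s = - complex_of_real m"
  define a where "a p = (if p \<in> restr then snd p \<oplus> s \<odot> fst p else \<zero>)" for p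
  have a_perp: "a p \<in> perp c" for p
    using restrD[of "fst p" "snd p"] by (auto simp: a_def perp_c)
  have aV: "a p \<in> V" for p using a_perp perp_in by blast
  have g: "same_gram a a" using aV by (rule same_gram_refl)
  have zV: "z \<in> V" using z by (rule perp_in)
  have TV: "Tr a a z \<in> V" using g zV by (rule Tr_in)
  define w where "w = z \<ominus> Tr a a z"
  have Tp: "Tr a a z \<in> perp c"
    using Tr_Cl[OF g zV] Cl_perp[of c a] c_in a_perp by blast
  have wp: "w \<in> perp c" using z Tp by (simp add: w_def perp_c)
  have wV: "w \<in> V" using wp by (rule perp_in)
  have w_orth: "ip w (a p) = 0" for p
    using zV TV aV Tr_ip[OF g zV] by (simp add: w_def ip_simps)
  define k1 where "k1 = - \<i> - of_real m"
  define k2 where "k2 = of_real m - \<i>"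
  have k: "k1 \<noteq> 0" "k2 \<noteq> 0" by (auto simp: k1_def k2_def complex_eq_iff)
  define q where "q = k1 \<odot> w \<oplus> k2 \<odot> cayley_inv w"
  have qp: "q \<in> perp c"
    using wp perp_cayley[OF compat_c wp] by (simp add: q_def perp_c)
  have qV: "q \<in> V" using qp by (rule perp_in)
  have "ip q p = 0" if p: "p \<in> perp c" for p
  proof -
    have pV: "p \<in> V" using p by (rule perp_in)
    have "ip w (a (p \<ominus> cayley p, \<i> \<odot> (p \<oplus> cayley p))) = 0"
      by (rule w_orth)
    then show ?thesis
      using restr_cayleyI[OF p] pV wV
      by (simp add: a_def q_def s_def k1_def k2_def ip_simps ip_cayley_inv algebra_simps)
  qed
  then have "q = \<zero>"
    using cinner_eq_0[OF qV] qp by blast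
  have 0: "k1 * ip w v + k2 * ip (cayley_inv w) v = 0" if "v \<in> V" for v
  proof -
    have "ip (k1 \<odot> w \<oplus> k2 \<odot> cayley_inv w) v = ip \<zero> v"
      using \<open>q = \<zero>\<close> by (simp only: q_def)
    then show ?thesis using that wV by (simp add: ip_simps)
  qed
  have "cayley_inv w = (- k1 / k2) \<odot> w"
  proof (rule ip_eqI)
    fix v assume v: "v \<in> V"
    show "ip (cayley_inv w) v = ip ((- k1 / k2) \<odot> w) v"
      using 0[OF v] k v wV by (simp add: ip_simps field_simps eq_neg_iff_add_eq_0)
  qed (use wV in auto)
  then have "w = (- k1 / k2) \<odot> cayley w"
    using wV cayley_cayley_inv[OF wV] by (simp add: cayley_smult)
  then have "ip w v = (- k1 / k2) * ip (cayley w) v" if "v \<in> V" for v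
    using that wV by (metis cinner_smult cayley_in)
  then have "cayley w = (- k2 / k1) \<odot> w"
    using k wV by (intro ip_eqI) (auto simp: ip_simps)
  then have "w = \<zero>" by (rule no_eigenvector[OF wp])
  then have Tz: "Tr a a z = z"
    using minus_eq_zeroD[OF zV TV] by (simp add: w_def)
  obtain xs where xs: "nm (z \<ominus> lc a xs) < e"
    using Tr_approx[OF g zV e] unfolding Tz by blast
  have a_eq: "a = (\<lambda>p. if p \<in> restr then snd p \<oplus> s \<odot> fst p else \<zero>)"
    by (simp add: a_def fun_eq_iff)
  obtain x y where xy: "(x, y) \<in> restr" "lc a xs = y \<oplus> s \<odot> x"
    unfolding a_eq
  proof (rule lc_pairs[where g = restr and s = s and xs = xs])
    show "(x, y) \<in> restr \<Longrightarrow> x \<in> V \<and> y \<in> V" for x y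
      using restrD by blast
  qed (auto intro: restr_zero restr_lin)
  have "y \<oplus> s \<odot> x = y \<ominus> of_real m \<odot> x"
    using restrD[OF xy(1)] by (intro ip_eqI) (auto simp: s_def ip_simps)
  then show ?thesis using that[OF xy(1)] xs xy(2) by simp
qed

text \<open>
  The approximate eigenvalues of the restricted operator, that is, its spectrum in a form that makes
  the inclusion into the spectrum of \<open>Q\<close> immediate, as resolvents are bounded.
\<close>
definition approx_eig :: "real set" where
  "approx_eig = {m. \<forall>e>0. \<exists>x y. (x, y) \<in> restr \<and> nm x = 1 \<and> nm (y \<ominus> of_real m \<odot> x) < e}"

lemma approx_eig_spectrum: "complex_of_real ` approx_eig \<subseteq> spectrum M"
proof (rule ccontr)
  assume "\<not> complex_of_real ` approx_eig \<subseteq> spectrum M"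
  then obtain m where m: "m \<in> approx_eig" "complex_of_real m \<notin> spectrum M" by blast
  then obtain S where S: "bounded_op M S"
      "\<And>x y. (x, y) \<in> shifted_graph M (of_real m) \<Longrightarrow> S y = x"
    unfolding not_spectrum_iff by blast
  obtain B where B: "B \<ge> 0" "\<And>x. x \<in> V \<Longrightarrow> nm (S x) \<le> B * nm x"
    using bounded_op_bound[OF S(1)] by blast
  obtain x y where xy: "(x, y) \<in> restr" "nm x = 1" "nm (y \<ominus> of_real m \<odot> x) < 1 / (B + 1)"
    using m(1) B(1) unfolding approx_eig_def by (auto dest: spec[of _ "1 / (B + 1)"])
  have "S (y \<ominus> of_real m \<odot> x) = x"
    using restrD(1)[OF xy(1)] by (intro S(2)) (auto simp: shifted_graph_def)
  then have "1 \<le> B * nm (y \<ominus> of_real m \<odot> x)"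
    using B(2)[of "y \<ominus> of_real m \<odot> x"] restrD[OF xy(1)] xy(2) by simp
  also have "\<dots> \<le> B * (1 / (B + 1))"
    using xy(3) B(1) by (intro mult_left_mono) auto
  also have "\<dots> < 1" using B(1) by (simp add: field_simps)
  finally show False by simp
qed

lemma restr_unit:
  assumes "(x, y) \<in> restr" "x \<noteq> \<zero>"
  defines "t \<equiv> complex_of_real (1 / nm x)"
  shows "(t \<odot> x, t \<odot> y) \<in> restr" "nm (t \<odot> x) = 1"
    "nm (t \<odot> y \<ominus> of_real m \<odot> (t \<odot> x)) = nm (y \<ominus> of_real m \<odot> x) / nm x"
proof -
  have V: "x \<in> V" "y \<in> V" using restrD[OF assms(1)] by auto
  have pos: "nm x > 0" using nm_pos assms(2) V by blast
  show "(t \<odot> x, t \<odot> y) \<in> restr" using assms(1) by (rule restr_smult)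
  show "nm (t \<odot> x) = 1" using V pos by (simp add: t_def norm_divide)
  have "t \<odot> y \<ominus> of_real m \<odot> (t \<odot> x) = t \<odot> (y \<ominus> of_real m \<odot> x)"
    using V by (intro ip_eqI) (auto simp: ip_simps algebra_simps)
  then show "nm (t \<odot> y \<ominus> of_real m \<odot> (t \<odot> x)) = nm (y \<ominus> of_real m \<odot> x) / nm x"
    using V pos by (simp add: t_def norm_divide)
qed

lemma restr_bound_scale:
  assumes "\<And>x y. (x, y) \<in> restr \<Longrightarrow> nm x = 1 \<Longrightarrow> e \<le> nm (y \<ominus> of_real m \<odot> x)" "(x, y) \<in> restr"
  shows "e * nm x \<le> nm (y \<ominus> of_real m \<odot> x)"
proof (cases "x = \<zero>")
  case True
  then show ?thesis using restrD[OF assms(2)] by simp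
next
  case False
  have V: "x \<in> V" using restrD[OF assms(2)] by auto
  have pos: "nm x > 0" using nm_pos False V by blast
  note u = restr_unit[OF assms(2) False]
  have "e \<le> nm (y \<ominus> of_real m \<odot> x) / nm x"
    using assms(1)[OF u(1,2)] unfolding u(3) .
  then show ?thesis using pos by (simp add: field_simps)
qed

lemma not_approx_eig:
  assumes "m \<notin> approx_eig"
  obtains e where "e > 0" "\<And>x y. (x, y) \<in> restr \<Longrightarrow> e * nm x \<le> nm (y \<ominus> of_real m \<odot> x)"
proof -
  obtain e where e: "e > 0"
      "\<And>x y. (x, y) \<in> restr \<Longrightarrow> nm x = 1 \<Longrightarrow> e \<le> nm (y \<ominus> of_real m \<odot> x)"
    using assms unfolding approx_eig_def by (auto simp: not_less)
  show ?thesis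
    by (rule that[OF e(1)]) (rule restr_bound_scale[OF e(2)])
qed

lemma restr_unit_ex: obtains x y where "(x, y) \<in> restr" "nm x = 1"
proof -
  obtain w where w: "w \<in> perp c" "w \<noteq> \<zero>"
    using nontrivial perp_c(1) by blast
  have wV: "w \<in> V" using w(1) by (rule perp_in)
  have "w \<ominus> cayley w \<noteq> \<zero>"
  proof
    assume "w \<ominus> cayley w = \<zero>"
    then have eq: "w = cayley w"
      by (rule minus_eq_zeroD[OF wV cayley_in[OF wV]])
    have one: "1 \<odot> w = w"
      using wV by (intro ip_eqI) (auto simp: ip_simps)
    have "cayley w = 1 \<odot> w"
      unfolding one by (rule eq[symmetric])
    then show False using no_eigenvector[OF w(1)] w(2) by blast
  qed
  then show ?thesis
    using restr_unit(1,2)[OF restr_cayleyI[OF w(1)]] that by blast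
qed

text \<open>
  With \<open>S = Q - m\<close> and \<open>r\<close> the lower bound of \<open>S\<close>, the form \<open>\<langle>Sx, Sy\<rangle> - r\<^sup>2\<langle>x, y\<rangle>\<close> is positive, and
  equals \<open>\<langle>(S - r)x, (S + r)y\<rangle>\<close>. It is almost zero at a suitable unit vector \<open>x\<close>. If \<open>S - r\<close> and
  \<open>S + r\<close> were bounded below, \<open>y\<close> could be chosen with \<open>(S + r)y\<close> close to \<open>(S - r)x\<close>, against the
  Cauchy-Schwarz inequality.
\<close>
lemma spectral_gap:
  assumes m: "m \<notin> approx_eig"
  obtains r where "r > 0" "\<And>x y. (x, y) \<in> restr \<Longrightarrow> r * nm x \<le> nm (y \<ominus> of_real m \<odot> x)"
    "m + r \<in> approx_eig \<or> m - r \<in> approx_eig"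
proof -
  define D where "D = {nm (y \<ominus> of_real m \<odot> x) | x y. (x, y) \<in> restr \<and> nm x = 1}"
  define r where "r = Inf D"
  have D_ne: "D \<noteq> {}"   proof -
    obtain x y where "(x, y) \<in> restr" "nm x = 1" by (rule restr_unit_ex)
    then show ?thesis unfolding D_def by blast
  qed
  have bdd: "bdd_below D"
    by (rule bdd_belowI[of _ 0]) (auto simp: D_def restrD)
  obtain e0 where e0: "e0 > 0" "\<And>x y. (x, y) \<in> restr \<Longrightarrow> e0 * nm x \<le> nm (y \<ominus> of_real m \<odot> x)"
    by (rule not_approx_eig[OF m]) (rule that)
  have "e0 \<le> r"
    unfolding r_def using e0(2) by (intro cInf_greatest D_ne) (fastforce simp: D_def)
  then have r: "r > 0" using e0(1) by simp
  have r_unit: "r \<le> nm (y \<ominus> of_real m \<odot> x)" if "(x, y) \<in> restr" "nm x = 1" for x y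
    unfolding r_def using that by (intro cInf_lower bdd) (auto simp: D_def)
  have r_le: "r * nm x \<le> nm (y \<ominus> of_real m \<odot> x)" if "(x, y) \<in> restr" for x y
    by (rule restr_bound_scale[OF r_unit that])
  have "m + r \<in> approx_eig \<or> m - r \<in> approx_eig"
  proof (rule ccontr)
    assume "\<not> ?thesis"
    then have ni: "m + r \<notin> approx_eig" "m - r \<notin> approx_eig" by auto
    obtain e1 where e1: "e1 > 0" "\<And>x y. (x, y) \<in> restr \<Longrightarrow> e1 * nm x \<le> nm (y \<ominus> of_real (m + r) \<odot> x)"
      by (rule not_approx_eig[OF ni(1)]) (rule that)
    obtain e2 where e2: "e2 > 0" "\<And>x y. (x, y) \<in> restr \<Longrightarrow> e2 * nm x \<le> nm (y \<ominus> of_real (m - r) \<odot> x)"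
      by (rule not_approx_eig[OF ni(2)]) (rule that)
    define K where "K = 1 + r / e2"
    have K: "K \<ge> 1" using r e2 by (simp add: K_def)
    define d where "d = e1 / (4 * K)"
    have d: "d > 0" using e1 K by (simp add: d_def)
    have "sqrt (r\<^sup>2 + d\<^sup>2) > sqrt (r\<^sup>2)"
      using d by (intro real_sqrt_less_mono) simp
    then have "Inf D < sqrt (r\<^sup>2 + d\<^sup>2)" using r unfolding r_def[symmetric] by simp
    then obtain x y where xy: "(x, y) \<in> restr" "nm x = 1" "nm (y \<ominus> of_real m \<odot> x) < sqrt (r\<^sup>2 + d\<^sup>2)"
      using cInf_lessD[OF D_ne, of "sqrt (r\<^sup>2 + d\<^sup>2)"] unfolding D_def by auto
    note xyD = restrD[OF xy(1)]
    define s where "s = y \<ominus> of_real m \<odot> x"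
    have sV: "s \<in> V" using xyD by (simp add: s_def)
    have "nm s < sqrt (r\<^sup>2 + d\<^sup>2)" using xy(3) by (simp add: s_def)
    then have "(nm s)\<^sup>2 < (sqrt (r\<^sup>2 + d\<^sup>2))\<^sup>2"
      using sV by (intro power_strict_mono) auto
    then have s_sq: "(nm s)\<^sup>2 - r\<^sup>2 \<le> d\<^sup>2" by simp
    define z where "z = y \<ominus> of_real (m + r) \<odot> x"
    have zp: "z \<in> perp c" using xyD by (simp add: z_def perp_c)
    have zV: "z \<in> V" using zp by (rule perp_in)
    have z_lb: "e1 \<le> nm z" using e1(2)[OF xy(1)] xy(2) by (simp add: z_def)
    then have z_pos: "nm z > 0" using e1(1) by linarith
    obtain x' y' where xy': "(x', y') \<in> restr" "nm (z \<ominus> (y' \<ominus> of_real (m - r) \<odot> x')) < nm z / 2"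
      using restr_range_dense[OF zp, of "nm z / 2" "m - r"] z_pos by auto
    note xyD' = restrD[OF xy'(1)]
    define q where "q = y' \<ominus> of_real (m - r) \<odot> x'"
    define s' where "s' = y' \<ominus> of_real m \<odot> x'"
    have qV: "q \<in> V" and s'V: "s' \<in> V" using xyD' by (auto simp: q_def s'_def)
    have zq: "nm (z \<ominus> q) < nm z / 2" using xy'(2) by (simp add: q_def)
    have "nm q \<le> nm z + nm (z \<ominus> q)"
      using nm_le_diff[OF qV zV] zV qV by (simp add: nm_minus_commute)
    then have q_ub: "nm q \<le> 3/2 * nm z" using zq by linarith
    have "e2 * nm x' \<le> nm q" using e2(2)[OF xy'(1)] by (simp add: q_def)
    then have "nm x' \<le> nm q / e2" using e2(1) by (simp add: field_simps)
    moreover have "nm s' \<le> nm q + r * nm x'"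
    proof -
      have "s' = q \<ominus> of_real r \<odot> x'"
        using xyD' by (intro ip_eqI) (auto simp: s'_def q_def ip_simps algebra_simps)
      then show ?thesis
        using nm_triangle_minus[of q "of_real r \<odot> x'"] qV xyD' r by simp
    qed
    ultimately have "nm s' \<le> nm q + r * (nm q / e2)"
      using r by (smt (verit) mult_left_mono)
    also have "\<dots> = nm q * K" by (simp add: K_def field_simps)
    also have "\<dots> \<le> 3/2 * nm z * K" using q_ub K by (intro mult_right_mono) auto
    finally have s'_ub: "nm s' \<le> 3/2 * nm z * K" .
    define E where "E = 3/2 * nm z * K"
    have E: "E > 0" using z_pos K by (simp add: E_def)
    have s'_sq: "(nm s')\<^sup>2 - r\<^sup>2 * (nm x')\<^sup>2 \<le> E\<^sup>2"
    proof -
      have "(nm s')\<^sup>2 \<le> E\<^sup>2" using s'_ub s'V by (intro power_mono) (auto simp: E_def)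
      then show ?thesis using zero_le_power2[of "r * nm x'"] unfolding power_mult_distrib by linarith
    qed
    have b: "ip s s' - of_real (r\<^sup>2) * ip x x' = ip z q"
      using xyD xyD' gr_sym[OF xyD'(1) xyD(1)]
      by (simp add: s_def s'_def z_def q_def ip_simps algebra_simps power2_eq_square)
    define t where "t = - (d / E)"
    have pos: "0 \<le> (nm (s \<oplus> of_real t \<odot> s'))\<^sup>2 - r\<^sup>2 * (nm (x \<oplus> of_real t \<odot> x'))\<^sup>2"
    proof -
      have in_r: "(of_real t \<odot> x' \<oplus> x, of_real t \<odot> y' \<oplus> y) \<in> restr"
        using restr_lin[OF xy'(1) xy(1)] .
      have eq: "of_real t \<odot> x' \<oplus> x = x \<oplus> of_real t \<odot> x'"
        "of_real t \<odot> y' \<oplus> y \<ominus> of_real m \<odot> (of_real t \<odot> x' \<oplus> x) = s \<oplus> of_real t \<odot> s'"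
        using xyD xyD' by (auto intro!: ip_eqI simp: s_def s'_def ip_simps algebra_simps)
      have "r * nm (x \<oplus> of_real t \<odot> x') \<le> nm (s \<oplus> of_real t \<odot> s')"
        using r_le[OF in_r] unfolding eq(2) unfolding eq(1) .
      then have "(r * nm (x \<oplus> of_real t \<odot> x'))\<^sup>2 \<le> (nm (s \<oplus> of_real t \<odot> s'))\<^sup>2"
        using r xyD xyD' by (intro power_mono) auto
      then show ?thesis by (simp add: power_mult_distrib)
    qed
    have A: "(nm (s \<oplus> of_real t \<odot> s'))\<^sup>2 = (nm s)\<^sup>2 + 2 * t * Re (ip s s') + t\<^sup>2 * (nm s')\<^sup>2"
      using sV s'V by (simp add: nm_add_sq ip_simps power_mult_distrib)
    have B: "(nm (x \<oplus> of_real t \<odot> x'))\<^sup>2 = 1 + 2 * t * Re (ip x x') + t\<^sup>2 * (nm x')\<^sup>2"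
      using xyD xyD' xy(2) by (simp add: nm_add_sq ip_simps power_mult_distrib)
    have R: "Re (ip z q) = Re (ip s s') - r\<^sup>2 * Re (ip x x')"
      using arg_cong[OF b, of Re] by simp
    have "(nm (s \<oplus> of_real t \<odot> s'))\<^sup>2 - r\<^sup>2 * (nm (x \<oplus> of_real t \<odot> x'))\<^sup>2
        = ((nm s)\<^sup>2 - r\<^sup>2) + 2 * t * Re (ip z q) + t\<^sup>2 * ((nm s')\<^sup>2 - r\<^sup>2 * (nm x')\<^sup>2)"
      unfolding A B R by (simp add: algebra_simps)
    then have "0 \<le> ((nm s)\<^sup>2 - r\<^sup>2) + 2 * t * Re (ip z q) + t\<^sup>2 * ((nm s')\<^sup>2 - r\<^sup>2 * (nm x')\<^sup>2)"
      using pos by simp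
    also have "\<dots> \<le> d\<^sup>2 + 2 * t * Re (ip z q) + t\<^sup>2 * E\<^sup>2"
      using s_sq mult_left_mono[OF s'_sq zero_le_power2[of t]] by linarith
    also have "t\<^sup>2 * E\<^sup>2 = d\<^sup>2" using E by (simp add: t_def power_divide)
    finally have "d / E * Re (ip z q) \<le> d * d" by (simp add: t_def power2_eq_square)
    then have ub: "Re (ip z q) \<le> d * E" using d E by (simp add: field_simps)
    have "Re (ip z q) = (nm z)\<^sup>2 - Re (ip z (z \<ominus> q))"
      using zV qV by (simp add: nm_sq ip_simps)
    moreover have "Re (ip z (z \<ominus> q)) \<le> nm z * nm (z \<ominus> q)"
      using ip_cs[of z "z \<ominus> q"] complex_Re_le_cmod[of "ip z (z \<ominus> q)"] zV qV by simp
    moreover have "nm z * nm (z \<ominus> q) \<le> nm z * (nm z / 2)"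
      using zq z_pos by (intro mult_left_mono) auto
    ultimately have "(nm z)\<^sup>2 / 2 \<le> d * E"
      using ub by (simp add: power2_eq_square)
    also have "d * E = 3/8 * e1 * nm z" using K by (simp add: d_def E_def field_simps)
    also have "\<dots> \<le> 3/8 * nm z * nm z" using z_lb z_pos by simp
    finally show False using z_pos by (simp add: power2_eq_square)
  qed
  note points = this
  show ?thesis by (rule that[OF r r_le points])
qed

lemma approx_eig_nonempty: "approx_eig \<noteq> {}"
proof (cases "0 \<in> approx_eig")
  case False
  then show ?thesis by (rule spectral_gap) auto
qed auto

lemma restr_shift_triangle:
  assumes "(x, y) \<in> restr" "nm x = 1"
  shows "nm (y \<ominus> of_real m \<odot> x) \<le> nm (y \<ominus> of_real m' \<odot> x) + \<bar>m' - m\<bar>"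
proof -
  note D = restrD[OF assms(1)]
  have "y \<ominus> of_real m \<odot> x = (y \<ominus> of_real m' \<odot> x) \<oplus> of_real (m' - m) \<odot> x"
    using D by (intro ip_eqI) (auto simp: ip_simps algebra_simps)
  then have "nm (y \<ominus> of_real m \<odot> x) \<le> nm (y \<ominus> of_real m' \<odot> x) + nm (of_real (m' - m) \<odot> x)"
    using nm_triangle[of "y \<ominus> of_real m' \<odot> x" "of_real (m' - m) \<odot> x"] D by simp
  moreover have "nm (of_real (m' - m) \<odot> x) = \<bar>m' - m\<bar>"
    using D assms(2) nm_smult[of x "of_real (m' - m)"] by (simp only: norm_of_real mult_1_right)
  ultimately show ?thesis by simp
qed

lemma approx_eig_closed: "closed approx_eig"
proof -
  have "\<exists>T. open T \<and> m \<in> T \<and> T \<subseteq> - approx_eig" if m: "m \<in> - approx_eig" for m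
  proof -
    obtain e where e: "e > 0" "\<And>x y. (x, y) \<in> restr \<Longrightarrow> e * nm x \<le> nm (y \<ominus> of_real m \<odot> x)"
      by (rule not_approx_eig[of m]) (use m that in auto)
    have "m' \<notin> approx_eig" if "m' \<in> ball m (e/2)" for m'
    proof
      assume "m' \<in> approx_eig"
      then obtain x y where xy: "(x, y) \<in> restr" "nm x = 1" "nm (y \<ominus> of_real m' \<odot> x) < e / 2"
        using e(1) unfolding approx_eig_def by (auto dest: spec[of _ "e/2"])
      then show False
        using e(2)[OF xy(1)] restr_shift_triangle[OF xy(1,2), of m m'] that
        by (simp add: dist_real_def abs_minus_commute)
    qed
    then show ?thesis
      using e(1) by (intro exI[of _ "ball m (e/2)"]) auto
  qed
  then show ?thesis
    unfolding closed_def by (subst open_subopen) blast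
qed

text \<open>
  If \<open>m\<close> were isolated, then \<open>\<bar>\<langle>Sx, x\<rangle>\<bar> \<le> \<parallel>Sx\<parallel>\<^sup>2 / d\<close> for \<open>S = Q - m\<close> by the gaps on both sides,
  hence \<open>4 Re \<langle>Sx, y\<rangle> \<le> (2 \<parallel>Sx\<parallel>\<^sup>2 + 2 \<parallel>Sy\<parallel>\<^sup>2) / d\<close> by polarization. Since the range of \<open>S\<close> is dense,
  \<open>Sx\<close> can approximate \<open>d y\<close>, and \<open>S\<close> is bounded below.
\<close>
lemma approx_eig_not_isolated:
  assumes m: "m \<in> approx_eig" and d: "d > 0"
  shows "\<exists>m'\<in>approx_eig. m' \<noteq> m \<and> \<bar>m' - m\<bar> < d"
proof (rule ccontr)
  assume "\<not> ?thesis"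
  then have iso: "\<And>m'. m' \<in> approx_eig \<Longrightarrow> \<bar>m' - m\<bar> < d \<Longrightarrow> m' = m" by blast
  have gap: "(d/2) * nm x \<le> nm (y \<ominus> of_real (m + k) \<odot> x)"
    if k: "\<bar>k\<bar> = d / 2" and xy: "(x, y) \<in> restr" for k x y
  proof -
    have "m + k \<notin> approx_eig" using iso[of "m + k"] k d by auto
    then obtain r where r: "r > 0" "\<And>x y. (x, y) \<in> restr \<Longrightarrow> r * nm x \<le> nm (y \<ominus> of_real (m + k) \<odot> x)"
      "m + k + r \<in> approx_eig \<or> m + k - r \<in> approx_eig"
      by (rule spectral_gap) (rule that)
    have "d / 2 \<le> r"
    proof (rule ccontr)
      assume "\<not> d / 2 \<le> r"
      then show False
        using iso[of "m + k + r"] iso[of "m + k - r"] r(1,3) k by (auto simp: abs_if split: if_splits)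
    qed
    then have "(d/2) * nm x \<le> r * nm x"
      using restrD[OF xy] by (intro mult_right_mono) auto
    then show ?thesis using r(2)[OF xy] by linarith
  qed
  define S where "S x y = y \<ominus> of_real m \<odot> x" for x y
  have SV: "S x y \<in> V" if "(x, y) \<in> restr" for x y
    using restrD[OF that] by (simp add: S_def)
  have form: "d * \<bar>Re (ip (S x y) x)\<bar> \<le> (nm (S x y))\<^sup>2" if xy: "(x, y) \<in> restr" for x y
  proof -
    note D = restrD[OF xy]
    have *: "0 \<le> (nm (S x y))\<^sup>2 - 2 * k * Re (ip (S x y) x)" if k: "\<bar>k\<bar> = d / 2" for k
    proof -
      have eq: "y \<ominus> of_real (m + k) \<odot> x = S x y \<ominus> of_real k \<odot> x"
        using D by (intro ip_eqI) (auto simp: S_def ip_simps algebra_simps)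
      have "\<bar>k\<bar> * nm x \<le> nm (S x y \<ominus> of_real k \<odot> x)"
        using gap[OF k xy] by (simp only: k eq)
      then have "(\<bar>k\<bar> * nm x)\<^sup>2 \<le> (nm (S x y \<ominus> of_real k \<odot> x))\<^sup>2"
        using D by (intro power_mono) auto
      also have "\<dots> = (nm (S x y))\<^sup>2 - 2 * k * Re (ip (S x y) x) + k\<^sup>2 * (nm x)\<^sup>2"
        using D SV[OF xy] by (simp add: nm_minus_sq ip_simps power_mult_distrib)
      finally show ?thesis by (simp add: power_mult_distrib)
    qed
    show ?thesis using *[of "d/2"] *[of "-(d/2)"] d by (auto simp: abs_if)
  qed
  have bound: "d / 2 \<le> nm (S x' y')" if xy': "(x', y') \<in> restr" and n1: "nm x' = 1" for x' y'
  proof -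
    note D' = restrD[OF xy']
    have p: "of_real d \<odot> x' \<in> perp c" using D' by (simp add: perp_c)
    define e where "e = d / 8"
    have e: "e > 0" using d by (simp add: e_def)
    obtain x y where xy: "(x, y) \<in> restr" "nm (of_real d \<odot> x' \<ominus> S x y) < e"
      using restr_range_dense[OF p e, of m] unfolding S_def by blast
    note D = restrD[OF xy(1)]
    let ?s = "S x y" and ?s' = "S x' y'"
    have sV: "?s \<in> V" "?s' \<in> V" using SV xy(1) xy' by auto
    have plus: "(x' \<oplus> x, y' \<oplus> y) \<in> restr" "S (x' \<oplus> x) (y' \<oplus> y) = ?s' \<oplus> ?s"
      using restr_lin[OF xy' xy(1), of 1] D D'
      by (auto intro!: ip_eqI simp: S_def ip_simps algebra_simps restr_def perp_c gr_add)
    have minus: "(x' \<ominus> x, y' \<ominus> y) \<in> restr" "S (x' \<ominus> x) (y' \<ominus> y) = ?s' \<ominus> ?s"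
      using D D' by (auto intro!: ip_eqI simp: S_def ip_simps algebra_simps restr_def perp_c gr_minus)
    have "ip ?s x' = ip x ?s'"
      using gr_sym[OF D'(1) D(1)] D D' by (simp add: S_def ip_simps)
    then have sym: "Re (ip ?s' x) = Re (ip ?s x')"
      using cinner_commute[of ?s' x] D sV by simp
    have "4 * Re (ip ?s x') = Re (ip (?s' \<oplus> ?s) (x' \<oplus> x)) - Re (ip (?s' \<ominus> ?s) (x' \<ominus> x))"
      using D D' sV sym by (simp add: ip_simps)
    then have "d * (4 * Re (ip ?s x')) = d * Re (ip (?s' \<oplus> ?s) (x' \<oplus> x)) - d * Re (ip (?s' \<ominus> ?s) (x' \<ominus> x))"
      by (simp add: right_diff_distrib)
    also have "\<dots> \<le> d * \<bar>Re (ip (?s' \<oplus> ?s) (x' \<oplus> x))\<bar> + d * \<bar>Re (ip (?s' \<ominus> ?s) (x' \<ominus> x))\<bar>"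
    proof -
      have "d * Re (ip (?s' \<oplus> ?s) (x' \<oplus> x)) \<le> d * \<bar>Re (ip (?s' \<oplus> ?s) (x' \<oplus> x))\<bar>"
        "d * (- Re (ip (?s' \<ominus> ?s) (x' \<ominus> x))) \<le> d * \<bar>Re (ip (?s' \<ominus> ?s) (x' \<ominus> x))\<bar>"
        using d by (intro mult_left_mono; simp)+
      then show ?thesis by simp
    qed
    also have "\<dots> \<le> (nm (?s' \<oplus> ?s))\<^sup>2 + (nm (?s' \<ominus> ?s))\<^sup>2"
      using form[OF plus(1)] form[OF minus(1)] unfolding plus(2) minus(2) by (rule add_mono)
    also have "\<dots> = 2 * (nm ?s')\<^sup>2 + 2 * (nm ?s)\<^sup>2"
      using sV by (simp add: nm_add_sq nm_minus_sq)
    finally have 1: "4 * d * Re (ip ?s x') \<le> 2 * (nm ?s')\<^sup>2 + 2 * (nm ?s)\<^sup>2" by simp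
    have dx: "nm (of_real d \<odot> x') = d" using D' n1 d by simp
    have "nm ?s \<le> d + e"
      using nm_le_diff[of ?s "of_real d \<odot> x'"] sV D' dx xy(2) by (simp add: nm_minus_commute)
    then have 2: "(nm ?s)\<^sup>2 \<le> (d + e)\<^sup>2" using sV by (intro power_mono) auto
    have "Re (ip (of_real d \<odot> x' \<ominus> ?s) x') \<le> nm (of_real d \<odot> x' \<ominus> ?s) * nm x'"
      using ip_cs[of "of_real d \<odot> x' \<ominus> ?s" x'] complex_Re_le_cmod[of "ip (of_real d \<odot> x' \<ominus> ?s) x'"] sV D'
      by simp
    moreover have "Re (ip (of_real d \<odot> x' \<ominus> ?s) x') = d - Re (ip ?s x')"
      using sV D' n1 by (simp add: ip_simps ip_self)
    ultimately have "d - e \<le> Re (ip ?s x')" using xy(2) n1 by simp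
    then have "4 * d * (d - e) \<le> 4 * d * Re (ip ?s x')"
      using d by (intro mult_left_mono) auto
    then have "4 * d * (d - e) \<le> 2 * (nm ?s')\<^sup>2 + 2 * (d + e)\<^sup>2" using 1 2 by linarith
    moreover have "4 * d * (d - e) = 7/2 * d\<^sup>2" "2 * (d + e)\<^sup>2 = 81/32 * d\<^sup>2"
      by (auto simp: e_def power2_eq_square field_simps)
    ultimately have "d\<^sup>2 / 4 \<le> (nm ?s')\<^sup>2"
      using zero_le_power2[of d] by linarith
    then have "(d / 2)\<^sup>2 \<le> (nm ?s')\<^sup>2"
      by (simp add: power_divide)
    then show ?thesis
      by (rule power2_le_imp_le) (use sV in simp)
  qed
  obtain x y where "(x, y) \<in> restr" "nm x = 1" "nm (y \<ominus> of_real m \<odot> x) < d / 2"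
    using m d unfolding approx_eig_def by (auto dest: spec[of _ "d/2"])
  then show False using bound[of x y] by (simp add: S_def)
qed

text \<open>
  The approximate eigenvalues form a nonempty perfect set of real numbers.
\<close>
lemma continuum_le_spectrum: "|UNIV :: real set| \<le>o |spectrum M|"
proof -
  have "euclideanreal derived_set_of approx_eig = approx_eig"
  proof
    show "euclideanreal derived_set_of approx_eig \<subseteq> approx_eig"
      using approx_eig_closed closedin_contains_derived_set[of euclideanreal approx_eig]
      by simp
    show "approx_eig \<subseteq> euclideanreal derived_set_of approx_eig"
    proof
      fix m assume m: "m \<in> approx_eig"
      have "\<exists>y. y \<noteq> m \<and> y \<in> approx_eig \<and> y \<in> T" if T: "open T" "m \<in> T" for T
      proof -
        obtain d where d: "d > 0" "\<And>y. dist y m < d \<Longrightarrow> y \<in> T"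
          using T by (meson open_dist)
        then show ?thesis
          using approx_eig_not_isolated[OF m d(1)] by (auto simp: dist_real_def)
      qed
      then show "m \<in> euclideanreal derived_set_of approx_eig"
        by (auto simp: derived_set_of_def)
    qed
  qed
  then have "(UNIV :: real set) \<lesssim> approx_eig"
    using lepoll_perfect_set[of euclideanreal approx_eig] approx_eig_nonempty
      completely_metrizable_space_euclidean by blast
  then have 1: "|UNIV :: real set| \<le>o |approx_eig|"
    by (auto simp: lepoll_def card_of_ordLeq[symmetric])
  have 2: "|approx_eig| \<le>o |spectrum M|"
    using approx_eig_spectrum by (auto simp: card_of_ordLeq[symmetric] intro!: exI[of _ complex_of_real] inj_onI)
  show ?thesis using 1 2 by (rule ordLeq_transitive)
qed

end

section \<open>Cardinalities and eigenvectors\<close>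

lemma card_lists_le:
  assumes k: "Cinfinite \<kappa>" and A: "|A| \<le>o \<kappa>"
  shows "|lists A| \<le>o \<kappa>"
proof -
  have inf: "infinite (Field \<kappa>)" "Card_order \<kappa>"
    using k by (auto simp: cinfinite_def)
  have nat: "|UNIV :: nat set| \<le>o \<kappa>"
    using ordIso_ordLeq_trans[OF card_of_nat natLeq_ordLeq_cinfinite[OF k]] .
  have "|{xs \<in> lists A. length xs = n}| \<le>o \<kappa>" for n
  proof (induction n)
    case 0
    have "|{xs \<in> lists A. length xs = 0}| \<le>o |UNIV :: nat set|"
      by (subst card_of_ordLeq[symmetric]) (auto intro!: exI[of _ "\<lambda>_. 0"] inj_onI)
    then show ?case using nat ordLeq_transitive by blast
  next
    case (Suc n)
    have "{xs \<in> lists A. length xs = Suc n} \<subseteq> (\<lambda>p. fst p # snd p) ` (A \<times> {xs \<in> lists A. length xs = n})"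
    proof
      fix xs assume "xs \<in> {xs \<in> lists A. length xs = Suc n}"
      then obtain y ys where "xs = y # ys" "y \<in> A" "ys \<in> lists A" "length ys = n"
        by (cases xs) auto
      then show "xs \<in> (\<lambda>p. fst p # snd p) ` (A \<times> {xs \<in> lists A. length xs = n})"
        by (intro image_eqI[of _ _ "(y, ys)"]) auto
    qed
    then have "|{xs \<in> lists A. length xs = Suc n}| \<le>o |A \<times> {xs \<in> lists A. length xs = n}|"
      using ordLeq_transitive[OF card_of_mono1 card_of_image] by blast
    also have "|A \<times> {xs \<in> lists A. length xs = n}| \<le>o \<kappa>"
      by (rule card_of_Times_ordLeq_infinite_Field[OF inf(1) A Suc inf(2)])
    finally show ?case .
  qed
  then have "|\<Union>n. {xs \<in> lists A. length xs = n}| \<le>o \<kappa>"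
    by (intro card_of_UNION_ordLeq_infinite_Field[OF inf nat]) auto
  moreover have "(\<Union>n. {xs \<in> lists A. length xs = n}) = lists A" by auto
  ultimately show ?thesis by simp
qed

lemma card_image_le_trans: "|A| \<le>o \<kappa> \<Longrightarrow> |f ` A| \<le>o \<kappa>"
  using card_of_image ordLeq_transitive by blast

lemma card_subset_le_trans: "A \<subseteq> B \<Longrightarrow> |B| \<le>o \<kappa> \<Longrightarrow> |A| \<le>o \<kappa>"
  using card_of_mono1 ordLeq_transitive by blast

lemma card_Times_le:
  assumes "Cinfinite \<kappa>" "|A| \<le>o \<kappa>" "|B| \<le>o \<kappa>" shows "|A \<times> B| \<le>o \<kappa>"
  using assms by (intro card_of_Times_ordLeq_infinite_Field) (auto simp: cinfinite_def)

lemma card_Un_le: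
  assumes "Cinfinite \<kappa>" "|A| \<le>o \<kappa>" "|B| \<le>o \<kappa>" shows "|A \<union> B| \<le>o \<kappa>"
  using assms by (intro card_of_Un_ordLeq_infinite_Field) (auto simp: cinfinite_def)

lemma countable_card_le:
  assumes "Cinfinite \<kappa>" "countable A" shows "|A| \<le>o \<kappa>"
proof -
  have "|A| \<le>o |UNIV :: nat set|"
    using assms(2) by (subst card_of_ordLeq[symmetric]) (auto simp: countable_def)
  also have "|UNIV :: nat set| \<le>o \<kappa>"
    using ordIso_ordLeq_trans[OF card_of_nat natLeq_ordLeq_cinfinite[OF assms(1)]] .
  finally show ?thesis .
qed

lemma card_complex_sequences: "|UNIV :: (int \<Rightarrow> complex) set| \<le>o |UNIV :: real set|"
proof -
  obtain \<psi> :: "real \<Rightarrow> nat set" where \<psi>: "inj \<psi>"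
    using eqpoll_imp_lepoll[OF eqpoll_sym[OF nat_sets_eqpoll_reals]] by (auto simp: lepoll_def)
  obtain \<phi> :: "nat set \<Rightarrow> real" where \<phi>: "inj \<phi>"
    using eqpoll_imp_lepoll[OF nat_sets_eqpoll_reals] by (auto simp: lepoll_def)
  define code :: "(int \<Rightarrow> complex) \<Rightarrow> (int \<times> bool \<times> nat) set" where
    "code f = {(n, b, k). k \<in> \<psi> (if b then Re (f n) else Im (f n))}" for f
  have "inj code"
  proof (rule injI)
    fix f f' assume eq: "code f = code f'"
    have "\<psi> (if b then Re (f n) else Im (f n)) = \<psi> (if b then Re (f' n) else Im (f' n))" for n b
    proof -
      have "(n, b, k) \<in> code f \<longleftrightarrow> (n, b, k) \<in> code f'" for k by (simp add: eq)
      then have "k \<in> \<psi> (if b then Re (f n) else Im (f n)) \<longleftrightarrow>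
          k \<in> \<psi> (if b then Re (f' n) else Im (f' n))" for k
        unfolding code_def mem_Collect_eq prod.case .
      then show ?thesis by blast
    qed
    from this[of True] this[of False] show "f = f'"
      using injD[OF \<psi>] by (intro ext complex_eqI) auto
  qed
  moreover have "inj (\<lambda>S :: (int \<times> bool \<times> nat) set. to_nat ` S)"
    by (rule injI) (simp add: inj_image_eq_iff)
  ultimately have "inj (\<phi> \<circ> (\<lambda>S. to_nat ` S) \<circ> code)"
    using \<phi> by (intro inj_compose)
  then show ?thesis
    by (subst card_of_ordLeq[symmetric]) blast
qed

context complex_hilbert_space
begin

lemma lc_approx_countable:
  assumes Q: "\<And>z :: complex. \<And>e. e > 0 \<Longrightarrow> \<exists>q\<in>Q. cmod (z - q) < e"
    and c: "\<And>i. c i \<in> V" "\<And>i. i \<notin> I \<Longrightarrow> c i = \<zero>" and e: "e > 0"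
  shows "\<exists>ys\<in>lists (Q \<times> I). nm (lc c xs \<ominus> lc c ys) < e"
  using e
proof (induction xs arbitrary: e)
  case Nil
  then show ?case by (intro bexI[of _ "[]"]) auto
next
  case (Cons p xs)
  obtain t i where p: "p = (t, i)" by (cases p)
  have l: "lc c xs \<in> V" for xs using c by simp
  obtain ys where ys: "ys \<in> lists (Q \<times> I)" "nm (lc c xs \<ominus> lc c ys) < e / 2"
    using Cons.IH[of "e/2"] Cons.prems by auto
  show ?case
  proof (cases "i \<in> I")
    case False
    have "lc c (p # xs) \<ominus> lc c ys = lc c xs \<ominus> lc c ys"
      using c l False by (intro ip_eqI) (auto simp: p ip_simps)
    then show ?thesis using ys Cons.prems by (intro bexI[of _ ys]) auto
  next
    case True
    define k where "k = nm (c i) + 1"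
    have k: "k > 0" using c(1) by (simp add: k_def add_nonneg_pos)
    obtain q where q: "q \<in> Q" "cmod (t - q) < e / 2 / k"
      using Q[of "e / 2 / k" t] k Cons.prems by auto
    have "lc c (p # xs) \<ominus> lc c ((q, i) # ys) = (t - q) \<odot> c i \<oplus> (lc c xs \<ominus> lc c ys)"
      using c(1) l by (intro ip_eqI) (auto simp: p ip_simps algebra_simps)
    then have "nm (lc c (p # xs) \<ominus> lc c ((q, i) # ys)) \<le> nm ((t - q) \<odot> c i) + nm (lc c xs \<ominus> lc c ys)"
      using nm_triangle[of "(t - q) \<odot> c i" "lc c xs \<ominus> lc c ys"] c(1) l by simp
    moreover have "nm ((t - q) \<odot> c i) \<le> e / 2"
    proof -
      have "nm ((t - q) \<odot> c i) \<le> e / 2 / k * nm (c i)"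
        using mult_right_mono[OF less_imp_le[OF q(2)] nm_nonneg[OF c(1)]] c(1) by simp
      also have "\<dots> \<le> e / 2 / k * k"
        using k Cons.prems by (intro mult_left_mono) (auto simp: k_def)
      finally show ?thesis using k by simp
    qed
    ultimately have "nm (lc c (p # xs) \<ominus> lc c ((q, i) # ys)) < e" using ys(2) by linarith
    then show ?thesis using ys(1) q(1) True by (intro bexI[of _ "(q, i) # ys"]) auto
  qed
qed

text \<open>The coefficients may be taken from a countable dense set of complex numbers.\<close>
lemma small_dense_combinations:
  assumes k: "Cinfinite \<kappa>" and I: "|I| \<le>o \<kappa>" and c: "\<And>i. c i \<in> V" "\<And>i. i \<notin> I \<Longrightarrow> c i = \<zero>"
  obtains D where "D \<subseteq> Cl c" "|D| \<le>o \<kappa>" "\<And>xs e. e > 0 \<Longrightarrow> \<exists>d\<in>D. nm (lc c xs \<ominus> d) < e"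
proof -
  obtain Q :: "complex set" where Q: "countable Q" "\<And>U. open U \<Longrightarrow> U \<noteq> {} \<Longrightarrow> \<exists>q\<in>Q. q \<in> U"
    using countable_dense_setE by metis
  have Qd: "\<exists>q\<in>Q. cmod (z - q) < e" if "e > 0" for z :: complex and e
    using Q(2)[of "ball z e"] that by (auto simp: dist_norm)
  define D where "D = lc c ` lists (Q \<times> I)"
  have "|D| \<le>o \<kappa>"
    unfolding D_def using countable_card_le[OF k Q(1)] I
    by (intro card_image_le_trans card_lists_le[OF k] card_Times_le[OF k])
  moreover have "D \<subseteq> Cl c"
    by (auto simp: D_def intro!: Cl_lc Cl_self c(1))
  moreover have "\<exists>d\<in>D. nm (lc c xs \<ominus> d) < e" if "e > 0" for xs e
    using lc_approx_countable[OF Qd c that, where xs = xs] by (auto simp: D_def)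
  ultimately show ?thesis using that by blast
qed

end

context sa_op
begin

text \<open>
  For \<open>(Q - t)S = I + K\<close> and eigenvectors \<open>x\<close>, \<open>y\<close> for \<open>t\<close>, one gets \<open>\<langle>x, Ky\<rangle> = -\<langle>x, y\<rangle>\<close>, so \<open>K\<close> could
  not be compact on an infinite orthonormal set of eigenvectors.
\<close>
lemma finite_orthonormal_eigenvectors:
  assumes t: "t \<notin> ess_spectrum M" and B: "B \<subseteq> eigenspace M t"
    and on: "\<And>x y. \<lbrakk>x \<in> B; y \<in> B\<rbrakk> \<Longrightarrow> ip x y = (if x = y then 1 else 0)"
  shows "finite B"
proof (rule ccontr)
  assume "infinite B"
  then obtain f :: "nat \<Rightarrow> 'a" where f: "inj f" "range f \<subseteq> B"
    using infinite_countable_subset by blast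
  have fB: "f n \<in> B" for n using f(2) by auto
  have gr: "(f n, t \<odot> f n) \<in> graph M" and fV: "f n \<in> V" for n
    using fB[of n] B by (auto simp: eigenspace_def)
  have ipf: "ip (f m) (f n) = (if m = n then 1 else 0)" for m n
    using on[OF fB fB] f(1) by (auto simp: inj_eq)
  obtain S K where S: "bounded_op M S" "compact_op M K"
      "\<And>v. v \<in> V \<Longrightarrow> (S v, v \<oplus> K v) \<in> shifted_graph M t"
    using t unfolding not_ess_spectrum_iff by blast
  have K: "bounded_op M K" using S(2) by (simp add: compact_op_def)
  have in_V: "S v \<in> V" "K v \<in> V" if "v \<in> V" for v
    using that bounded_opD(1)[OF S(1)] bounded_opD(1)[OF K] by auto
  have real: "cnj t = t"
    using gr_sym[OF gr[of 0] gr[of 0]] fV[of 0] ipf[of 0 0] by (simp add: ip_simps)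
  have ipK: "ip (f m) (K (f n)) = - ip (f m) (f n)" for m n
  proof -
    have "(S (f n), f n \<oplus> K (f n) \<oplus> t \<odot> S (f n)) \<in> graph M"
      using S(3)[OF fV] in_V[OF fV] fV by (simp add: shifted_iff)
    then have "ip (t \<odot> f m) (S (f n)) = ip (f m) (f n \<oplus> K (f n) \<oplus> t \<odot> S (f n))"
      using gr by (rule gr_sym)
    then show ?thesis
      using fV in_V[OF fV] by (simp add: ip_simps real eq_neg_iff_add_eq_0 add.commute)
  qed
  have nm_f: "nm (f n) = 1" for n
    by (simp add: hnorm_def ipf)
  have far: "1 \<le> nm (K (f m) \<ominus> K (f n))" if "m \<noteq> n" for m n
  proof -
    have "ip (f m) (K (f m) \<ominus> K (f n)) = -1"
      using fV in_V[OF fV] that by (simp add: ip_simps ipK ipf)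
    then have "1 \<le> nm (f m) * nm (K (f m) \<ominus> K (f n))"
      using ip_cs[of "f m" "K (f m) \<ominus> K (f n)"] fV in_V[OF fV] by simp
    then show ?thesis by (simp add: nm_f)
  qed
  obtain r :: "nat \<Rightarrow> nat" where r: "strict_mono r" "MS.MCauchy (\<lambda>n. K (f (r n)))"
    using conjunct2[OF iffD1[OF compact_op_iff S(2)], rule_format, of f] fV nm_f by auto
  obtain k where k: "\<And>n n'. k \<le> n \<Longrightarrow> k \<le> n' \<Longrightarrow> hdist M (K (f (r n))) (K (f (r n'))) < 1"
    using r(2) unfolding MS.MCauchy_def by (meson zero_less_one)
  have "r k \<noteq> r (Suc k)" using strict_monoD[OF r(1), of k "Suc k"] by simp
  then show False
    using k[of k "Suc k"] far[of "r k" "r (Suc k)"] in_V[OF fV] by (simp add: hdist_eq)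
qed

lemma cpow_perp:
  assumes "compat c c" "y \<in> perp c" shows "cpow n y \<in> perp c"
proof -
  have "(cayley ^^ k) y \<in> perp c" "(cayley_inv ^^ k) y \<in> perp c" for k
    using assms perp_cayley[OF assms(1)] by (induction k) auto
  then show ?thesis by (simp add: cpow_def)
qed

lemma smult_one_id: "x \<in> V \<Longrightarrow> 1 \<odot> x = x"
  by (intro ip_eqI) (auto simp: ip_simps)

lemma compat_cpow:
  assumes V: "u \<in> V" "u' \<in> V" and mom: "\<And>n. ip (cpow n u) u = ip (cpow n u') u'"
  shows "compat (\<lambda>n. cpow n u) (\<lambda>n. cpow n u')"
  unfolding compat_def same_gram_def
proof (intro conjI allI)
  fix n
  show "\<exists>k s. cayley (cpow n u) = s \<odot> cpow k u \<and> cayley (cpow n u') = s \<odot> cpow k u'"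
    using V by (intro exI[of _ "n + 1"] exI[of _ 1]) (simp add: cayley_cpow smult_one_id)
  show "\<exists>k s. cayley_inv (cpow n u) = s \<odot> cpow k u \<and> cayley_inv (cpow n u') = s \<odot> cpow k u'"
    using V by (intro exI[of _ "n - 1"] exI[of _ 1]) (simp add: cayley_inv_cpow smult_one_id)
qed (use V mom in \<open>auto simp: ip_cpow\<close>)

lemma cayley_eigen_inv:
  assumes "y \<in> V" "cayley y = z \<odot> y"
  shows "cayley_inv y = (1 / z) \<odot> y"
proof (cases "z = 0")
  case True
  have "0 \<odot> y = \<zero>" using assms(1) by (intro ip_eqI) (auto simp: ip_simps)
  then have "cayley y = \<zero>" using assms(2) True by simp
  then have y: "y = \<zero>" using cayley_inv_cayley[OF assms(1)] by simp
  show ?thesis unfolding y by (auto intro!: ip_eqI simp: ip_simps)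
next
  case False
  have "y = z \<odot> cayley_inv y"
    using arg_cong[OF assms(2), of cayley_inv] assms(1) by (simp add: cayley_inv_smult)
  then have "ip y v = z * ip (cayley_inv y) v" if "v \<in> V" for v
    using assms(1) that by (metis cinner_smult cayley_inv_in)
  then show ?thesis
    using assms(1) False by (intro ip_eqI) (auto simp: ip_simps)
qed

lemma cayley_eigen_unit:
  assumes "y \<in> V" "y \<noteq> \<zero>" "cayley y = z \<odot> y"
  shows "cmod z = 1"
  using nm_cayley[OF assms(1)] nm_pos[OF assms(1,2)] assms(1) unfolding assms(3) by simp

text \<open>
  Eigenvalues of a unitary operator lie on the unit circle, where \<open>z cnj z' = 1\<close> forces \<open>z = z'\<close>.
\<close>
lemma cayley_eigen_orth:
  assumes V: "x \<in> V" "y \<in> V" and eig: "cayley x = z \<odot> x" "cayley y = z' \<odot> y" and ne: "z \<noteq> z'"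
  shows "ip x y = 0"
proof (rule ccontr)
  assume nz: "ip x y \<noteq> 0"
  have "x \<noteq> \<zero>" "y \<noteq> \<zero>" using nz V by auto
  then have "cmod z' = 1" using cayley_eigen_unit V eig by blast
  then have "cnj z' * z' = 1"
    using complex_norm_square[of z'] by (simp add: mult.commute)
  moreover have "z * cnj z' = 1"
    using ip_cayley_cayley[OF V] nz V by (simp add: eig ip_simps mult.commute)
  ultimately have "z = z'"
    by (metis mult.assoc mult.right_neutral mult.left_neutral)
  then show False using ne by simp
qed

text \<open>The inverse Cayley transform maps eigenvalues of the unitary injectively to eigenvalues of \<open>Q\<close>.\<close>
lemma card_cayley_eigenvalues: "|{z. \<exists>y\<in>V. y \<noteq> \<zero> \<and> cayley y = z \<odot> y}| \<le>o |spectrum M|"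
proof -
  let ?Z = "{z. \<exists>y\<in>V. y \<noteq> \<zero> \<and> cayley y = z \<odot> y}"
  define l where "l z = \<i> * (1 + z) / (1 - z)" for z :: complex
  have Z: "z \<noteq> 1 \<and> l z \<in> spectrum M" if zZ: "z \<in> ?Z" for z
  proof -
    obtain y where y: "y \<in> V" "y \<noteq> \<zero>" "cayley y = z \<odot> y" using zZ by blast
    have *: "(y \<ominus> cayley y, \<i> \<odot> (y \<oplus> cayley y)) \<in> graph M" using y(1) by (rule gr_cayleyI)
    have "y \<ominus> cayley y = (1 - z) \<odot> y" "\<i> \<odot> (y \<oplus> cayley y) = (\<i> * (1 + z)) \<odot> y"
      using y by (auto intro!: ip_eqI simp: ip_simps algebra_simps)
    then have g: "((1 - z) \<odot> y, (\<i> * (1 + z)) \<odot> y) \<in> graph M" using * by simp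
    have z1: "z \<noteq> 1"
    proof
      assume z: "z = 1"
      have "(1 - z) \<odot> y = \<zero>" using y z by (intro ip_eqI) (auto simp: ip_simps)
      then have "(\<i> * (1 + z)) \<odot> y = \<zero>" using g gr_unique[OF _ gr_zero] by simp
      then have "cmod (\<i> * (1 + z)) * nm y = 0" using nm_smult[OF y(1), of "\<i> * (1 + z)"] by simp
      then show False using y nm_eq_0 z by (simp add: norm_mult)
    qed
    have "(y, l z \<odot> y) \<in> graph M"
    proof -
      have "(1 / (1 - z)) \<odot> ((1 - z) \<odot> y) = y" "(1 / (1 - z)) \<odot> ((\<i> * (1 + z)) \<odot> y) = l z \<odot> y"
        using y z1 by (auto intro!: ip_eqI simp: ip_simps l_def)
      then show ?thesis using gr_smult[OF g, of "1 / (1 - z)"] by simp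
    qed
    then have sh: "(y, \<zero>) \<in> shifted_graph M (l z)" using y(1) by (simp add: shifted_iff)
    have "\<zero> \<oplus> l z \<odot> \<zero> = \<zero>" by (intro ip_eqI) (auto simp: ip_simps)
    then have sh0: "(\<zero>, \<zero>) \<in> shifted_graph M (l z)" by (simp add: shifted_iff)
    have "l z \<in> spectrum M"
    proof (rule ccontr)
      assume "l z \<notin> spectrum M"
      then obtain S where "\<And>x y. (x, y) \<in> shifted_graph M (l z) \<Longrightarrow> S y = x"
        unfolding not_spectrum_iff by blast
      from this[OF sh] this[OF sh0] show False using y(2) by simp
    qed
    then show ?thesis using z1 by simp
  qed
  have "inj_on l ?Z"
  proof (rule inj_onI)
    fix z z' assume "z \<in> ?Z" "z' \<in> ?Z" and eq: "l z = l z'"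
    then have "z \<noteq> 1" "z' \<noteq> 1" using Z by auto
    then have "(1 + z) * (1 - z') = (1 + z') * (1 - z)"
      using eq unfolding l_def by (simp add: frac_eq_eq mult.assoc)
    then show "z = z'" by (simp add: algebra_simps)
  qed
  moreover have "l ` ?Z \<subseteq> spectrum M" using Z by blast
  ultimately show ?thesis by (subst card_of_ordLeq[symmetric]) blast
qed

end

section \<open>Small dense sets of types\<close>

locale type_setting = sa_op M for M :: "'a hilb_op" (structure) +
  fixes M0 :: "'a hilb_op" and G :: "'a set"
  assumes in_class: "M \<in> K_class M0" and G_in: "G \<subseteq> V"
begin

definition same_type :: "('a \<times> 'a) set" where
  "same_type = {(v, w). gatp_eq M0 (UNIV :: unit set) M (\<lambda>_. v) M (\<lambda>_. w) G}"

lemma same_typeD: "(v, w) \<in> same_type \<Longrightarrow> v \<in> V \<and> w \<in> V"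
  by (auto simp: same_type_def gatp_eq_def)

lemma same_type_refl: "v \<in> V \<Longrightarrow> (v, v) \<in> same_type"
proof -
  assume v: "v \<in> V"
  have "K_embedding M M (\<lambda>x. x)"
    by (rule K_embeddingI[where f' = "\<lambda>x. x"]) (unfold_locales, auto)
  then show ?thesis
    using v in_class G_in unfolding same_type_def gatp_eq_def
    by (auto intro!: bexI[of _ M] exI[of _ "\<lambda>x. x"])
qed

lemma type_dist_le:
  assumes "(x, v) \<in> same_type" "(y, w) \<in> same_type"
  shows "type_dist M (same_type `` {x}) (same_type `` {y}) \<le> nm (v \<ominus> w)"
  unfolding type_dist_def
proof (rule cInf_lower)
  show "bdd_below {nm (v \<ominus> w) |v w. v \<in> same_type `` {x} \<and> w \<in> same_type `` {y}}"
    using same_typeD by (intro bdd_belowI[of _ 0]) auto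
qed (use assms in blast)

lemma galois_types_eq: "galois_types M0 M G = (\<lambda>x. same_type `` {x}) ` V"
  unfolding galois_types_def same_type_def quotient_def by blast

text \<open>
  The distance of two types is an infimum over all realizations, so both vectors may be replaced by
  others of the same type before they are compared.
\<close>
lemma dense_types:
  assumes D: "D \<subseteq> V" "|D| \<le>o \<kappa>"
    and approx: "\<And>v e. \<lbrakk>v \<in> V; e > 0\<rbrakk> \<Longrightarrow>
      \<exists>d\<in>D. \<exists>w v'. (d, w) \<in> same_type \<and> (v, v') \<in> same_type \<and> nm (v' \<ominus> w) < e"
  shows "\<exists>D \<subseteq> galois_types M0 M G. |D| \<le>o \<kappa> \<and>
           (\<forall>p\<in>galois_types M0 M G. \<forall>e>0. \<exists>q\<in>D. type_dist M p q < e)"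
proof (intro exI conjI ballI allI impI)
  show "(\<lambda>x. same_type `` {x}) ` D \<subseteq> galois_types M0 M G"
    using D(1) by (auto simp: galois_types_eq)
  show "|(\<lambda>x. same_type `` {x}) ` D| \<le>o \<kappa>"
    using D(2) by (rule card_image_le_trans)
  fix p and e :: real assume p: "p \<in> galois_types M0 M G" and e: "e > 0"
  obtain v where v: "v \<in> V" "p = same_type `` {v}" using p by (auto simp: galois_types_eq)
  obtain d w v' where d: "d \<in> D" "(d, w) \<in> same_type" "(v, v') \<in> same_type" "nm (v' \<ominus> w) < e"
    using approx[OF v(1) e] by blast
  show "\<exists>q\<in>(\<lambda>x. same_type `` {x}) ` D. type_dist M p q < e"
  proof (rule bexI)
    show "type_dist M p (same_type `` {d}) < e"
      using type_dist_le[OF d(3,2)] d(4) by (simp add: v(2))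
  qed (use d(1) in blast)
qed

end

locale small_parameters = type_setting M M0 G for M :: "'a hilb_op" (structure) and M0 G +
  fixes \<kappa> :: "'k rel"
  assumes \<kappa>: "Cinfinite \<kappa>" and small: "|G| \<le>o \<kappa>" and large: "\<kappa> <o |V|"
    and spec: "|spectrum M| \<le>o \<kappa>"
begin

definition eigenbasis :: "complex \<Rightarrow> 'a set" where
  "eigenbasis t = (SOME B. orthonormal_basis M (eigenspace M t) B)"

lemma eigenbasis:
  assumes "t \<in> spectrum M - ess_spectrum M"
  shows "orthonormal_basis M (eigenspace M t) (eigenbasis t)" "finite (eigenbasis t)"
proof -
  have "\<exists>B. orthonormal_basis M (eigenspace M t) B"
    using assms in_class unfolding K_class_def spectrally_equivalent_def same_dim_def by blast
  then show *: "orthonormal_basis M (eigenspace M t) (eigenbasis t)"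
    unfolding eigenbasis_def by (rule someI_ex)
  show "finite (eigenbasis t)"
    by (rule finite_orthonormal_eigenvectors[of t])
      (use assms * in \<open>auto simp: orthonormal_basis_def\<close>)
qed

text \<open>
  The discrete eigenspaces must not be enlarged in an amalgam, so bases of them are added to the
  parameters.
\<close>
definition params :: "'a set" where
  "params = G \<union> (\<Union>t\<in>spectrum M - ess_spectrum M. eigenbasis t)"

lemma params_in: "params \<subseteq> V"
proof -
  have "eigenbasis t \<subseteq> V" if "t \<in> spectrum M - ess_spectrum M" for t
    using eigenbasis(1)[OF that] unfolding orthonormal_basis_def eigenspace_def by blast
  then show ?thesis using G_in unfolding params_def by blast
qed

lemma card_params: "|params| \<le>o \<kappa>"
proof -
  have "|spectrum M - ess_spectrum M| \<le>o \<kappa>"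
    using spec by (rule card_subset_le_trans[rotated]) blast
  then have "|\<Union>t\<in>spectrum M - ess_spectrum M. eigenbasis t| \<le>o \<kappa>"
    using \<kappa> eigenbasis(2)
    by (intro card_of_UNION_ordLeq_infinite_Field)
      (auto simp: cinfinite_def intro: countable_card_le[OF \<kappa>] countable_finite)
  then show ?thesis
    unfolding params_def using small by (intro card_Un_le[OF \<kappa>])
qed

text \<open>
  The closed span of the orbit is the reducing subspace generated by the parameters; the orthogonal
  complement of the orbit is where types over the parameters differ freely.
\<close>
definition orbit :: "int \<times> 'a \<Rightarrow> 'a" where
  "orbit = (\<lambda>(n, g). if g \<in> params then cpow n g else \<zero>)"

lemma orbit_in: "orbit p \<in> V"
  using params_in by (auto simp: orbit_def split: prod.split)

lemmas perp_orbit = perp_closed[of orbit, OF orbit_in]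

lemma orbit_0: "g \<in> params \<Longrightarrow> orbit (0, g) = g"
  by (simp add: orbit_def)

lemma compat_orbit: "compat orbit orbit"
  unfolding compat_def
proof (intro conjI allI same_gram_refl orbit_in)
  fix p :: "int \<times> 'a"
  obtain n g where p: "p = (n, g)" by (cases p)
  have z: "1 \<odot> \<zero> = \<zero>" by (rule smult_one_id) simp
  show "\<exists>k s. cayley (orbit p) = s \<odot> orbit k \<and> cayley (orbit p) = s \<odot> orbit k"
    using params_in z
    by (intro exI[of _ "(n + 1, g)"] exI[of _ 1])
      (auto simp: p orbit_def cayley_cpow smult_one_id subset_iff)
  show "\<exists>k s. cayley_inv (orbit p) = s \<odot> orbit k \<and> cayley_inv (orbit p) = s \<odot> orbit k"
    using params_in z
    by (intro exI[of _ "(n - 1, g)"] exI[of _ 1])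
      (auto simp: p orbit_def cayley_inv_cpow smult_one_id subset_iff)
qed

lemma card_orbit_index: "|(UNIV :: int set) \<times> params| \<le>o \<kappa>"
  by (intro card_Times_le[OF \<kappa>] card_params countable_card_le[OF \<kappa>]) simp

abbreviation proj :: "'a \<Rightarrow> 'a" where "proj \<equiv> Tr orbit orbit"

lemma orbit_gram: "same_gram orbit orbit"
  by (rule same_gram_refl[OF orbit_in])

lemma proj_in: "v \<in> V \<Longrightarrow> proj v \<in> V"
  by (rule Tr_in[OF orbit_gram])

lemma minus_proj_perp: "v \<in> V \<Longrightarrow> v \<ominus> proj v \<in> perp orbit"
  using orbit_in proj_in Tr_ip[OF orbit_gram] by (auto simp: perp_def ip_simps)

lemma proj_decomp: "v \<in> V \<Longrightarrow> proj v \<oplus> (v \<ominus> proj v) = v"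
  using proj_in by (intro ip_eqI) (auto simp: ip_simps)

lemma infinite_V: "infinite V"
proof -
  have "infinite (Field \<kappa>)" "Card_order \<kappa>" using \<kappa> by (auto simp: cinfinite_def)
  moreover have "\<kappa> \<le>o |V|" using large by (rule ordLess_imp_ordLeq)
  ultimately show ?thesis
    using card_of_ordLeq_infinite[of "Field \<kappa>" V] card_of_Field_ordIso[of \<kappa>] ordIso_ordLeq_trans by blast
qed

text \<open>
  A vector is split into its component \<open>h\<close> in the reducing subspace generated by the parameters and
  an orthogonal one. The latter may be moved by any unitary operator between reducing subspaces
  that are orthogonal to the parameters: they contain no discrete eigenvectors, since the
  parameters contain bases of the discrete eigenspaces.
\<close>
lemma same_typeI:
  assumes c: "compat a b" and ab: "\<And>i. a i \<in> perp orbit" "\<And>i. b i \<in> perp orbit"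
    and h: "h \<in> Cl orbit" and v: "v \<in> Cl a" and u: "u \<in> Cl b" and uv: "\<And>i. ip v (a i) = ip u (b i)"
  shows "(h \<oplus> v, h \<oplus> u) \<in> same_type"
proof -
  have orth: "ip g (a i) = 0" "ip g (b i) = 0" if g: "g \<in> Cl orbit" for g i
    by (rule ClD(2)[OF g perp_in[OF ab(1)]], rule perp_ip[OF ab(1)])
      (rule ClD(2)[OF g perp_in[OF ab(2)]], rule perp_ip[OF ab(2)])
  have GCl: "g \<in> Cl orbit" if "g \<in> G" for g
    using Cl_self[of orbit "(0, g)"] orbit_in orbit_0[of g] that by (simp add: params_def)
  have eig: "eigenspace M t \<inter> Cl a = {\<zero>}" if t: "t \<in> spectrum M - ess_spectrum M" for t
  proof (intro equalityI subsetI)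
    fix x assume x: "x \<in> eigenspace M t \<inter> Cl a"
    then have xp: "x \<in> perp orbit" using Cl_perp[of orbit a] orbit_in ab(1) by blast
    have "ip x y = 0" if y: "y \<in> eigenbasis t" for y
    proof -
      have "y \<in> params" using y t unfolding params_def by blast
      then show ?thesis using perp_ip[OF xp, of "(0, y)"] by (simp add: orbit_0)
    qed
    then show "x \<in> {\<zero>}"
      using eigenbasis(1)[OF t] x unfolding orthonormal_basis_def by blast
  next
    have "t \<odot> \<zero> = \<zero>" by (rule ip_eqI) (auto simp: ip_simps)
    then show "x \<in> eigenspace M t \<inter> Cl a" if "x \<in> {\<zero>}" for x
      using that by (auto simp: eigenspace_def)
  qed
  have "gatp_eq M0 (UNIV :: unit set) M (\<lambda>_. h \<oplus> v) M (\<lambda>_. h \<oplus> u) G"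
    by (rule gatp_eqI[OF in_class c G_in ordLeq_ordLess_trans[OF small large] infinite_V _ _ eig])
      (use orth h GCl ClD(1)[OF h] v u uv in auto)
  then show ?thesis by (simp add: same_type_def)
qed

lemma card_vector_sums:
  assumes "|A| \<le>o \<kappa>" "|B| \<le>o \<kappa>"
  shows "|(\<lambda>(x, y). x \<oplus> y) ` (A \<times> B)| \<le>o \<kappa>"
  using assms by (intro card_image_le_trans card_Times_le[OF \<kappa>])

lemma proj_approx:
  obtains D where "D \<subseteq> Cl orbit" "|D| \<le>o \<kappa>"
    "\<And>v e. \<lbrakk>v \<in> V; e > 0\<rbrakk> \<Longrightarrow> \<exists>d\<in>D. nm (proj v \<ominus> d) < e"
proof -
  obtain D where D: "D \<subseteq> Cl orbit" "|D| \<le>o \<kappa>" "\<And>xs e. e > 0 \<Longrightarrow> \<exists>d\<in>D. nm (lc orbit xs \<ominus> d) < e"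
  proof (rule small_dense_combinations[OF \<kappa> card_orbit_index, of orbit])
    show "orbit i = \<zero>" if "i \<notin> UNIV \<times> params" for i
      using that by (cases i) (auto simp: orbit_def)
  qed (use orbit_in in auto)
  have "\<exists>d\<in>D. nm (proj v \<ominus> d) < e" if v: "v \<in> V" and e: "e > 0" for v e
  proof -
    obtain xs where xs: "nm (proj v \<ominus> lc orbit xs) < e / 2"
      using Tr_approx[OF orbit_gram v, of "e/2"] e by auto
    obtain d where d: "d \<in> D" "nm (lc orbit xs \<ominus> d) < e / 2"
      using D(3)[of "e/2" xs] e by auto
    have "nm (proj v \<ominus> d) \<le> nm (proj v \<ominus> lc orbit xs) + nm (lc orbit xs \<ominus> d)"
      using d(1) D(1) ClD(1) proj_in[OF v] orbit_in by (intro nm_diff_triangle) auto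
    then show ?thesis using xs d by (intro bexI[of _ d]) auto
  qed
  then show ?thesis using that D by blast
qed

text \<open>
  The closed span of the orbit of \<open>u\<close> under the Cayley transform \<open>U\<close> is determined, up to unitary
  equivalence, by the moments \<open>\<langle>U\<^sup>n u, u\<rangle>\<close>, which are the Gram matrix of the orbit. There are only
  continuum many sequences of moments, and one representative for each of them suffices.
\<close>
lemma dense_types_continuum:
  assumes cont: "|UNIV :: real set| \<le>o \<kappa>"
  shows "\<exists>D\<subseteq>V. |D| \<le>o \<kappa> \<and> (\<forall>v\<in>V. \<forall>e>0.
    \<exists>d\<in>D. \<exists>w v'. (d, w) \<in> same_type \<and> (v, v') \<in> same_type \<and> nm (v' \<ominus> w) < e)"
proof -
  define mom where "mom u = (\<lambda>n. ip (cpow n u) u)" for u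
  define rep where "rep m = (SOME u. u \<in> perp orbit \<and> mom u = m)" for m
  have rep: "rep (mom u) \<in> perp orbit" "mom (rep (mom u)) = mom u" if "u \<in> perp orbit" for u
    using someI[of "\<lambda>w. w \<in> perp orbit \<and> mom w = mom u" u] that by (auto simp: rep_def)
  obtain D0 where D0: "D0 \<subseteq> Cl orbit" "|D0| \<le>o \<kappa>"
    "\<And>v e. \<lbrakk>v \<in> V; e > 0\<rbrakk> \<Longrightarrow> \<exists>d\<in>D0. nm (proj v \<ominus> d) < e"
    by (rule proj_approx) (rule that)
  define R where "R = rep ` mom ` perp orbit"
  define D where "D = (\<lambda>(x, y). x \<oplus> y) ` (D0 \<times> R)"
  have card_mom: "|mom ` perp orbit| \<le>o \<kappa>"
    using card_of_mono1[of "mom ` perp orbit" UNIV] card_complex_sequences cont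
    by (blast intro: ordLeq_transitive)
  have card: "|D| \<le>o \<kappa>"
    unfolding D_def R_def by (rule card_vector_sums[OF D0(2) card_image_le_trans[OF card_mom]])
  have RV: "R \<subseteq> V" using rep(1) perp_in by (auto simp: R_def)
  have D0V: "D0 \<subseteq> V" using D0(1) ClD(1) by blast
  have DV: "D \<subseteq> V" using RV D0V by (auto simp: D_def)
  have "\<exists>d\<in>D. \<exists>w v'. (d, w) \<in> same_type \<and> (v, v') \<in> same_type \<and> nm (v' \<ominus> w) < e"
    if v: "v \<in> V" and e: "e > 0" for v e
  proof -
    define u where "u = v \<ominus> proj v"
    have u: "u \<in> perp orbit" using minus_proj_perp[OF v] by (simp add: u_def)
    have uV: "u \<in> V" using u by (rule perp_in)
    obtain g where g: "g \<in> D0" "nm (proj v \<ominus> g) < e" using D0(3)[OF v e] by blast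
    have gV: "g \<in> V" using g(1) D0V by blast
    define u' where "u' = rep (mom u)"
    have u': "u' \<in> perp orbit" "mom u' = mom u" using rep[OF u] by (auto simp: u'_def)
    have u'V: "u' \<in> V" using u'(1) by (rule perp_in)
    have m: "ip (cpow n u') u' = ip (cpow n u) u" for n
      using fun_cong[OF u'(2), of n] by (simp add: mom_def)
    have "(g \<oplus> u', g \<oplus> u) \<in> same_type"
    proof (rule same_typeI[OF compat_cpow[OF u'V uV m]])
      show "u' \<in> Cl (\<lambda>n. cpow n u')" "u \<in> Cl (\<lambda>n. cpow n u)"
        using Cl_self[of "\<lambda>n. cpow n u'" 0] Cl_self[of "\<lambda>n. cpow n u" 0] uV u'V by simp_all
      show "ip u' (cpow n u') = ip u (cpow n u)" for n
        using ip_cpow[OF u'V u'V, of 0 n] ip_cpow[OF uV uV, of 0 n] m by simp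
    qed (use u u' g(1) D0(1) in \<open>auto intro: cpow_perp[OF compat_orbit]\<close>)
    moreover have "g \<oplus> u' \<in> D"
      using g(1) u by (auto simp: D_def R_def u'_def)
    moreover have "nm (v \<ominus> (g \<oplus> u)) < e"
    proof -
      have "v \<ominus> (g \<oplus> u) = proj v \<ominus> g"
        using v gV proj_in[OF v] by (intro ip_eqI) (auto simp: u_def ip_simps)
      then show ?thesis using g(2) by simp
    qed
    ultimately show ?thesis using same_type_refl[OF v] by blast
  qed
  then show ?thesis using DV card by blast
qed

definition eigvec :: "complex \<Rightarrow> 'a set" where
  "eigvec z = {y \<in> perp orbit. cayley y = z \<odot> y}"

lemma eigvecD: "y \<in> eigvec z \<Longrightarrow> y \<in> perp orbit" "y \<in> eigvec z \<Longrightarrow> y \<in> V"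
  "y \<in> eigvec z \<Longrightarrow> cayley y = z \<odot> y"
  using perp_in by (auto simp: eigvec_def)

lemma eigvec_closed:
  shows "\<zero> \<in> eigvec z" "y \<in> eigvec z \<Longrightarrow> t \<odot> y \<in> eigvec z"
    "\<lbrakk>x \<in> eigvec z; y \<in> eigvec z\<rbrakk> \<Longrightarrow> x \<ominus> y \<in> eigvec z"
proof -
  have "z \<odot> \<zero> = \<zero>" by (rule ip_eqI) (auto simp: ip_simps)
  then show "\<zero> \<in> eigvec z" using perp_orbit(1) by (simp add: eigvec_def)
  show "t \<odot> y \<in> eigvec z" if "y \<in> eigvec z"
    using eigvecD[OF that] perp_orbit(4)
    by (auto simp: eigvec_def cayley_smult intro!: ip_eqI) (simp add: ip_simps)
  show "x \<ominus> y \<in> eigvec z" if "x \<in> eigvec z" "y \<in> eigvec z"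
    using eigvecD[OF that(1)] eigvecD[OF that(2)] perp_orbit(3)
    by (auto simp: eigvec_def cayley_minus intro!: ip_eqI) (simp add: ip_simps algebra_simps)
qed

text \<open>
  A part without eigenvectors would put continuum many points into the spectrum.
\<close>
lemma eigenvectors_total:
  assumes cont: "\<not> |UNIV :: real set| \<le>o \<kappa>"
    and y: "y \<in> perp orbit" "\<And>z x. x \<in> eigvec z \<Longrightarrow> ip y x = 0"
  shows "y = \<zero>"
proof -
  define E where "E x = (if \<exists>z. x \<in> eigvec z then x else \<zero>)" for x
  define c where "c = case_sum orbit E"
  have E_in: "E x \<in> V" for x using eigvecD(2) by (auto simp: E_def)
  have c_in: "c i \<in> V" for i using orbit_in E_in by (auto simp: c_def split: sum.split)
  have E_eig: "\<exists>z. E x \<in> eigvec z" for x using eigvec_closed(1) by (auto simp: E_def)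
  have perp_c: "perp c = {y \<in> perp orbit. \<forall>x. ip y (E x) = 0}"
    by (auto simp: perp_def c_def split: sum.splits)
  have compat_c: "compat c c"
    unfolding compat_def
  proof (intro conjI allI same_gram_refl c_in)
    fix i
    show "\<exists>k s. cayley (c i) = s \<odot> c k \<and> cayley (c i) = s \<odot> c k"
    proof (cases i)
      case (Inl p)
      obtain k s where "cayley (orbit p) = s \<odot> orbit k"
        using compat_orbit unfolding compat_def by blast
      then show ?thesis by (intro exI[of _ "Inl k"] exI[of _ s]) (simp add: c_def Inl)
    next
      case (Inr x)
      obtain z where "E x \<in> eigvec z" using E_eig by blast
      then show ?thesis by (intro exI[of _ i] exI[of _ z]) (simp add: c_def Inr eigvecD)
    qed
    show "\<exists>k s. cayley_inv (c i) = s \<odot> c k \<and> cayley_inv (c i) = s \<odot> c k"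
    proof (cases i)
      case (Inl p)
      obtain k s where "cayley_inv (orbit p) = s \<odot> orbit k"
        using compat_orbit unfolding compat_def by blast
      then show ?thesis by (intro exI[of _ "Inl k"] exI[of _ s]) (simp add: c_def Inl)
    next
      case (Inr x)
      obtain z where "E x \<in> eigvec z" using E_eig by blast
      then have "cayley_inv (E x) = (1 / z) \<odot> E x" by (intro cayley_eigen_inv eigvecD)
      then show ?thesis by (intro exI[of _ i] exI[of _ "1 / z"]) (simp add: c_def Inr)
    qed
  qed
  have "perp c = {\<zero>}"
  proof (rule ccontr)
    assume nt: "perp c \<noteq> {\<zero>}"
    interpret F: eigenvector_free M c
    proof
      show "compat c c" by (rule compat_c)
      show "perp c \<noteq> {\<zero>}" by (rule nt)
      fix x t assume x: "x \<in> perp c" "cayley x = t \<odot> x"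
      then have "x \<in> eigvec t" by (simp add: eigvec_def perp_c)
      then have "E x = x" by (auto simp: E_def)
      moreover have "ip x (E x) = 0" using x(1) by (simp add: perp_c)
      ultimately show "x = \<zero>" using cinner_eq_0 perp_in[OF x(1)] by simp
    qed
    show False using F.continuum_le_spectrum spec cont ordLeq_transitive by blast
  qed
  moreover have "y \<in> perp c"
    using y perp_in[OF y(1)] by (auto simp: perp_c E_def)
  ultimately show ?thesis by blast
qed

text \<open>
  The projection onto the eigenspace yields an eigenvector, because the adjoint of \<open>U - z\<close> maps every
  vector into the orthogonal complement of the eigenspace.
\<close>
lemma eigen_component:
  assumes v: "v \<in> V"
  obtains y where "y \<in> eigvec z" "\<And>x. x \<in> eigvec z \<Longrightarrow> ip y x = ip v x"
proof -
  define E where "E x = (if x \<in> eigvec z then x else \<zero>)" for x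
  have E_eig: "E x \<in> eigvec z" for x using eigvec_closed(1) by (simp add: E_def)
  have EV: "E x \<in> V" for x using E_eig eigvecD(2) by blast
  have g: "same_gram E E" using EV by (rule same_gram_refl)
  define y where "y = Tr E E v"
  have yV: "y \<in> V" using Tr_in[OF g v] by (simp add: y_def)
  have yCl: "y \<in> Cl E" using Tr_Cl[OF g v] by (simp add: y_def)
  have "y \<in> perp orbit"
    using yCl Cl_perp[of orbit E] orbit_in E_eig eigvecD(1) by blast
  moreover have "cayley y = z \<odot> y"
  proof (rule ip_eqI)
    fix p assume p: "p \<in> V"
    have "ip (cayley_inv p \<ominus> cnj z \<odot> p) (E x) = 0" for x
      using p EV[of x] eigvecD(3)[OF E_eig[of x]] by (simp add: ip_simps ip_cayley_inv)
    then have "ip y (cayley_inv p \<ominus> cnj z \<odot> p) = 0"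
      using p by (intro ClD(2)[OF yCl]) auto
    then show "ip (cayley y) p = ip (z \<odot> y) p"
      using p yV by (simp add: ip_simps ip_cayley)
  qed (use yV in auto)
  ultimately have "y \<in> eigvec z" by (simp add: eigvec_def)
  moreover have "ip y x = ip v x" if "x \<in> eigvec z" for x
    using Tr_ip[OF g v, of x] that by (simp add: y_def E_def)
  ultimately show ?thesis using that by blast
qed

lemma eigvec_orth: "\<lbrakk>x \<in> eigvec z; y \<in> eigvec z'; z \<noteq> z'\<rbrakk> \<Longrightarrow> ip x y = 0"
  using cayley_eigen_orth eigvecD by metis

text \<open>
  If the eigenvectors are total, a vector is moved to the closed span of fixed unit eigenvectors,
  one for each eigenvalue, by rotating its component in every eigenspace separately.
\<close>
lemma dense_types_eigenvectors:
  assumes cont: "\<not> |UNIV :: real set| \<le>o \<kappa>"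
  shows "\<exists>D\<subseteq>V. |D| \<le>o \<kappa> \<and> (\<forall>v\<in>V. \<forall>e>0.
    \<exists>d\<in>D. \<exists>w v'. (d, w) \<in> same_type \<and> (v, v') \<in> same_type \<and> nm (v' \<ominus> w) < e)"
proof -
  define Z where "Z = {z. \<exists>y\<in>V. y \<noteq> \<zero> \<and> cayley y = z \<odot> y}"
  define f where "f z = (if \<exists>y\<in>eigvec z. nm y = 1 then SOME y. y \<in> eigvec z \<and> nm y = 1 else \<zero>)" for z
  have f_eig: "f z \<in> eigvec z" for z
    using someI_ex[of "\<lambda>y. y \<in> eigvec z \<and> nm y = 1"] eigvec_closed(1) by (auto simp: f_def)
  have f_unit: "nm (f z) = 1" if "y \<in> eigvec z" "y \<noteq> \<zero>" for y z
  proof -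
    have yV: "y \<in> V" using that eigvecD by blast
    have "nm (of_real (1 / nm y) \<odot> y) = 1"
      using yV nm_pos[OF yV that(2)] by (simp add: norm_divide)
    then have "\<exists>y\<in>eigvec z. nm y = 1" using eigvec_closed(2)[OF that(1)] by blast
    then show ?thesis
      using someI_ex[of "\<lambda>y. y \<in> eigvec z \<and> nm y = 1"] by (auto simp: f_def)
  qed
  have fV: "f z \<in> V" for z using f_eig eigvecD(2) by blast
  have f_off: "f z = \<zero>" if "z \<notin> Z" for z
    using that f_eig[of z] fV[of z] eigvecD(3)[of "f z" z] by (auto simp: Z_def)
  have cardZ: "|Z| \<le>o \<kappa>"
    using card_cayley_eigenvalues spec unfolding Z_def by (rule ordLeq_transitive)
  obtain W where W: "W \<subseteq> Cl f" "|W| \<le>o \<kappa>" "\<And>xs e. e > 0 \<Longrightarrow> \<exists>d\<in>W. nm (lc f xs \<ominus> d) < e"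
    by (rule small_dense_combinations[OF \<kappa> cardZ, of f]) (use fV f_off in auto)
  obtain D0 where D0: "D0 \<subseteq> Cl orbit" "|D0| \<le>o \<kappa>"
    "\<And>v e. \<lbrakk>v \<in> V; e > 0\<rbrakk> \<Longrightarrow> \<exists>d\<in>D0. nm (proj v \<ominus> d) < e"
    by (rule proj_approx) (rule that)
  define D where "D = (\<lambda>(x, y). x \<oplus> y) ` (D0 \<times> W)"
  have card: "|D| \<le>o \<kappa>"
    unfolding D_def by (intro card_vector_sums D0(2) W(2))
  have D0V: "D0 \<subseteq> V" and WV: "W \<subseteq> V" using D0(1) W(1) ClD(1) by blast+
  have DV: "D \<subseteq> V" using WV D0V by (auto simp: D_def)
  have "\<exists>d\<in>D. \<exists>w v'. (d, w) \<in> same_type \<and> (v, v') \<in> same_type \<and> nm (v' \<ominus> w) < e"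
    if v: "v \<in> V" and e: "e > 0" for v e
  proof -
    define u where "u = v \<ominus> proj v"
    have u: "u \<in> perp orbit" using minus_proj_perp[OF v] by (simp add: u_def)
    have uV: "u \<in> V" using u by (rule perp_in)
    have "\<exists>y. y \<in> eigvec z \<and> (\<forall>x\<in>eigvec z. ip y x = ip u x)" for z
      by (rule eigen_component[OF uV, of z]) blast
    then obtain a where a: "\<And>z. a z \<in> eigvec z" "\<And>z x. x \<in> eigvec z \<Longrightarrow> ip (a z) x = ip u x"
      by metis
    have aV: "a z \<in> V" for z using a(1) eigvecD(2) by blast
    define b where "b z = of_real (nm (a z)) \<odot> f z" for z
    have b_eig: "b z \<in> eigvec z" for z using f_eig eigvec_closed(2) by (simp add: b_def)
    have bV: "b z \<in> V" for z using b_eig eigvecD(2) by blast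
    have ab: "compat a b"
      unfolding compat_def same_gram_def
    proof (intro conjI allI aV bV)
      fix z z'
      show "ip (a z) (a z') = ip (b z) (b z')"
      proof (cases "z = z'")
        case True
        have "nm (b z) = nm (a z)"
          using fV f_unit[OF a(1)] aV nm_eq_0[OF aV] by (cases "a z = \<zero>") (auto simp: b_def)
        then show ?thesis using True aV bV by (simp add: ip_self)
      next
        case False
        show ?thesis
          using eigvec_orth[OF a(1) a(1) False] eigvec_orth[OF b_eig b_eig False] by simp
      qed
      show "\<exists>k s. cayley (a z) = s \<odot> a k \<and> cayley (b z) = s \<odot> b k"
        using eigvecD(3)[OF a(1)] eigvecD(3)[OF b_eig] by blast
      show "\<exists>k s. cayley_inv (a z) = s \<odot> a k \<and> cayley_inv (b z) = s \<odot> b k"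
        using cayley_eigen_inv[OF aV eigvecD(3)[OF a(1)]] cayley_eigen_inv[OF bV eigvecD(3)[OF b_eig]]
        by blast
    qed
    have gab: "same_gram a b" and ga: "same_gram a a"
      using ab compat_self by (auto intro: compat_gram)
    have uCl: "u \<in> Cl a"
    proof -
      define r where "r = u \<ominus> Tr a a u"
      have TV: "Tr a a u \<in> V" using Tr_in[OF ga uV] .
      have TCl: "Tr a a u \<in> Cl a" using Tr_Cl[OF ga uV] .
      have rV: "r \<in> V" using uV TV by (simp add: r_def)
      have "Tr a a u \<in> perp orbit"
        using TCl Cl_perp[of orbit a] orbit_in a(1) eigvecD(1) by blast
      then have rp: "r \<in> perp orbit" using u perp_orbit(3) by (simp add: r_def)
      have ra: "ip r (a z) = 0" for z
        using uV TV aV Tr_ip[OF ga uV] by (simp add: r_def ip_simps)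
      have "ip r x = 0" if x: "x \<in> eigvec z" for x z
      proof -
        have xV: "x \<in> V" using x by (rule eigvecD)
        \<comment> \<open>The part of \<open>x\<close> orthogonal to \<open>a z\<close> is orthogonal to all of \<open>a\<close>, and to \<open>u\<close>. If \<open>a z\<close> is zero,
          then \<open>s = 0\<close> by division by zero, as it should be.\<close>
        define s where "s = ip x (a z) / ip (a z) (a z)"
        define x' where "x' = x \<ominus> s \<odot> a z"
        have x': "x' \<in> eigvec z" using x a(1) eigvec_closed by (simp add: x'_def)
        have x'V: "x' \<in> V" using x' by (rule eigvecD)
        have x'z: "ip x' (a z) = 0"
          using xV aV cinner_eq_0[OF aV[of z]] by (cases "a z = \<zero>") (auto simp: x'_def s_def ip_simps)
        have x'a: "ip x' (a z') = 0" for z'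
          using x'z eigvec_orth[OF x' a(1)] by (cases "z' = z") auto
        have "ip (Tr a a u) x' = 0"
          using x'V x'a by (rule ClD(2)[OF TCl])
        moreover have "ip u x' = 0"
          using a(2)[OF x'] x'z ip_eq_0_commute[OF x'V aV[of z]] by simp
        ultimately have "ip r x' = 0" using uV TV x'V by (simp add: r_def ip_simps)
        then show ?thesis
          using rV xV aV ra by (simp add: x'_def ip_simps)
      qed
      then have "r = \<zero>" using eigenvectors_total[OF cont rp] by blast
      then have "u = Tr a a u" using minus_eq_zeroD[OF uV TV] by (simp add: r_def)
      then show ?thesis using TCl by simp
    qed
    define u' where "u' = Tr a b u"
    have u'V: "u' \<in> V" using Tr_in[OF gab uV] by (simp add: u'_def)
    have "(proj v \<oplus> u, proj v \<oplus> u') \<in> same_type"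
    proof (rule same_typeI[OF ab])
      show "u' \<in> Cl b" using Tr_Cl[OF gab uV] by (simp add: u'_def)
      show "ip u (a i) = ip u' (b i)" for i using Tr_ip[OF gab uV] by (simp add: u'_def)
    qed (use a(1) b_eig eigvecD(1) uCl Tr_Cl[OF orbit_gram v] in auto)
    then have t: "(v, proj v \<oplus> u') \<in> same_type"
      using proj_decomp[OF v] by (simp add: u_def)
    obtain g where g: "g \<in> D0" "nm (proj v \<ominus> g) < e / 3" using D0(3)[OF v, of "e/3"] e by auto
    obtain xs where xs: "nm (u' \<ominus> lc b xs) < e / 3"
      using Tr_approx[OF gab uV, of "e/3"] e by (auto simp: u'_def)
    have "lc b xs = lc f (map (\<lambda>(t, z). (t * of_real (nm (a z)), z)) xs)"
    proof (induction xs)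
      case (Cons p xs)
      have "fst p \<odot> b (snd p) = (fst p * of_real (nm (a (snd p)))) \<odot> f (snd p)"
        using fV by (intro ip_eqI) (auto simp: b_def ip_simps)
      then show ?case using Cons by (simp add: case_prod_beta)
    qed simp
    then obtain w where w: "w \<in> W" "nm (lc b xs \<ominus> w) < e / 3"
      using W(3)[of "e/3" "map (\<lambda>(t, z). (t * of_real (nm (a z)), z)) xs"] e by auto
    have V: "g \<in> V" "w \<in> V" "lc b xs \<in> V" "proj v \<in> V"
      using g(1) w(1) D0V WV bV proj_in[OF v] by auto
    have "proj v \<oplus> u' \<ominus> (g \<oplus> w) = (proj v \<ominus> g) \<oplus> (u' \<ominus> w)"
      using V u'V by (intro ip_eqI) (auto simp: ip_simps)
    then have "nm (proj v \<oplus> u' \<ominus> (g \<oplus> w)) \<le> nm (proj v \<ominus> g) + nm (u' \<ominus> w)"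
      using nm_triangle[of "proj v \<ominus> g" "u' \<ominus> w"] V u'V by simp
    moreover have "nm (u' \<ominus> w) \<le> nm (u' \<ominus> lc b xs) + nm (lc b xs \<ominus> w)"
      using V u'V by (intro nm_diff_triangle)
    ultimately have "nm (proj v \<oplus> u' \<ominus> (g \<oplus> w)) < e"
      using g(2) xs w(2) by linarith
    moreover have "g \<oplus> w \<in> D" using g(1) w(1) by (auto simp: D_def)
    moreover have "(g \<oplus> w, g \<oplus> w) \<in> same_type" using V by (intro same_type_refl) auto
    ultimately show ?thesis using t by blast
  qed
  then show ?thesis using DV card by blast
qed

end

theorem theorem6p8:
  fixes M Mt :: "'a hilb_op" and kstar :: "'a rel" and \<kappa> :: "'k rel"
  assumes "sa_structure M" and "unbounded_op M"
    and "monster_model M kstar Mt"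
    and "Cinfinite \<kappa>" and "\<kappa> <o kstar"
    and "|spectrum M| \<le>o \<kappa>"
  shows "kappa_stable M Mt \<kappa>"
  unfolding kappa_stable_def
proof (intro allI impI)
  fix G assume G: "G \<subseteq> carrier Mt" "|G| \<le>o \<kappa>"
  have K: "Mt \<in> K_class M" using assms(3) by (simp add: monster_model_def)
  then have sa: "sa_structure Mt" and spec: "spectrum Mt = spectrum M"
    by (auto simp: K_class_def spectrally_equivalent_def)
  interpret type_setting Mt M G
    using sa K G(1)
    by (simp add: type_setting_def type_setting_axioms_def sa_op_def sa_op_axioms_def
      sa_structure_def self_adjoint_def)
  show "\<exists>D\<subseteq>galois_types M Mt G. |D| \<le>o \<kappa> \<and>
      (\<forall>p\<in>galois_types M Mt G. \<forall>e>0. \<exists>q\<in>D. type_dist Mt p q < e)"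
  proof (cases "|carrier Mt| \<le>o \<kappa>")
    case True
    \<comment> \<open>There are at most \<open>\<kappa>\<close> types at all.\<close>
    show ?thesis
    proof (rule dense_types[OF subset_refl True])
      fix v e assume v: "v \<in> V" and e: "(e::real) > 0"
      show "\<exists>d\<in>V. \<exists>w v'. (d, w) \<in> same_type \<and> (v, v') \<in> same_type \<and> nm (v' \<ominus>\<^bsub>Mt\<^esub> w) < e"
        using same_type_refl[OF v] v e
        by (intro bexI[of _ v] exI[of _ v]) auto
    qed
  next
    case False
    have wo: "Well_order \<kappa>" using assms(4) by (auto simp: card_order_on_def)
    have large: "\<kappa> <o |carrier Mt|"
      using False not_ordLeq_iff_ordLess[OF wo card_of_Well_order] by blast
    interpret small_parameters Mt M G \<kappa>
      using assms(4,6) G(2) large spec by unfold_locales auto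
    have "\<exists>D\<subseteq>V. |D| \<le>o \<kappa> \<and> (\<forall>v\<in>V. \<forall>e>0.
        \<exists>d\<in>D. \<exists>w v'. (d, w) \<in> same_type \<and> (v, v') \<in> same_type \<and> nm (v' \<ominus>\<^bsub>Mt\<^esub> w) < e)"
      by (cases "|UNIV :: real set| \<le>o \<kappa>")
        (rule dense_types_continuum dense_types_eigenvectors; assumption)+
    then obtain D where D: "D \<subseteq> V" "|D| \<le>o \<kappa>" "\<forall>v\<in>V. \<forall>e>0.
        \<exists>d\<in>D. \<exists>w v'. (d, w) \<in> same_type \<and> (v, v') \<in> same_type \<and> nm (v' \<ominus>\<^bsub>Mt\<^esub> w) < e"
      by (elim exE conjE)
    show ?thesis by (rule dense_types[OF D(1,2) D(3)[rule_format]])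
  qed
qed

end
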